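(* Let $f\in\ell(z)$ be a rational function of degree $d\ge2$, and let $\Gamma$ be an $\ell$-split vertex set in $\mathbf{P}^1_{\mathrm{Berk},k}$. Then there exists an $\ell$-split vertex set $\Gamma'\supseteq\Gamma$ such that for each $\zeta\in\Gamma'$ exactly one of the following holds: (i) $f(\zeta)\in\Gamma'$; (ii) $f(\zeta)$ lies in a wandering $F$-disk (relative to $\Gamma'$) whose boundary point is periodic and belongs to $\Gamma'$; (iii) $f(\zeta)$ lies in an $F$-disk (relative to $\Gamma'$) that contains an attracting type I periodic point. In particular, $(f,\Gamma')$ is analytically stable.
   Context: $\ell$ is a discretely valued field with residue characteristic zero, $\hat\ell$ its completion, $k$ the completion of an algebraic closure of $\hat\ell$, and $\mathbf{P}^1_{\mathrm{Berk},k}$ the Berkovich projective line over $k$. A vertex set is a finite nonempty set $\Gamma$ of type II points; connected components of the complement of $\Gamma$ are $\Gamma$-domains, and a $\Gamma$-domain with one boundary point is a $\Gamma$-disk. A $\Gamma$-domain $U$ is an $F$-domain ($F$-disk if it is a $\Gamma$-disk) if $f^n(U)\cap\Gamma=\varnothing$ for all $n\ge1$. Under analytic stability, the image of an $F$-domain lies in an $F$-domain; the forward orbit of an $F$-domain $U$ is the set of $F$-domains $V$ with $f^n(U)\subseteq V$ for some $n\ge0$, and $U$ is wandering if this set is infinite. $(f,\Gamma)$ is analytically stable if for each $\zeta\in\Gamma$, either $f(\zeta)\in\Gamma$ or $f(\zeta)$ lies in some $F$-domain. A type II point is $\ell$-split if it equals $\zeta_{a,r}$ (the sup-norm point of $\{x\in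 k:|x-a|\le r\}$) with $a\in\ell$, $r\in|\ell^\times|$; a vertex set is $\ell$-split if all its elements are. *)

theory Defs
  imports "HOL-Analysis.Analysis" "HOL-Computational_Algebra.Polynomial"
begin

text \<open>The field k is modelled as a type 'k with an absolute value absv; the
  field ell is a subset of k (a subfield).  berk_setting absv L expresses:
  absv is a non-archimedean absolute value on k, k is complete and algebraically
  closed, L is a subfield of k on which absv is discretely valued (value group
  generated by one element of absolute value in (0,1)) with residue
  characteristic zero, and the elements of k algebraic over the closure of L
  (which is the completion of L) are dense in k; i.e. k is the completion of an
  algebraic closure of the completion of L.\<close>

definition nonarch_absval :: "('k::field \<Rightarrow> real) \<Rightarrow> bool" where
  "nonarch_absval absv \<longleftrightarrow>
     (\<forall>x. absv x \<ge> 0) \<and> (\<forall>x. absv x = 0 \<longleftrightarrow> x = 0) \<and>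
     (\<forall>x y. absv (x * y) = absv x * absv y) \<and>
     (\<forall>x y. absv (x + y) \<le> max (absv x) (absv y))"

definition absv_complete :: "('k::field \<Rightarrow> real) \<Rightarrow> bool" where
  "absv_complete absv \<longleftrightarrow>
     (\<forall>s :: nat \<Rightarrow> 'k. (\<forall>e>0. \<exists>N. \<forall>m\<ge>N. \<forall>n\<ge>N. absv (s m - s n) < e) \<longrightarrow>
        (\<exists>x. \<forall>e>0. \<exists>N. \<forall>n\<ge>N. absv (s n - x) < e))"

definition alg_closed_field :: "'k::field itself \<Rightarrow> bool" where
  "alg_closed_field _ \<longleftrightarrow> (\<forall>p :: 'k poly. degree p \<ge> 1 \<longrightarrow> (\<exists>x. poly p x = 0))"

definition is_subfield :: "'k::field set \<Rightarrow> bool" where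
  "is_subfield L \<longleftrightarrow> 0 \<in> L \<and> 1 \<in> L \<and> (\<forall>x\<in>L. \<forall>y\<in>L. x + y \<in> L \<and> x * y \<in> L \<and> - x \<in> L) \<and>
     (\<forall>x\<in>L. x \<noteq> 0 \<longrightarrow> inverse x \<in> L)"

definition discretely_valued :: "('k::field \<Rightarrow> real) \<Rightarrow> 'k set \<Rightarrow> bool" where
  "discretely_valued absv L \<longleftrightarrow>
     (\<exists>\<pi>\<in>L. 0 < absv \<pi> \<and> absv \<pi> < 1 \<and> absv ` (L - {0}) = {absv \<pi> powi n | n. True})"

definition residue_char_zero :: "('k::field \<Rightarrow> real) \<Rightarrow> bool" where
  "residue_char_zero absv \<longleftrightarrow> (\<forall>n::nat. n \<ge> 1 \<longrightarrow> absv (of_nat n) = 1)"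

definition absv_closure :: "('k::field \<Rightarrow> real) \<Rightarrow> 'k set \<Rightarrow> 'k set" where
  "absv_closure absv S = {x. \<forall>e>0. \<exists>y\<in>S. absv (x - y) < e}"

definition algebraic_over :: "'k::field set \<Rightarrow> 'k \<Rightarrow> bool" where
  "algebraic_over S x \<longleftrightarrow> (\<exists>p. p \<noteq> 0 \<and> set (coeffs p) \<subseteq> S \<and> poly p x = 0)"

definition berk_setting :: "('k::field \<Rightarrow> real) \<Rightarrow> 'k set \<Rightarrow> bool" where
  "berk_setting absv L \<longleftrightarrow>
     nonarch_absval absv \<and> absv_complete absv \<and> alg_closed_field TYPE('k) \<and>
     is_subfield L \<and> discretely_valued absv L \<and> residue_char_zero absv \<and>
     absv_closure absv {x. algebraic_over (absv_closure absv L) x} = UNIV"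

datatype 's berk_pt = Fin 's | Inf

type_synonym 'k berk = "('k poly \<Rightarrow> real) berk_pt"

definition berk_seminorm :: "('k::field \<Rightarrow> real) \<Rightarrow> ('k poly \<Rightarrow> real) \<Rightarrow> bool" where
  "berk_seminorm absv s \<longleftrightarrow>
     (\<forall>p. s p \<ge> 0) \<and> (\<forall>c. s [:c:] = absv c) \<and>
     (\<forall>p q. s (p * q) = s p * s q) \<and> (\<forall>p q. s (p + q) \<le> s p + s q)"

definition BP :: "('k::field \<Rightarrow> real) \<Rightarrow> 'k berk set" where
  "BP absv = insert Inf (Fin ` {s. berk_seminorm absv s})"

text \<open>Topology: on the affine part the weakest topology making all
  evaluations |g|_zeta continuous (Gelfand topology); neighbourhoods of infinity
  are the complements of closed disks D(0,R), i.e. P^1_Berk is the one-point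
  compactification of A^1_Berk.\<close>

definition berk_subbasis :: "('k::field \<Rightarrow> real) \<Rightarrow> 'k berk set set" where
  "berk_subbasis absv =
     {{Fin s | s. berk_seminorm absv s \<and> s g \<in> U} | g U. open U} \<union>
     {insert Inf {Fin s | s. berk_seminorm absv s \<and> s [:0, 1:] > R} | R. True}"

definition berk_top :: "('k::field \<Rightarrow> real) \<Rightarrow> 'k berk topology" where
  "berk_top absv = subtopology (topology_generated_by (berk_subbasis absv)) (BP absv)"

definition typeI_pt :: "('k::field \<Rightarrow> real) \<Rightarrow> 'k \<Rightarrow> 'k berk" where
  "typeI_pt absv a = Fin (\<lambda>p. absv (poly p a))"

definition is_typeI :: "('k::field \<Rightarrow> real) \<Rightarrow> 'k berk \<Rightarrow> bool" where
  "is_typeI absv z \<longleftrightarrow> z = Inf \<or> (\<exists>a. z = typeI_pt absv a)"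

definition zeta :: "('k::field \<Rightarrow> real) \<Rightarrow> 'k \<Rightarrow> real \<Rightarrow> 'k berk" where
  "zeta absv a r = Fin (\<lambda>p. SUP x\<in>{x. absv (x - a) \<le> r}. absv (poly p x))"

definition is_typeII :: "('k::field \<Rightarrow> real) \<Rightarrow> 'k berk \<Rightarrow> bool" where
  "is_typeII absv z \<longleftrightarrow> (\<exists>a r. r \<in> absv ` (UNIV - {0}) \<and> z = zeta absv a r)"

definition L_split :: "('k::field \<Rightarrow> real) \<Rightarrow> 'k set \<Rightarrow> 'k berk \<Rightarrow> bool" where
  "L_split absv L z \<longleftrightarrow> (\<exists>a\<in>L. \<exists>r \<in> absv ` (L - {0}). z = zeta absv a r)"

definition vertex_set :: "('k::field \<Rightarrow> real) \<Rightarrow> 'k berk set \<Rightarrow> bool" where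
  "vertex_set absv G \<longleftrightarrow> finite G \<and> G \<noteq> {} \<and> (\<forall>z\<in>G. is_typeII absv z)"

definition L_split_vertex_set :: "('k::field \<Rightarrow> real) \<Rightarrow> 'k set \<Rightarrow> 'k berk set \<Rightarrow> bool" where
  "L_split_vertex_set absv L G \<longleftrightarrow> vertex_set absv G \<and> (\<forall>z\<in>G. L_split absv L z)"

text \<open>A rational function is a pair (P, Q) of polynomials, f = P/Q.
  hcomp m g P Q = Q^m * g(P/Q) for m \<ge> degree g.\<close>

definition hcomp :: "nat \<Rightarrow> 'k::field poly \<Rightarrow> 'k poly \<Rightarrow> 'k poly \<Rightarrow> 'k poly" where
  "hcomp m g P Q = (\<Sum>i\<le>m. smult (coeff g i) (P ^ i * Q ^ (m - i)))"

definition rat_deg :: "'k::field poly \<times> 'k poly \<Rightarrow> nat" where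
  "rat_deg f = max (degree (fst f)) (degree (snd f))"

definition rat_over :: "'k::field set \<Rightarrow> 'k poly \<times> 'k poly \<Rightarrow> bool" where
  "rat_over L f \<longleftrightarrow> set (coeffs (fst f)) \<subseteq> L \<and> set (coeffs (snd f)) \<subseteq> L \<and>
     snd f \<noteq> 0 \<and> coprime (fst f) (snd f)"

definition berk_map :: "('k::field \<Rightarrow> real) \<Rightarrow> 'k poly \<times> 'k poly \<Rightarrow> 'k berk \<Rightarrow> 'k berk" where
  "berk_map absv f z = (case z of
      Inf \<Rightarrow> (if degree (fst f) > degree (snd f) then Inf
              else typeI_pt absv (coeff (fst f) (degree (snd f)) / lead_coeff (snd f)))
    | Fin s \<Rightarrow> (if s (snd f) = 0 then Inf
              else Fin (\<lambda>g. s (hcomp (degree g) g (fst f) (snd f)) / s (snd f) ^ degree g)))"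

definition rat_comp :: "'k::field poly \<times> 'k poly \<Rightarrow> 'k poly \<times> 'k poly \<Rightarrow> 'k poly \<times> 'k poly" where
  "rat_comp f g = (hcomp (rat_deg f) (fst f) (fst g) (snd g), hcomp (rat_deg f) (snd f) (fst g) (snd g))"

fun rat_iter :: "'k::field poly \<times> 'k poly \<Rightarrow> nat \<Rightarrow> 'k poly \<times> 'k poly" where
  "rat_iter f 0 = ([:0, 1:], 1)"
| "rat_iter f (Suc n) = rat_comp f (rat_iter f n)"

definition rat_deriv_at :: "'k::field poly \<times> 'k poly \<Rightarrow> 'k \<Rightarrow> 'k" where
  "rat_deriv_at f x = (poly (pderiv (fst f)) x * poly (snd f) x - poly (fst f) x * poly (pderiv (snd f)) x)
                       / (poly (snd f) x) ^ 2"

definition rev_deg :: "nat \<Rightarrow> 'k::zero poly \<Rightarrow> 'k poly" where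
  "rev_deg D p = Poly (map (\<lambda>i. coeff p (D - i)) [0..<Suc D])"

text \<open>Multiplier of g at a fixed type I point z: g'(a) for z = a finite,
  and the derivative at 0 of 1/g(1/w) for z = infinity.\<close>

definition multiplier :: "('k::field \<Rightarrow> real) \<Rightarrow> 'k poly \<times> 'k poly \<Rightarrow> 'k berk \<Rightarrow> 'k" where
  "multiplier absv g z =
     (if z = Inf then rat_deriv_at (rev_deg (rat_deg g) (snd g), rev_deg (rat_deg g) (fst g)) 0
      else rat_deriv_at g (SOME a. z = typeI_pt absv a))"

definition attracting_typeI_periodic ::
    "('k::field \<Rightarrow> real) \<Rightarrow> 'k poly \<times> 'k poly \<Rightarrow> 'k berk \<Rightarrow> bool" where
  "attracting_typeI_periodic absv f z \<longleftrightarrow> is_typeI absv z \<and>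
     (\<exists>n\<ge>1. (berk_map absv f ^^ n) z = z \<and> absv (multiplier absv (rat_iter f n) z) < 1)"

definition periodic_pt :: "('k::field \<Rightarrow> real) \<Rightarrow> 'k poly \<times> 'k poly \<Rightarrow> 'k berk \<Rightarrow> bool" where
  "periodic_pt absv f z \<longleftrightarrow> (\<exists>n\<ge>1. (berk_map absv f ^^ n) z = z)"

definition Gamma_domain :: "('k::field \<Rightarrow> real) \<Rightarrow> 'k berk set \<Rightarrow> 'k berk set \<Rightarrow> bool" where
  "Gamma_domain absv G U \<longleftrightarrow>
     U \<in> connected_components_of (subtopology (berk_top absv) (BP absv - G))"

definition Gamma_disk :: "('k::field \<Rightarrow> real) \<Rightarrow> 'k berk set \<Rightarrow> 'k berk set \<Rightarrow> bool" where
  "Gamma_disk absv G U \<longleftrightarrow> Gamma_domain absv G U \<and> (\<exists>b. berk_top absv frontier_of U = {b})"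

definition F_domain :: "('k::field \<Rightarrow> real) \<Rightarrow> 'k poly \<times> 'k poly \<Rightarrow> 'k berk set \<Rightarrow> 'k berk set \<Rightarrow> bool" where
  "F_domain absv f G U \<longleftrightarrow> Gamma_domain absv G U \<and>
     (\<forall>n\<ge>1. (berk_map absv f ^^ n) ` U \<inter> G = {})"

definition F_disk :: "('k::field \<Rightarrow> real) \<Rightarrow> 'k poly \<times> 'k poly \<Rightarrow> 'k berk set \<Rightarrow> 'k berk set \<Rightarrow> bool" where
  "F_disk absv f G U \<longleftrightarrow> F_domain absv f G U \<and> Gamma_disk absv G U"

definition forward_orbit :: "('k::field \<Rightarrow> real) \<Rightarrow> 'k poly \<times> 'k poly \<Rightarrow> 'k berk set \<Rightarrow> 'k berk set \<Rightarrow> 'k berk set set" where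
  "forward_orbit absv f G U = {V. F_domain absv f G V \<and> (\<exists>n. (berk_map absv f ^^ n) ` U \<subseteq> V)}"

definition wandering :: "('k::field \<Rightarrow> real) \<Rightarrow> 'k poly \<times> 'k poly \<Rightarrow> 'k berk set \<Rightarrow> 'k berk set \<Rightarrow> bool" where
  "wandering absv f G U \<longleftrightarrow> infinite (forward_orbit absv f G U)"

definition analytically_stable :: "('k::field \<Rightarrow> real) \<Rightarrow> 'k poly \<times> 'k poly \<Rightarrow> 'k berk set \<Rightarrow> bool" where
  "analytically_stable absv f G \<longleftrightarrow>
     (\<forall>z\<in>G. berk_map absv f z \<in> G \<or> (\<exists>U. F_domain absv f G U \<and> berk_map absv f z \<in> U))"

end

theory Submission
  imports Defs
begin

text \<open>The L-split points are the vertices of a tree, rooted at the Gauss point, on which f acts. To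
  a vertex t other than the root belongs the open disk D(t) that is attached to the parent of t and
  contains t; it avoids the root. For all t outside a finite set B, f maps D(t) into such a disk
  again, and if D(t) contains no critical point, f maps the edge above t onto a single edge; this
  is where residue characteristic zero enters.

  Let z be a vertex with infinite orbit, z(n) its n-th image, and t(n) the topmost ancestor of z(n)
  whose orbit is infinite and never meets B. The t(n) are equal or incomparable. If two of them
  agree, some iterate of f maps a disk D(t) strictly into itself, and by completeness it contains
  an attracting fixed point of that iterate. Otherwise the disks D(t(n)) are disjoint, so
  eventually free of critical points. Then either the parent of t(n) lies in B infinitely often,
  which again leads to a contracting disk, or the parents form a cycle and the D(t(n)) are wandering
  disks attached to it. A finite set is made stable by adding the boundary points of the disks
  obtained in this way, and the orbits of its points up to their first entry into one of them.\<close>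

section \<open>Seminorms on polynomials over a non-archimedean field\<close>

text \<open>Residue characteristic zero means that every positive integer has absolute value 1. It
  is used twice. Distinct integers lie in distinct residue classes, so a polynomial attains its norm
  on a disk with split data at a point \<open>a + \<rho> * of_nat i\<close> of \<open>L\<close>;
  hence \<open>f\<close> maps split points to split points. And differentiation preserves the
  absolute values of coefficients up to the shift of index, so the Wronskian measures exactly how
  \<open>f\<close> scales radii. Discreteness makes the split points a tree with integral heights,
  in which topmost ancestors exist.

  The obstacle is that \<open>f\<close> does not respect the order of this tree near its zeros and
  poles. Order is preserved only below vertices outside the finite set \<open>B\<close>, and even
  there the image disk of \<open>t\<close>, attached to \<open>f (par t)\<close>, may contain
  \<open>f t\<close> several levels below its top. This is why \<open>f\<close> on points and
  \<open>g\<close> on disks are kept apart. Moreover the boundary point of a disk may lie in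
  \<open>B\<close> although the disk does not, and the tree argument has to cope with such boundary
  points throughout.\<close>

definition Lin :: "'k::comm_ring_1 \<Rightarrow> 'k poly" where "Lin a = [:- a, 1:]"

locale nonarch_field =
  fixes av :: "'k::field \<Rightarrow> real"
  assumes nonarch: "nonarch_absval av" and alg_closed: "alg_closed_field TYPE('k)"
    and residue_char: "residue_char_zero av"
begin

lemma av_nonneg [simp]: "av x \<ge> 0" and av_eq_0 [simp]: "av x = 0 \<longleftrightarrow> x = 0"
  and av_mult: "av (x * y) = av x * av y" and av_add: "av (x + y) \<le> max (av x) (av y)"
  using nonarch unfolding nonarch_absval_def by auto

lemma av_0 [simp]: "av 0 = 0" by simp
lemma av_pos [simp]: "av x > 0 \<longleftrightarrow> x \<noteq> 0" using av_nonneg[of x] av_eq_0[of x] by linarith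
lemma av_1 [simp]: "av 1 = 1"
  using av_mult[of 1 1] av_eq_0[of 1] by (metis mult_cancel_left2 mult_1_right one_neq_zero)
lemma av_minus [simp]: "av (- x) = av x"
proof -
  have "av (-1) * av (-1) = 1" using av_mult[of "-1" "-1"] by simp
  then have "av (-1) = 1" using av_nonneg[of "-1"] by (metis abs_of_nonneg real_sqrt_abs2 real_sqrt_one)
  then show ?thesis using av_mult[of "-1" x] by simp
qed
lemma av_diff: "av (x - y) \<le> max (av x) (av y)" using av_add[of x "- y"] by simp
lemma av_commute: "av (x - y) = av (y - x)" using av_minus[of "x - y"] by simp
lemma av_power: "av (x ^ n) = av x ^ n" by (induction n) (auto simp: av_mult)
lemma av_inverse: "av (inverse x) = inverse (av x)"
proof (cases "x = 0")
  case False
  then have "av x * av (inverse x) = 1" using av_mult[of x "inverse x"] by simp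
  then show ?thesis by (simp add: inverse_unique)
qed auto
lemma av_divide: "av (x / y) = av x / av y"
  by (simp add: divide_inverse av_mult av_inverse)
lemma av_add_eq: "av x < av y \<Longrightarrow> av (x + y) = av y"
  using av_add[of x y] av_diff[of "x + y" x] by auto
lemma av_diff_eq: "av x < av y \<Longrightarrow> av (x - y) = av y"
  using av_add_eq[of x "- y"] by simp
lemma av_diff_eq2: "av x < av y \<Longrightarrow> av (y - x) = av y"
  using av_diff_eq[of x y] av_commute by metis
lemma av_nat: "n \<ge> 1 \<Longrightarrow> av (of_nat n) = 1"
  using residue_char unfolding residue_char_zero_def by auto
lemma av_nat_le: "av (of_nat n) \<le> 1"
  using av_nat[of n] by (cases n) auto
lemma of_nat_ne: "n \<ge> 1 \<Longrightarrow> (of_nat n :: 'k) \<noteq> 0" using av_nat[of n] by auto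
lemma av_ultra: "av (x - z) \<le> max (av (x - y)) (av (y - z))"
  using av_add[of "x - y" "y - z"] by simp

lemma poly_root: "degree (p :: 'k poly) \<ge> 1 \<Longrightarrow> \<exists>x. poly p x = 0"
  using alg_closed unfolding alg_closed_field_def by auto

text \<open>Algebraic closedness enters through this induction over linear factors: a multiplicative
  function on polynomials is governed by its values on constants and on the
  \<open>Lin a\<close>.\<close>

lemma poly_lin_induct [case_names const lin]:
  fixes p :: "'k poly"
  assumes "\<And>c. P [:c:]" and "\<And>a q. q \<noteq> 0 \<Longrightarrow> P q \<Longrightarrow> P (Lin a * q)"
  shows "P p"
proof (induction "degree p" arbitrary: p)
  case 0
  then show ?case using assms(1) by (metis degree_eq_zeroE)
next
  case (Suc n)
  then obtain a where "poly p a = 0" using poly_root[of p] by auto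
  then obtain q where q: "p = Lin a * q" unfolding Lin_def by (meson dvdE poly_eq_0_iff_dvd)
  have "q \<noteq> 0" using Suc q by auto
  moreover have "degree p = Suc (degree q)" unfolding q Lin_def
    using \<open>q \<noteq> 0\<close> by (subst degree_mult_eq) auto
  ultimately show ?case using Suc assms(2) q by auto
qed

lemma poly_Lin [simp]: "poly (Lin a) x = x - a" for x a :: 'k by (simp add: Lin_def)
lemma Lin_ne_0 [simp]: "Lin (a :: 'k) \<noteq> 0" by (simp add: Lin_def)
lemma Lin_0: "Lin (0 :: 'k) = [:0, 1:]" by (simp add: Lin_def)
lemma Lin_diff: "Lin a + [:a - b:] = Lin b" for a b :: 'k by (simp add: Lin_def)

abbreviation "sn \<equiv> berk_seminorm av"

context
  fixes s :: "'k poly \<Rightarrow> real"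
  assumes s: "sn s"
begin

lemma sn_nonneg [simp]: "s p \<ge> 0" and sn_const [simp]: "s [:c:] = av c"
  and sn_mult: "s (p * q) = s p * s q" and sn_add: "s (p + q) \<le> s p + s q"
  using s unfolding berk_seminorm_def by auto

lemma sn_0 [simp]: "s 0 = 0" using sn_const[of 0] by simp
lemma sn_1 [simp]: "s 1 = 1" using sn_const[of 1] by (simp add: one_pCons)
lemma sn_smult: "s (smult c p) = av c * s p"
  using sn_mult[of "[:c:]" p] by simp
lemma sn_minus [simp]: "s (- p) = s p"
  using sn_smult[of "-1" p] by simp
lemma sn_power: "s (p ^ n) = s p ^ n" by (induction n) (auto simp: sn_mult)
lemma sn_sum: "s (sum p I) \<le> (\<Sum>i\<in>I. s (p i))"
  by (induction I rule: infinite_finite_induct) (auto intro: order_trans[OF sn_add])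

lemma sn_of_nat: "s (of_nat n) \<le> 1"
  using sn_const[of "of_nat n"] av_nat_le by (simp add: of_nat_poly)

text \<open>Only subadditivity is assumed of a seminorm. Expanding \<open>(p + q) ^ n\<close>, whose
  binomial coefficients have seminorm at most 1, gives
  \<open>s (p + q) ^ n \<le> (n + 1) * M ^ n\<close>; the powers of a number above 1 would outgrow
  \<open>n + 1\<close>.\<close>

lemma sn_ultra: "s (p + q) \<le> max (s p) (s q)"
proof (rule ccontr)
  define M where "M = max (s p) (s q)"
  assume "\<not> ?thesis"
  then have M: "s (p + q) > M" unfolding M_def by (simp only: not_le)
  have M0: "M \<ge> 0" by (simp add: M_def le_max_iff_disj)
  have *: "s (p + q) ^ n \<le> (real n + 1) * M ^ n" for n
  proof -
    have "s (p + q) ^ n = s (\<Sum>k\<le>n. of_nat (n choose k) * p ^ k * q ^ (n - k))"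
      by (simp add: sn_power[symmetric] binomial_ring)
    also have "\<dots> \<le> (\<Sum>k\<le>n. s (of_nat (n choose k) * p ^ k * q ^ (n - k)))" by (rule sn_sum)
    also have "\<dots> \<le> (\<Sum>k\<le>n. M ^ n)"
    proof (rule sum_mono)
      fix k assume k: "k \<in> {..n}"
      have "s (of_nat (n choose k) * p ^ k * q ^ (n - k)) = s (of_nat (n choose k)) * s p ^ k * s q ^ (n - k)"
        by (simp add: sn_mult sn_power)
      also have "\<dots> \<le> 1 * M ^ k * M ^ (n - k)"
        by (intro mult_mono power_mono) (auto simp: M_def sn_of_nat le_max_iff_disj)
      also have "\<dots> = M ^ n" using k by (simp add: power_add[symmetric])
      finally show "s (of_nat (n choose k) * p ^ k * q ^ (n - k)) \<le> M ^ n" .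
    qed
    finally show ?thesis by (simp add: algebra_simps)
  qed
  have "M > 0"
  proof (rule ccontr)
    assume "\<not> M > 0" then have "M = 0" using M0 by simp
    then show False using *[of 1] M by simp
  qed
  define x where "x = s (p + q) / M"
  have x: "x > 1" using M \<open>M > 0\<close> by (simp add: x_def)
  have "x ^ n \<le> real n + 1" for n using *[of n] \<open>M > 0\<close> by (simp add: x_def power_divide field_simps)
  moreover obtain n where "real n + 1 < x ^ n"
  proof -
    have "((\<lambda>n. (real n + 1) / x ^ n) \<longlongrightarrow> 0) sequentially"
      using tendsto_add[OF lim_n_over_pown[of x] LIMSEQ_inverse_realpow_zero[OF x]] x
      by (simp add: add_divide_distrib inverse_eq_divide)
    then have "eventually (\<lambda>n. (real n + 1) / x ^ n < 1) sequentially"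
      by (rule order_tendstoD) auto
    then obtain n where "(real n + 1) / x ^ n < 1" by (auto simp: eventually_sequentially)
    then show ?thesis using that[of n] x by (simp add: field_simps)
  qed
  ultimately show False by (metis not_le)
qed

lemma sn_ultra_eq: "s p < s q \<Longrightarrow> s (p + q) = s q"
  using sn_ultra[of p q] sn_ultra[of "p + q" "- p"] by auto

lemma sn_diff: "s (p - q) \<le> max (s p) (s q)" using sn_ultra[of p "- q"] by simp

lemma sn_Lin: "s (Lin b) \<le> max (s (Lin a)) (av (a - b))"
  using sn_ultra[of "Lin a" "[:a - b:]"] by (simp add: Lin_diff)

lemma sn_Lin_eq: "s (Lin a) < av (a - b) \<Longrightarrow> s (Lin b) = av (a - b)"
  using sn_ultra_eq[of "Lin a" "[:a - b:]"] by (simp add: Lin_diff)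

lemma sn_Lin_eq2: "s (Lin a) > av (a - b) \<Longrightarrow> s (Lin b) = s (Lin a)"
  using sn_ultra_eq[of "[:a - b:]" "Lin a"] by (simp add: Lin_diff add.commute)

lemma sn_zero_root: "s p = 0 \<Longrightarrow> p \<noteq> 0 \<Longrightarrow> \<exists>a. s (Lin a) = 0 \<and> poly p a = 0"
proof (induction p rule: poly_lin_induct)
  case (lin a q)
  then show ?case by (auto simp: sn_mult)
qed auto

end

lemma sn_eqI:
  assumes "sn s" "sn s'" "\<And>a. s (Lin a) = s' (Lin a)" shows "s = s'"
proof
  show "s p = s' p" for p
    by (induction p rule: poly_lin_induct) (auto simp: assms sn_mult[OF assms(1)] sn_mult[OF assms(2)] sn_const[OF assms(1)] sn_const[OF assms(2)])
qed

section \<open>Gauss norms and the seminorms attached to disks\<close>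

definition gn :: "real \<Rightarrow> 'k poly \<Rightarrow> real" where
  "gn r p = Max ((\<lambda>i. av (coeff p i) * r ^ i) ` {..degree p})"

lemma gn_ge: "r \<ge> 0 \<Longrightarrow> av (coeff p i) * r ^ i \<le> gn r p"
proof (cases "i \<le> degree p")
  case False
  assume r: "r \<ge> 0"
  have "0 \<le> av (coeff p 0) * r ^ 0" by simp
  also have "\<dots> \<le> gn r p" unfolding gn_def by (rule Max_ge) (simp, rule image_eqI[of _ _ 0], auto)
  finally show ?thesis using False by (simp add: coeff_eq_0)
qed (auto simp: gn_def)

lemma gn_attained: "\<exists>i. gn r p = av (coeff p i) * r ^ i"
proof -
  have "Max ((\<lambda>i. av (coeff p i) * r ^ i) ` {..degree p}) \<in> (\<lambda>i. av (coeff p i) * r ^ i) ` {..degree p}"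
    by (rule Max_in) auto
  then show ?thesis unfolding gn_def by blast
qed

lemma gn_le: "(\<And>i. av (coeff p i) * r ^ i \<le> M) \<Longrightarrow> gn r p \<le> M"
  using gn_attained[of r p] by auto

lemma gn_nonneg: "r \<ge> 0 \<Longrightarrow> gn r p \<ge> 0"
  using gn_attained[of r p] by auto

lemma gn_const: "gn r [:c:] = av c" by (simp add: gn_def)

lemma gn_add: assumes "r \<ge> 0" shows "gn r (p + q) \<le> max (gn r p) (gn r q)"
proof (rule gn_le)
  fix i
  have "av (coeff (p + q) i) * r ^ i \<le> max (av (coeff p i)) (av (coeff q i)) * r ^ i"
    using av_add assms by (intro mult_right_mono) auto
  also have "\<dots> \<le> max (gn r p) (gn r q)"
    using gn_ge[OF assms, of p i] gn_ge[OF assms, of q i] by (auto simp: max_def)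
  finally show "av (coeff (p + q) i) * r ^ i \<le> max (gn r p) (gn r q)" .
qed

lemma coeff_Lin_mult: "coeff (Lin a * p) i = (case i of 0 \<Rightarrow> 0 | Suc j \<Rightarrow> coeff p j) - a * coeff p i" for a :: 'k
  by (auto simp: Lin_def coeff_pCons split: nat.splits)

text \<open>Gauss's lemma for a linear factor. The upper bound is termwise. For the lower bound a
  coefficient is needed in which one of two summands strictly dominates: if \<open>av a > r\<close>,
  a maximal term of \<open>p\<close> provides it, otherwise the coefficient just after the last
  maximal term.\<close>

lemma gn_Lin_mult: assumes r: "r \<ge> 0" shows "gn r (Lin a * p) = max r (av a) * gn r p"
proof (rule antisym)
  show "gn r (Lin a * p) \<le> max r (av a) * gn r p"
  proof (rule gn_le)
    fix i
    define u where "u = (case i of 0 \<Rightarrow> 0 | Suc j \<Rightarrow> coeff p j)"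
    have 1: "av u * r ^ i \<le> r * gn r p"
      using gn_ge[OF r, of p] gn_nonneg[OF r, of p] r unfolding u_def
      by (auto split: nat.splits simp: mult.assoc mult.left_commute intro!: mult_left_mono)
    have 2: "av (a * coeff p i) * r ^ i \<le> av a * gn r p"
      using gn_ge[OF r, of p i] by (auto simp: av_mult mult.assoc intro!: mult_left_mono)
    have "av (coeff (Lin a * p) i) * r ^ i \<le> max (av u) (av (a * coeff p i)) * r ^ i"
      unfolding coeff_Lin_mult u_def[symmetric] using av_diff r by (intro mult_right_mono) auto
    also have "\<dots> = max (av u * r ^ i) (av (a * coeff p i) * r ^ i)" using r by (simp add: max_mult_distrib_right)
    also have "\<dots> \<le> max (r * gn r p) (av a * gn r p)" using 1 2 by auto
    also have "\<dots> = max r (av a) * gn r p" using gn_nonneg[OF r, of p] by (simp add: max_mult_distrib_right)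
    finally show "av (coeff (Lin a * p) i) * r ^ i \<le> max r (av a) * gn r p" .
  qed
next
  define m where "m = gn r p"
  define I where "I = {i. av (coeff p i) * r ^ i = m}"
  have m0: "m \<ge> 0" using gn_nonneg[OF r] m_def by auto
  show "max r (av a) * gn r p \<le> gn r (Lin a * p)"
  proof (cases "m = 0 \<or> max r (av a) = 0")
    case True
    then show ?thesis using gn_nonneg[OF r] m_def by auto
  next
    case False
    then have m: "m > 0" using m0 by auto
    have Id: "I \<subseteq> {..degree p}" using m unfolding I_def by (auto intro: le_degree simp: not_le)
    then have fin: "finite I" using finite_subset by blast
    have ne: "I \<noteq> {}" using gn_attained[of r p] m_def unfolding I_def by (metis (mono_tags, lifting) empty_iff mem_Collect_eq)
    show ?thesis
    proof (cases "av a > r")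
      case True
      define i where "i = Min I"
      have i: "av (coeff p i) * r ^ i = m" using Min_in[OF fin ne] i_def I_def by auto
      define u where "u = (case i of 0 \<Rightarrow> 0 | Suc j \<Rightarrow> coeff p j)"
      have "av u * r ^ i < av (a * coeff p i) * r ^ i"
      proof (cases i)
        case 0
        then show ?thesis using i m True r by (auto simp: u_def av_mult intro!: mult_pos_pos)
      next
        case (Suc j)
        have "av u * r ^ i = r * (av (coeff p j) * r ^ j)" using Suc u_def by auto
        also have "\<dots> \<le> r * m" using gn_ge[OF r, of p j] r m_def by (intro mult_left_mono) auto
        also have "\<dots> < av a * m" using True m by simp
        also have "\<dots> = av (a * coeff p i) * r ^ i" using i by (simp add: av_mult mult.assoc)
        finally show ?thesis .
      qed
      then have "av u < av (a * coeff p i)" using r by (simp add: mult_less_cancel_right) 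
      then have "av (coeff (Lin a * p) i) = av (a * coeff p i)"
        unfolding coeff_Lin_mult u_def[symmetric] by (rule av_diff_eq)
      then have "av a * m = av (coeff (Lin a * p) i) * r ^ i" using i by (simp add: av_mult)
      also have "\<dots> \<le> gn r (Lin a * p)" by (rule gn_ge[OF r])
      finally show ?thesis using True m_def by auto
    next
      case nle: False
      then have r0: "r > 0" using False r by (auto simp: max_def split: if_splits)
      define i where "i = Max I"
      have i: "av (coeff p i) * r ^ i = m" using Max_in[OF fin ne] i_def I_def by auto
      have "Suc i \<notin> I" using fin i_def by (metis Max_ge Suc_n_not_le_n)
      then have "av (coeff p (Suc i)) * r ^ Suc i < m"
        using gn_ge[OF r, of p "Suc i"] unfolding I_def m_def by auto
      then have "av (coeff p (Suc i)) * r ^ Suc i < av (coeff p i) * r ^ i" using i by simp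
      then have "av (coeff p (Suc i)) * r < av (coeff p i)" using r0 by (simp add: field_simps)
      moreover have "av a * av (coeff p (Suc i)) \<le> r * av (coeff p (Suc i))" using nle by (intro mult_right_mono) auto
      ultimately have "av (a * coeff p (Suc i)) < av (coeff p i)" by (simp add: av_mult mult.commute)
      then have "av (coeff (Lin a * p) (Suc i)) = av (coeff p i)"
        unfolding coeff_Lin_mult by (simp add: av_diff_eq2)
      then have "r * m = av (coeff (Lin a * p) (Suc i)) * r ^ Suc i" using i by simp
      also have "\<dots> \<le> gn r (Lin a * p)" by (rule gn_ge[OF r])
      finally show ?thesis using nle m_def by (simp add: max_def)
    qed
  qed
qed

text \<open>The Gauss norm with centre \<open>a\<close>. Defined through coefficients it makes sense
  for every \<open>r \<ge> 0\<close>: radius 0 gives the type I point \<open>a\<close>, and radii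
  outside the value group fill in the paths used for connectedness.\<close>

definition gs :: "'k \<Rightarrow> real \<Rightarrow> 'k poly \<Rightarrow> real" where
  "gs a r p = gn r (pcompose p [:a, 1:])"

lemma Lin_pcompose: "pcompose (Lin b) [:a, 1:] = Lin (b - a)" for a b :: 'k
  by (simp add: Lin_def pcompose_pCons)

lemma gs_const [simp]: "gs a r [:c:] = av c"
  by (simp add: gs_def pcompose_const gn_const)

lemma gs_Lin_mult: "r \<ge> 0 \<Longrightarrow> gs a r (Lin b * p) = max r (av (a - b)) * gs a r p"
  by (simp add: gs_def pcompose_mult Lin_pcompose gn_Lin_mult av_commute[of a b])

lemma gs_Lin: "r \<ge> 0 \<Longrightarrow> gs a r (Lin b) = max r (av (a - b))"
  using gs_Lin_mult[of r a b "[:1:]"] by simp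

lemma gs_sn: assumes "r \<ge> 0" shows "sn (gs a r)"
  unfolding berk_seminorm_def
proof (intro conjI allI)
  show "0 \<le> gs a r p" for p using gn_nonneg assms by (auto simp: gs_def)
  then show "gs a r (p + q) \<le> gs a r p + gs a r q" for p q
    using gn_add[OF assms, of "pcompose p [:a, 1:]" "pcompose q [:a, 1:]"]
    by (smt (verit) gs_def pcompose_add)
  show "gs a r (p * q) = gs a r p * gs a r q" for p q
  proof (induction p rule: poly_lin_induct)
    case (const c)
    have "gs a r (smult c q) = av c * gs a r q"
    proof (induction q rule: poly_lin_induct)
      case (lin b q)
      then show ?case using gs_Lin_mult[OF assms, of a b "smult c q"] gs_Lin_mult[OF assms, of a b q] by simp
    qed (simp add: av_mult)
    then show ?case by simp
  next
    case (lin b p)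
    then show ?case using gs_Lin_mult[OF assms, of a b "p * q"] gs_Lin_mult[OF assms, of a b p] by (simp add: mult.assoc)
  qed
qed auto

text \<open>Among the seminorms with value at most \<open>r\<close> at \<open>Lin a\<close>,
  \<open>gs a r\<close> is the largest, because it is so on each linear factor.\<close>

lemma gs_le: assumes "sn s" "s (Lin a) \<le> r" shows "s p \<le> gs a r p"
proof (induction p rule: poly_lin_induct)
  case (lin b q)
  have r: "r \<ge> 0" using sn_nonneg[OF assms(1), of "Lin a"] assms(2) by linarith
  have "s (Lin b) \<le> max r (av (a - b))" using sn_Lin[OF assms(1), of b a] assms(2) by auto
  then show ?case using lin by (simp add: sn_mult[OF assms(1)] gs_Lin_mult[OF r]) (intro mult_mono, auto simp: sn_nonneg[OF assms(1)] le_max_iff_disj)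
qed (simp add: sn_const[OF assms(1)])

lemma gs_eqI: assumes "sn s" "r \<ge> 0" "\<And>b. s (Lin b) = max r (av (a - b))" shows "s = gs a r"
  using sn_eqI[OF assms(1) gs_sn[OF assms(2)]] assms gs_Lin by auto

lemma gs_recenter: "r \<ge> 0 \<Longrightarrow> av (a - b) \<le> r \<Longrightarrow> gs a r = gs b r"
proof (rule gs_eqI[OF gs_sn])
  assume "r \<ge> 0" "av (a - b) \<le> r"
  then show "gs a r (Lin c) = max r (av (b - c))" for c
    using av_ultra[of a c b] av_ultra[of b c a] av_commute[of a b] by (simp add: gs_Lin)
qed auto

lemma gs_inj: "r \<ge> 0 \<Longrightarrow> r' \<ge> 0 \<Longrightarrow> gs a r = gs b r' \<Longrightarrow> r = r' \<and> av (a - b) \<le> r"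
proof -
  assume r: "r \<ge> 0" "r' \<ge> 0" "gs a r = gs b r'"
  have "max r (av (a - a)) = max r' (av (b - a))" "max r (av (a - b)) = max r' (av (b - b))"
    using r gs_Lin by metis+
  then show ?thesis using r av_commute[of a b] by (auto simp: max_def split: if_splits)
qed

lemma gs_zero: "gs a 0 p = av (poly p a)"
proof (induction p rule: poly_lin_induct)
  case (lin b q)
  then show ?case by (simp add: gs_Lin_mult av_mult)
qed simp

lemma typeI_gs: "typeI_pt av a = Fin (gs a 0)"
  unfolding typeI_pt_def by (simp add: gs_zero[abs_def])

lemma typeI_sn: "sn (\<lambda>p. av (poly p a))"
  using gs_sn[of 0 a] by (simp add: gs_zero[abs_def])

lemma sn_kernel: assumes "sn s" "s (Lin a) = 0" shows "s = gs a 0"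
proof (rule gs_eqI[OF assms(1)])
  show "s (Lin b) = max 0 (av (a - b))" for b
    using sn_Lin_eq[OF assms(1), of a b] assms sn_Lin[OF assms(1), of b a] sn_nonneg[OF assms(1), of "Lin b"]
    by (cases "a = b") auto
qed auto

lemma gs_pos: "r > 0 \<Longrightarrow> p \<noteq> 0 \<Longrightarrow> gs a r p > 0"
proof (induction p rule: poly_lin_induct)
  case (lin b q)
  then show ?case by (auto simp: gs_Lin_mult)
qed auto

lemma gs_mono: "0 \<le> r \<Longrightarrow> r \<le> r' \<Longrightarrow> gs a r p \<le> gs a r' p"
  by (rule gs_le[OF gs_sn]) (auto simp: gs_Lin)

lemma gs_continuous: "continuous_on {0..} (\<lambda>r. gs a r p)"
proof (induction p rule: poly_lin_induct)
  case (lin b q)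
  have "continuous_on {0..} (\<lambda>r. max r (av (a - b)) * gs a r q)"
    by (intro continuous_intros lin)
  then show ?case by (rule continuous_on_eq) (simp add: gs_Lin_mult)
qed (simp add: continuous_on_const)

lemma poly_le_gs: "av (x - a) \<le> r \<Longrightarrow> av (poly p x) \<le> gs a r p"
  using gs_le[OF typeI_sn[of x], of a r p] by simp

text \<open>Distinct integers stay at distance 1 by the hypothesis on the residue characteristic, so at
  most one of the points a + rho*i falls into the open disk around a given root.\<close>
lemma gs_integer_points:
  assumes "p \<noteq> 0" "\<rho> \<noteq> 0"
  shows "eventually (\<lambda>i::nat. av (poly p (a + \<rho> * of_nat i)) = gs a (av \<rho>) p) sequentially"
  using assms(1)
proof (induction p rule: poly_lin_induct)
  case (lin b q)
  have "finite {i::nat. av (a + \<rho> * of_nat i - b) \<noteq> max (av \<rho>) (av (a - b))}"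
  proof -
    have "i \<le> 0 \<or> j \<le> 0 \<or> i = j" if "av (a + \<rho> * of_nat i - b) \<noteq> max (av \<rho>) (av (a - b))"
      "av (a + \<rho> * of_nat j - b) \<noteq> max (av \<rho>) (av (a - b))" for i j
    proof (rule ccontr)
      assume ij: "\<not> ?thesis"
      have *: "av (a + \<rho> * of_nat i - b) < av \<rho>" if "av (a + \<rho> * of_nat i - b) \<noteq> max (av \<rho>) (av (a - b))" "i \<ge> 1" for i
      proof -
        have i: "av (\<rho> * of_nat i) = av \<rho>" using av_nat[OF \<open>i \<ge> 1\<close>] by (simp add: av_mult)
        have eq: "a + \<rho> * of_nat i - b = \<rho> * of_nat i + (a - b)" by simp
        show ?thesis
          using that(1) av_add[of "\<rho> * of_nat i" "a - b"] av_add_eq[of "\<rho> * of_nat i" "a - b"]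
            av_add_eq[of "a - b" "\<rho> * of_nat i"] i unfolding eq
          by (cases "av \<rho>" "av (a - b)" rule: linorder_cases) (auto simp: add.commute)
      qed
      have diff: "av (\<rho> * (of_nat i - of_nat j)) < av \<rho>"
        using *[of i] *[of j] that ij av_diff[of "a + \<rho> * of_nat i - b" "a + \<rho> * of_nat j - b"]
        by (auto simp: algebra_simps)
      have "av (of_nat i - of_nat j) = 1"
      proof (cases "i < j")
        case True
        then show ?thesis using av_nat[of "j - i"] av_commute[of "of_nat i" "of_nat j"] by (simp add: of_nat_diff)
      next
        case False
        then show ?thesis using av_nat[of "i - j"] ij by (auto simp: of_nat_diff)
      qed
      then show False using diff by (simp add: av_mult)
    qed
    then have "{i::nat. av (a + \<rho> * of_nat i - b) \<noteq> max (av \<rho>) (av (a - b))} \<subseteq>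
      {0, SOME i. i > 0 \<and> av (a + \<rho> * of_nat i - b) \<noteq> max (av \<rho>) (av (a - b))}"
      by (smt (verit, ccfv_threshold) insertCI le_zero_eq mem_Collect_eq neq0_conv someI_ex subsetI)
    then show ?thesis by (rule finite_subset) auto
  qed
  then have "eventually (\<lambda>i::nat. av (a + \<rho> * of_nat i - b) = max (av \<rho>) (av (a - b))) sequentially"
    by (simp add: cofinite_eq_sequentially[symmetric] eventually_cofinite)
  then show ?case using lin(2)[OF lin(1)]
    by eventually_elim (simp add: av_mult gs_Lin_mult)
qed simp

text \<open>The supremum in \<open>zeta\<close> is a maximum, attained at one of the points supplied
  by \<open>gs_integer_points\<close>.\<close>

lemma zeta_gs: assumes "r \<in> av ` (UNIV - {0})" shows "zeta av a r = Fin (gs a r)"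
proof -
  obtain \<rho> where \<rho>: "\<rho> \<noteq> 0" "r = av \<rho>" using assms by auto
  have "(SUP x\<in>{x. av (x - a) \<le> r}. av (poly p x)) = gs a r p" for p
  proof (cases "p = 0")
    case True
    then show ?thesis using gs_const[of a r 0] av_nonneg by (simp) (intro cSup_eq_maximum, auto simp: image_iff \<rho> intro!: exI[of _ a])
  next
    case False
    then have "eventually (\<lambda>i::nat. av (poly p (a + \<rho> * of_nat i)) = gs a r p) sequentially"
      using gs_integer_points \<rho> by auto
    then obtain i where i: "av (poly p (a + \<rho> * of_nat i)) = gs a r p" by (auto simp: eventually_sequentially)
    show ?thesis
    proof (rule cSup_eq_maximum)
      have "av (a + \<rho> * of_nat i - a) \<le> r" using \<rho> av_nat_le[of i] by (simp add: av_mult mult_left_le)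
      then show "gs a r p \<in> (\<lambda>x. av (poly p x)) ` {x. av (x - a) \<le> r}" using i by (metis (mono_tags, lifting) image_eqI mem_Collect_eq)
    qed (auto intro: poly_le_gs)
  qed
  then show ?thesis unfolding zeta_def by (simp add: fun_eq_iff)
qed

section \<open>Polynomials without zeros on an open disk, and approximation by disk points\<close>

definition zero_free :: "'k \<Rightarrow> real \<Rightarrow> 'k poly \<Rightarrow> bool" where
  "zero_free a r p \<longleftrightarrow> (\<forall>x. av (x - a) < r \<longrightarrow> poly p x \<noteq> 0)"

text \<open>All roots keep distance at least \<open>r\<close> from \<open>a\<close>, so by the
  ultrametric inequality each linear factor, and with it \<open>p\<close>, has constant size on the
  open Berkovich disk.\<close>

lemma zero_free_sn:
  assumes "sn s" "s (Lin a) < r" "zero_free a r p" shows "s p = av (poly p a)"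
  using assms(3)
proof (induction p rule: poly_lin_induct)
  case (const c) then show ?case by (simp add: sn_const[OF assms(1)])
next
  case (lin b q)
  have "zero_free a r q" using lin unfolding zero_free_def by auto
  moreover have "av (a - b) \<ge> r" using lin(3)[unfolded zero_free_def, rule_format, of b] av_commute[of a b] by force
  ultimately show ?case using lin sn_Lin_eq[OF assms(1), of a b] assms(2) by (simp add: sn_mult[OF assms(1)] av_mult)
qed

text \<open>This includes the boundary radius \<open>t = r\<close>, which
  \<open>zero_free_sn\<close> does not reach.\<close>

lemma zero_free_gs:
  assumes "zero_free a r p" "0 \<le> t" "t \<le> r" shows "gs a t p = av (poly p a)"
  using assms(1)
proof (induction p rule: poly_lin_induct)
  case (lin b q)
  have "zero_free a r q" using lin unfolding zero_free_def by auto
  moreover have "av (a - b) \<ge> r" using lin(3)[unfolded zero_free_def, rule_format, of b] av_commute[of a b] by force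
  ultimately show ?case using lin assms by (simp add: gs_Lin_mult av_mult max_absorb2)
qed simp

text \<open>The factor \<open>Lin a\<close> is strictly smaller inside the open disk than at its
  boundary point, and the cofactor is not larger. This strictness is what makes images of open disks
  lie in open disks.\<close>

lemma sn_less_gs:
  assumes "sn s" "s (Lin a) < r" "p \<noteq> 0" "poly p a = 0" shows "s p < gs a r p"
proof -
  have r: "r > 0" using sn_nonneg[OF assms(1), of "Lin a"] assms(2) by linarith
  obtain q where q: "p = Lin a * q" using assms(4) unfolding Lin_def by (meson dvdE poly_eq_0_iff_dvd)
  then have "q \<noteq> 0" using assms(3) by auto
  have "s p = s (Lin a) * s q" using q by (simp add: sn_mult[OF assms(1)])
  also have "\<dots> \<le> s (Lin a) * gs a r q" using gs_le[OF assms(1), of a r q] assms(2) by (intro mult_left_mono) (auto simp: sn_nonneg[OF assms(1)])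
  also have "\<dots> < r * gs a r q" using gs_pos[OF r \<open>q \<noteq> 0\<close>] assms(2) by simp
  also have "\<dots> = gs a r p" using q r by (simp add: gs_Lin_mult)
  finally show ?thesis .
qed

text \<open>To finitely many polynomials every seminorm looks like the seminorm of a disk: take as
  centre the root at which \<open>s\<close> is smallest. Disk points are therefore dense.\<close>

lemma finite_poly_agree:
  assumes s: "sn s" and F: "finite F"
  shows "\<exists>a. \<forall>p\<in>F. s p = gs a (s (Lin a)) p"
proof -
  define R where "R = (\<Union>p\<in>F - {0}. {x. poly p x = 0})"
  have fin: "finite R" unfolding R_def using F poly_roots_finite by auto
  have "\<exists>a. \<forall>b\<in>R. s (Lin b) = max (s (Lin a)) (av (a - b))"
  proof (cases "R = {}")
    case False
    define a where "a = arg_min_on (\<lambda>x. s (Lin x)) R"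
    have min: "s (Lin a) \<le> s (Lin b)" if "b \<in> R" for b
      using arg_min_least[OF fin False that] a_def by auto
    have "s (Lin b) = max (s (Lin a)) (av (a - b))" if "b \<in> R" for b
      using min[OF that] sn_Lin[OF s, of b a] sn_Lin_eq[OF s, of a b] by (cases "s (Lin a) < av (a - b)") auto
    then show ?thesis by blast
  qed auto
  then obtain a where a: "\<And>b. b \<in> R \<Longrightarrow> s (Lin b) = max (s (Lin a)) (av (a - b))" by auto
  have "s p = gs a (s (Lin a)) p" if "{x. poly p x = 0} \<subseteq> R \<or> p = 0" for p
    using that
  proof (induction p rule: poly_lin_induct)
    case (const c) then show ?case by (simp add: sn_const[OF s])
  next
    case (lin b q)
    then have "b \<in> R" "{x. poly q x = 0} \<subseteq> R" by auto
    then show ?case using lin a[of b] by (simp add: sn_mult[OF s] gs_Lin_mult sn_nonneg[OF s])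
  qed
  then show ?thesis unfolding R_def by blast
qed

end

section \<open>Functoriality of the action of rational functions\<close>

lemma coeff_mult_top:
  fixes p q :: "'k::field poly"
  assumes "degree p \<le> a" "degree q \<le> b"
  shows "coeff (p * q) (a + b) = coeff p a * coeff q b"
proof -
  have "coeff (p * q) (a + b) = (\<Sum>i\<le>a + b. coeff p i * coeff q (a + b - i))" by (rule coeff_mult)
  also have "\<dots> = (\<Sum>i\<in>{a}. coeff p i * coeff q (a + b - i))"
  proof (rule sum.mono_neutral_right)
    show "\<forall>i\<in>{..a + b} - {a}. coeff p i * coeff q (a + b - i) = 0"
    proof
      fix i assume "i \<in> {..a + b} - {a}"
      then have "i > a \<or> a + b - i > b" by auto
      then show "coeff p i * coeff q (a + b - i) = 0" using assms by (auto simp: coeff_eq_0)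
    qed
  qed auto
  finally show ?thesis by simp
qed

lemma coeff_power_top:
  fixes p :: "'k::field poly"
  assumes "degree p \<le> a" shows "coeff (p ^ n) (n * a) = coeff p a ^ n \<and> degree (p ^ n) \<le> n * a"
proof (induction n)
  case (Suc n)
  have "degree (p * p ^ n) \<le> a + n * a" using degree_mult_le[of p "p ^ n"] Suc assms by linarith
  then show ?case using coeff_mult_top[OF assms, of "p ^ n" "n * a"] Suc by simp
qed auto

context nonarch_field
begin

text \<open>The coefficient in the formal top degree plays the role of the value at infinity, so
  this is composition evaluated at infinity.\<close>

lemma hcomp_coeff_top:
  assumes "degree P \<le> d" "degree Q \<le> d"
  shows "coeff (hcomp n p P Q) (n * d) = (\<Sum>i\<le>n. coeff p i * coeff P d ^ i * coeff Q d ^ (n - i))"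
    and "degree (hcomp n p P Q) \<le> n * d"
proof -
  have *: "coeff (P ^ i * Q ^ (n - i)) (n * d) = coeff P d ^ i * coeff Q d ^ (n - i) \<and> degree (P ^ i * Q ^ (n - i)) \<le> n * d"
    if "i \<le> n" for i
  proof -
    have n: "n * d = i * d + (n - i) * d" using that by (simp add: add_mult_distrib[symmetric])
    have "degree (P ^ i * Q ^ (n - i)) \<le> i * d + (n - i) * d"
      using degree_mult_le[of "P ^ i" "Q ^ (n - i)"] coeff_power_top[OF assms(1), of i] coeff_power_top[OF assms(2), of "n - i"] by linarith
    then show ?thesis unfolding n
      using coeff_mult_top[of "P ^ i" "i * d" "Q ^ (n - i)" "(n - i) * d"] coeff_power_top[OF assms(1), of i] coeff_power_top[OF assms(2), of "n - i"]
      by auto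
  qed
  show "coeff (hcomp n p P Q) (n * d) = (\<Sum>i\<le>n. coeff p i * coeff P d ^ i * coeff Q d ^ (n - i))"
    unfolding hcomp_def by (simp add: coeff_sum * mult.assoc)
  show "degree (hcomp n p P Q) \<le> n * d"
    unfolding hcomp_def using * by (intro degree_sum_le) (auto intro: order_trans[OF degree_smult_le])
qed

lemma poly_hcomp: "poly (hcomp n p P Q) x = (\<Sum>i\<le>n. coeff p i * poly P x ^ i * poly Q x ^ (n - i))"
  unfolding hcomp_def by (simp add: poly_sum mult.assoc)

lemma sum_hom:
  fixes p :: "'k poly"
  assumes "degree p \<le> n" "v \<noteq> 0"
  shows "(\<Sum>i\<le>n. coeff p i * u ^ i * v ^ (n - i)) = v ^ n * poly p (u / v)"
proof -
  have "poly p (u / v) = (\<Sum>i\<le>n. coeff p i * (u / v) ^ i)"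
    unfolding poly_altdef using assms(1)
    by (intro sum.mono_neutral_left) (auto simp: coeff_eq_0)
  then have "v ^ n * poly p (u / v) = (\<Sum>i\<le>n. v ^ n * (coeff p i * (u / v) ^ i))" by (simp add: sum_distrib_left)
  also have "\<dots> = (\<Sum>i\<le>n. coeff p i * u ^ i * v ^ (n - i))"
  proof (rule sum.cong)
    fix i assume "i \<in> {..n}"
    then have "v ^ n = v ^ i * v ^ (n - i)" by (simp add: power_add[symmetric])
    then show "v ^ n * (coeff p i * (u / v) ^ i) = coeff p i * u ^ i * v ^ (n - i)"
      using assms(2) by (simp add: power_divide)
  qed simp
  finally show ?thesis by simp
qed

lemma poly_hcomp_eval: fixes p P Q :: "'k poly" shows "degree p \<le> n \<Longrightarrow> poly Q x \<noteq> 0 \<Longrightarrow> poly (hcomp n p P Q) x = poly Q x ^ n * poly p (poly P x / poly Q x)"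
  by (simp add: poly_hcomp sum_hom)

lemma infinite_UNIV_k: "infinite (UNIV :: 'k set)"
proof -
  have "inj (of_nat :: nat \<Rightarrow> 'k)"
  proof (rule linorder_injI)
    fix i j :: nat assume "i < j"
    then have "(of_nat (j - i) :: 'k) = of_nat j - of_nat i" "j - i \<ge> 1" by (simp_all add: of_nat_diff)
    then show "(of_nat i :: 'k) \<noteq> of_nat j" using of_nat_ne[of "j - i"] by auto
  qed
  then show ?thesis using finite_imageD infinite_UNIV_nat finite_subset subset_UNIV by metis
qed

text \<open>The field is infinite, so identities about compositions may be checked pointwise where
  division by \<open>Q\<close> is possible.\<close>

lemma poly_eqI_off:
  fixes p q :: "'k poly"
  assumes "Q \<noteq> 0" "\<And>x. poly Q x \<noteq> 0 \<Longrightarrow> poly p x = poly q x" shows "p = q"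
proof (rule ccontr)
  assume "p \<noteq> q"
  then have "(p - q) * Q \<noteq> 0" using assms by simp
  then have "finite {x. poly ((p - q) * Q) x = 0}" by (rule poly_roots_finite)
  moreover have "{x. poly ((p - q) * Q) x = 0} = UNIV" using assms(2) by auto
  ultimately show False using infinite_UNIV_k by metis
qed

lemma hcomp_mult:
  fixes p q P Q :: "'k poly"
  assumes "Q \<noteq> 0" "degree p \<le> n" "degree q \<le> m"
  shows "hcomp (n + m) (p * q) P Q = hcomp n p P Q * hcomp m q P Q"
proof (rule poly_eqI_off[OF assms(1)])
  fix x assume "poly Q x \<noteq> 0"
  moreover have "degree (p * q) \<le> n + m" using degree_mult_le[of p q] assms by linarith
  ultimately show "poly (hcomp (n + m) (p * q) P Q) x = poly (hcomp n p P Q * hcomp m q P Q) x"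
    using assms by (simp add: poly_hcomp_eval power_add)
qed

lemma hcomp_add: "hcomp n (p + q) P Q = hcomp n p P Q + hcomp n q P Q"
  by (simp add: hcomp_def smult_add_left sum.distrib)

lemma hcomp_smult: "hcomp n (smult c p) P Q = smult c (hcomp n p P Q)"
  by (rule poly_eqI) (simp add: hcomp_def coeff_sum sum_distrib_left mult.assoc)

lemma hcomp_sum: "hcomp n (sum p I) P Q = (\<Sum>i\<in>I. hcomp n (p i) P Q)"
  by (induction I rule: infinite_finite_induct) (simp_all add: hcomp_add, simp_all add: hcomp_def)

lemma hcomp_const: "hcomp 0 [:c:] P Q = [:c:]"
  by (simp add: hcomp_def)

lemma hcomp_power:
  fixes p P Q :: "'k poly"
  assumes "Q \<noteq> 0" "degree p \<le> n"
  shows "hcomp (k * n) (p ^ k) P Q = hcomp n p P Q ^ k"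
proof (induction k)
  case (Suc k)
  then show ?case using hcomp_mult[OF assms, of "p ^ k" "k * n" P] coeff_power_top[OF assms(2), of k] by simp
qed (simp add: hcomp_const one_pCons)

lemma hcomp_hcomp:
  fixes p P Q P' Q' :: "'k poly"
  assumes "Q \<noteq> 0" "degree P' \<le> d" "degree Q' \<le> d"
  shows "hcomp n p (hcomp d P' P Q) (hcomp d Q' P Q) = hcomp (n * d) (hcomp n p P' Q') P Q"
proof -
  have "hcomp (n * d) (P' ^ i * Q' ^ (n - i)) P Q = hcomp d P' P Q ^ i * hcomp d Q' P Q ^ (n - i)" if "i \<le> n" for i
  proof -
    have n: "n * d = i * d + (n - i) * d" using that by (simp add: add_mult_distrib[symmetric])
    show ?thesis unfolding n
      using hcomp_mult[OF assms(1), of "P' ^ i" "i * d" "Q' ^ (n - i)" "(n - i) * d" P] hcomp_power[OF assms(1,2), of i P] hcomp_power[OF assms(1,3), of "n - i" P]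
        coeff_power_top[OF assms(2), of i] coeff_power_top[OF assms(3), of "n - i"] by simp
  qed
  then show ?thesis unfolding hcomp_def[of n p P' Q'] hcomp_def[of n p "hcomp d P' P Q"]
    by (simp add: hcomp_sum hcomp_smult)
qed

text \<open>Evaluation of p as a binary form of degree n; points of the projective line are determined by
  these values up to scaling by the n-th power of a constant.\<close>
definition hn :: "'k berk \<Rightarrow> nat \<Rightarrow> 'k poly \<Rightarrow> real" where
  "hn z n p = (case z of Fin s \<Rightarrow> s p | Inf \<Rightarrow> av (coeff p n))"

lemma hn_Fin [simp]: "hn (Fin s) n p = s p" and hn_Inf [simp]: "hn Inf n p = av (coeff p n)"
  by (auto simp: hn_def)

lemma BP_Fin [simp]: "Fin s \<in> BP av \<longleftrightarrow> sn s" and BP_Inf [simp]: "Inf \<in> BP av"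
  by (auto simp: BP_def)

lemma BP_cases: assumes "z \<in> BP av" obtains "z = Inf" | s where "z = Fin s" "sn s"
  using assms by (auto simp: BP_def)

text \<open>The value of 1 in degree 1 vanishes exactly at infinity, and at finite points it forces
  \<open>c = c'\<close>.\<close>

lemma hn_unique:
  assumes "w \<in> BP av" "w' \<in> BP av" "c > 0" "c' > 0"
    and eq: "\<And>n p. degree p \<le> n \<Longrightarrow> hn w n p * c ^ n = hn w' n p * c' ^ n"
  shows "w = w'"
proof -
  have 1: "hn w 1 1 * c = hn w' 1 1 * c'" using eq[of 1 1] by simp
  show ?thesis
  proof (cases rule: BP_cases[OF assms(1)])
    case 1
    then show ?thesis using \<open>hn w 1 1 * c = hn w' 1 1 * c'\<close> assms(2,4)
      by (cases rule: BP_cases[OF assms(2)]) (auto simp: sn_1)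
  next
    case (2 s)
    then obtain s' where s': "w' = Fin s'" "sn s'" using \<open>hn w 1 1 * c = hn w' 1 1 * c'\<close> assms(2,3)
      by (cases rule: BP_cases[OF assms(2)]) (auto simp: sn_1)
    then have "c = c'" using 1 2 by (simp add: sn_1)
    then have "s p = s' p" for p using eq[of p "degree p"] 2 s' assms(3) by simp
    then show ?thesis using 2 s' by auto
  qed
qed

lemma sn_add_zero: assumes "sn s" "s q = 0" shows "s (p + q) = s p"
  using sn_ultra_eq[OF assms(1), of q p] sn_ultra[OF assms(1), of p q] sn_nonneg[OF assms(1), of p]
    sn_nonneg[OF assms(1), of "p + q"] assms(2)
  by (cases "s p > 0") (auto simp: add.commute)

text \<open>Coprimality, phrased as absence of common zeros on the whole Berkovich line including
  infinity. In this form it passes to compositions by evaluation at image points, without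
  divisibility arguments.\<close>

definition nondeg :: "'k poly \<times> 'k poly \<Rightarrow> bool" where
  "nondeg f \<longleftrightarrow> rat_deg f \<ge> 1 \<and> (\<forall>z\<in>BP av. hn z (rat_deg f) (fst f) \<noteq> 0 \<or> hn z (rat_deg f) (snd f) \<noteq> 0)"

lemma rat_deg_le: "degree (fst f) \<le> rat_deg f" "degree (snd f) \<le> rat_deg f"
  by (simp_all add: rat_deg_def)

lemma nondeg_typeI: "nondeg f \<Longrightarrow> poly (fst f) x \<noteq> 0 \<or> poly (snd f) x \<noteq> 0"
  using typeI_sn[of x] unfolding nondeg_def
  by (metis BP_Fin av_eq_0 hn_Fin)

text \<open>Otherwise numerator and denominator would be multiples of one polynomial
  \<open>q\<close>; a root of \<open>q\<close> or, if \<open>q\<close> is constant, infinity would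
  be a common zero.\<close>

lemma nondeg_comb: assumes "nondeg f" "a \<noteq> 0 \<or> b \<noteq> 0" shows "smult a (fst f) + smult b (snd f) \<noteq> 0"
proof
  assume eq: "smult a (fst f) + smult b (snd f) = 0"
  have *: "degree q = 0 \<and> coeff q (rat_deg f) \<noteq> 0"
    if "fst f = smult u q" "snd f = smult v q" for q u v
  proof
    show "degree q = 0"
    proof (rule ccontr)
      assume "degree q \<noteq> 0"
      then obtain x where "poly q x = 0" using poly_root[of q] by auto
      then show False using nondeg_typeI[OF assms(1), of x] that by auto
    qed
    have "coeff (fst f) (rat_deg f) \<noteq> 0 \<or> coeff (snd f) (rat_deg f) \<noteq> 0"
      using assms(1) unfolding nondeg_def by (metis BP_Inf av_eq_0 hn_Inf)
    then show "coeff q (rat_deg f) \<noteq> 0" using that by auto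
  qed
  have d: "rat_deg f \<ge> 1" using assms(1) unfolding nondeg_def by auto
  have "\<exists>q u v. fst f = smult u q \<and> snd f = smult v q"
  proof (cases "a = 0")
    case True
    then have "snd f = 0" using eq assms(2) by auto
    then show ?thesis by (intro exI[of _ "fst f"] exI[of _ 1] exI[of _ 0]) auto
  next
    case False
    have "smult a (fst f) = smult (- b) (snd f)" using eq by (simp add: add_eq_0_iff2)
    then have "smult (inverse a) (smult a (fst f)) = smult (inverse a) (smult (- b) (snd f))" by simp
    then have "fst f = smult (inverse a * - b) (snd f)" using False by simp
    then show ?thesis by (intro exI[of _ "snd f"] exI[of _ "inverse a * - b"] exI[of _ 1]) auto
  qed
  then obtain q u v where "fst f = smult u q" "snd f = smult v q" by blast
  then have "degree q = 0" "coeff q (rat_deg f) \<noteq> 0" using * by auto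
  then show False using d by (simp add: coeff_eq_0)
qed

lemma nondeg_snd: "nondeg f \<Longrightarrow> snd f \<noteq> 0" and nondeg_fst: "nondeg f \<Longrightarrow> fst f \<noteq> 0"
  using nondeg_comb[of f 0 1] nondeg_comb[of f 1 0] by auto

lemma nondeg_diff: "nondeg f \<Longrightarrow> fst f - smult c (snd f) \<noteq> 0"
  using nondeg_comb[of f 1 "- c"] by simp

text \<open>One description for all cases of \<open>berk_map\<close>: evaluating a form at the image
  means pulling it back, up to the scaling \<open>c ^ n\<close>. Here \<open>c\<close> is the size
  of the denominator at \<open>z\<close>, or of the numerator where the denominator
  vanishes.\<close>

lemma berk_map_hn:
  assumes f: "nondeg f" and z: "z \<in> BP av"
  shows "berk_map av f z \<in> BP av \<and> (\<exists>c>0. \<forall>n p. degree p \<le> n \<longrightarrow>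
    hn (berk_map av f z) n p * c ^ n = hn z (n * rat_deg f) (hcomp n p (fst f) (snd f)))"
proof -
  define P Q d where "P = fst f" and "Q = snd f" and "d = rat_deg f"
  have dP: "degree P \<le> d" "degree Q \<le> d" unfolding P_def Q_def d_def by (rule rat_deg_le)+
  have Q0: "Q \<noteq> 0" using nondeg_snd f Q_def by auto
  have nd: "hn z d P \<noteq> 0 \<or> hn z d Q \<noteq> 0" using f z unfolding nondeg_def P_def Q_def d_def by auto
  show ?thesis unfolding P_def[symmetric] Q_def[symmetric] d_def[symmetric]
  proof (cases rule: BP_cases[OF z])
    case (2 s)
    show "berk_map av f z \<in> BP av \<and> (\<exists>c>0. \<forall>n p. degree p \<le> n \<longrightarrow>
      hn (berk_map av f z) n p * c ^ n = hn z (n * d) (hcomp n p P Q))"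
    proof (cases "s Q = 0")
      case False
      define t where "t = (\<lambda>g. s (hcomp (degree g) g P Q) / s Q ^ degree g)"
      have w: "berk_map av f z = Fin t" using 2 False by (simp add: berk_map_def P_def Q_def t_def)
      have pos: "s Q > 0" using False sn_nonneg[OF 2(2), of Q] by linarith
      have t: "t p * s Q ^ n = s (hcomp n p P Q)" if "degree p \<le> n" for n p
      proof -
        have "hcomp n p P Q = hcomp (n - degree p) 1 P Q * hcomp (degree p) p P Q"
          using hcomp_mult[OF Q0, of 1 "n - degree p" p "degree p" P] that by simp
        moreover have "hcomp (n - degree p) 1 P Q = Q ^ (n - degree p)"
          by (rule poly_eqI_off[OF Q0]) (simp add: poly_hcomp_eval)
        ultimately have "s (hcomp n p P Q) = s Q ^ (n - degree p) * s (hcomp (degree p) p P Q)"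
          by (simp add: sn_mult[OF 2(2)] sn_power[OF 2(2)])
        moreover have "s Q ^ n = s Q ^ (n - degree p) * s Q ^ degree p" using that by (simp add: power_add[symmetric])
        ultimately show ?thesis using pos by (simp add: t_def)
      qed
      have "sn t" unfolding berk_seminorm_def
      proof (intro conjI allI)
        show "t p \<ge> 0" for p by (simp add: t_def sn_nonneg[OF 2(2)])
        show "t [:c:] = av c" for c by (simp add: t_def hcomp_const sn_const[OF 2(2)])
        fix p q
        show "t (p * q) = t p * t q"
        proof -
          have "t (p * q) * s Q ^ (degree p + degree q) = (t p * s Q ^ degree p) * (t q * s Q ^ degree q)"
            using t[of "p * q" "degree p + degree q"] t[of p "degree p"] t[of q "degree q"] degree_mult_le[of p q]
            by (simp add: hcomp_mult[OF Q0] sn_mult[OF 2(2)])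
          then show ?thesis using pos by (simp add: power_add)
        qed
        define n where "n = max (degree p) (degree q)"
        have "t (p + q) * s Q ^ n \<le> t p * s Q ^ n + t q * s Q ^ n"
          using t[of "p + q" n] t[of p n] t[of q n] degree_add_le[of p n q] sn_add[OF 2(2), of "hcomp n p P Q" "hcomp n q P Q"]
          by (simp add: n_def hcomp_add)
        then show "t (p + q) \<le> t p + t q" using pos by (simp add: distrib_right[symmetric])
      qed
      then show ?thesis using w t pos 2 by (auto intro!: exI[of _ "s Q"])
    next
      case True
      have w: "berk_map av f z = Inf" using 2 True by (simp add: berk_map_def P_def Q_def)
      have "s P \<noteq> 0" using nd True 2 by auto
      then have pos: "s P > 0" using sn_nonneg[OF 2(2), of P] by linarith
      have "s (hcomp n p P Q) = av (coeff p n) * s P ^ n" for n p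
      proof -
        have "hcomp n p P Q = smult (coeff p n) (P ^ n) + (\<Sum>i<n. smult (coeff p i) (P ^ i * Q ^ (n - i)))"
          unfolding hcomp_def by (simp add: lessThan_Suc_atMost[symmetric])
        moreover have "s (\<Sum>i<n. smult (coeff p i) (P ^ i * Q ^ (n - i))) = 0"
        proof (rule antisym)
          have "s (\<Sum>i<n. smult (coeff p i) (P ^ i * Q ^ (n - i))) \<le> (\<Sum>i<n. s (smult (coeff p i) (P ^ i * Q ^ (n - i))))"
            by (rule sn_sum[OF 2(2)])
          also have "\<dots> = 0"
            using True by (intro sum.neutral) (auto simp: sn_smult[OF 2(2)] sn_mult[OF 2(2)] sn_power[OF 2(2)])
          finally show "s (\<Sum>i<n. smult (coeff p i) (P ^ i * Q ^ (n - i))) \<le> 0" .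
        qed (simp add: sn_nonneg[OF 2(2)])
        ultimately show ?thesis by (simp add: sn_add_zero[OF 2(2)] sn_smult[OF 2(2)] sn_power[OF 2(2)])
      qed
      then show ?thesis using w pos 2 by (auto intro!: exI[of _ "s P"])
    qed
  next
    case 1
    have top: "coeff P d \<noteq> 0 \<or> coeff Q d \<noteq> 0" using nd 1 by simp
    show "berk_map av f z \<in> BP av \<and> (\<exists>c>0. \<forall>n p. degree p \<le> n \<longrightarrow>
      hn (berk_map av f z) n p * c ^ n = hn z (n * d) (hcomp n p P Q))"
    proof (cases "degree P > degree Q")
      case True
      have w: "berk_map av f z = Inf" using 1 True by (simp add: berk_map_def P_def Q_def)
      have Q: "coeff Q d = 0" using True dP by (simp add: coeff_eq_0)
      have "coeff (hcomp n p P Q) (n * d) = coeff p n * coeff P d ^ n" for n p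
      proof -
        have "(\<Sum>i\<le>n. coeff p i * coeff P d ^ i * coeff Q d ^ (n - i)) = (\<Sum>i\<in>{n}. coeff p i * coeff P d ^ i * coeff Q d ^ (n - i))"
          by (rule sum.mono_neutral_right) (auto simp: Q)
        then show ?thesis by (simp add: hcomp_coeff_top[OF dP])
      qed
      then show ?thesis using w 1 top Q by (auto simp: av_mult av_power intro!: exI[of _ "av (coeff P d)"])
    next
      case False
      have dQ: "degree Q = d"
      proof (rule ccontr)
        assume "degree Q \<noteq> d"
        then have "degree Q < d" "degree P < d" using dP False by auto
        then show False using top by (simp add: coeff_eq_0)
      qed
      have w: "berk_map av f z = typeI_pt av (coeff P d / coeff Q d)"
        using 1 False dQ by (simp add: berk_map_def P_def Q_def)
      have Q: "coeff Q d \<noteq> 0" using dQ Q0 by auto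
      have "coeff (hcomp n p P Q) (n * d) = coeff Q d ^ n * poly p (coeff P d / coeff Q d)" if "degree p \<le> n" for n p
        using hcomp_coeff_top[OF dP, of n p] sum_hom[OF that Q] by simp
      then show ?thesis unfolding w typeI_pt_def using 1 Q typeI_sn
        by (auto simp: av_mult av_power intro!: exI[of _ "av (coeff Q d)"])
    qed
  qed
qed

lemma berk_map_BP: "nondeg f \<Longrightarrow> z \<in> BP av \<Longrightarrow> berk_map av f z \<in> BP av"
  using berk_map_hn by blast

lemma berk_map_Lin:
  assumes f: "nondeg f" and s: "sn s" "s (snd f) \<noteq> 0"
  shows "\<exists>t. berk_map av f (Fin s) = Fin t \<and> sn t \<and> (\<forall>b. t (Lin b) = s (fst f - smult b (snd f)) / s (snd f))"
proof -
  obtain t where t: "berk_map av f (Fin s) = Fin t"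
    "t = (\<lambda>g. s (hcomp (degree g) g (fst f) (snd f)) / s (snd f) ^ degree g)"
    using s by (simp add: berk_map_def)
  have "sn t" using berk_map_BP[OF f, of "Fin s"] s t by simp
  moreover have "hcomp (degree (Lin b)) (Lin b) (fst f) (snd f) = fst f - smult b (snd f)"
    and "degree (Lin b) = 1" for b
    by (simp_all add: Lin_def hcomp_def)
  then have "t (Lin b) = s (fst f - smult b (snd f)) / s (snd f)" for b
    unfolding t(2) by (metis power_one_right)
  ultimately show ?thesis using t(1) by auto
qed

text \<open>Nothing cancels: a common zero of the composed pair would give a common zero of
  \<open>f\<close> at the image point, and at infinity the same argument preserves the formal
  degree. The composition law follows from uniqueness up to scaling.\<close>

lemma rat_comp_correct:
  assumes f: "nondeg f" and g: "nondeg g"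
  shows "nondeg (rat_comp f g)" "rat_deg (rat_comp f g) = rat_deg f * rat_deg g"
    and "z \<in> BP av \<Longrightarrow> berk_map av (rat_comp f g) z = berk_map av f (berk_map av g z)"
proof -
  define P Q where "P = hcomp (rat_deg f) (fst f) (fst g) (snd g)" and "Q = hcomp (rat_deg f) (snd f) (fst g) (snd g)"
  have fg: "rat_comp f g = (P, Q)" by (simp add: rat_comp_def P_def Q_def)
  define d where "d = rat_deg f * rat_deg g"
  have le: "degree P \<le> d" "degree Q \<le> d" unfolding P_def Q_def d_def by (rule hcomp_coeff_top(2)[OF rat_deg_le(1) rat_deg_le(2)])+
  have nz: "hn z d P \<noteq> 0 \<or> hn z d Q \<noteq> 0" if z: "z \<in> BP av" for z
  proof -
    obtain c where c: "c > 0" "\<And>n p. degree p \<le> n \<Longrightarrow>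
      hn (berk_map av g z) n p * c ^ n = hn z (n * rat_deg g) (hcomp n p (fst g) (snd g))"
      using berk_map_hn[OF g z] by blast
    have "hn (berk_map av g z) (rat_deg f) (fst f) \<noteq> 0 \<or> hn (berk_map av g z) (rat_deg f) (snd f) \<noteq> 0"
      using f berk_map_BP[OF g z] unfolding nondeg_def by auto
    then show ?thesis using c(2)[OF rat_deg_le(1)[of f]] c(2)[OF rat_deg_le(2)[of f]] c(1)
      unfolding P_def Q_def d_def by (metis mult_eq_0_iff power_not_zero less_irrefl)
  qed
  show deg: "rat_deg (rat_comp f g) = d"
  proof -
    have "coeff P d \<noteq> 0 \<or> coeff Q d \<noteq> 0" using nz[of Inf] by simp
    then have "degree P \<ge> d \<or> degree Q \<ge> d" by (auto intro: le_degree)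
    then show ?thesis using le by (auto simp: fg rat_deg_def)
  qed
  show nd: "nondeg (rat_comp f g)" unfolding nondeg_def deg
    using nz f g unfolding nondeg_def by (auto simp: fg d_def Suc_le_eq)
  assume z: "z \<in> BP av"
  define w where "w = berk_map av g z"
  obtain c where c: "c > 0" "\<And>n p. degree p \<le> n \<Longrightarrow>
      hn w n p * c ^ n = hn z (n * rat_deg g) (hcomp n p (fst g) (snd g))"
    using berk_map_hn[OF g z] w_def by blast
  have w: "w \<in> BP av" using berk_map_BP[OF g z] w_def by auto
  obtain c' where c': "c' > 0" "\<And>n p. degree p \<le> n \<Longrightarrow>
      hn (berk_map av f w) n p * c' ^ n = hn w (n * rat_deg f) (hcomp n p (fst f) (snd f))"
    using berk_map_hn[OF f w] by blast
  obtain c'' where c'': "c'' > 0" "\<And>n p. degree p \<le> n \<Longrightarrow>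
      hn (berk_map av (rat_comp f g) z) n p * c'' ^ n = hn z (n * d) (hcomp n p P Q)"
    using berk_map_hn[OF nd z] deg unfolding fg by auto
  show "berk_map av (rat_comp f g) z = berk_map av f (berk_map av g z)"
    unfolding w_def[symmetric]
  proof (rule hn_unique[of _ _ c'' "c' * c ^ rat_deg f"])
    show "berk_map av (rat_comp f g) z \<in> BP av" "berk_map av f w \<in> BP av" using berk_map_BP nd z f w by auto
    show "0 < c''" "0 < c' * c ^ rat_deg f" using c c' c'' by auto
    fix n and p :: "'k poly" assume p: "degree p \<le> n"
    have "hn (berk_map av f w) n p * (c' * c ^ rat_deg f) ^ n = (hn (berk_map av f w) n p * c' ^ n) * c ^ (n * rat_deg f)"
      by (simp add: power_mult_distrib power_mult[symmetric] mult.commute)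
    also have "\<dots> = hn z (n * rat_deg f * rat_deg g) (hcomp (n * rat_deg f) (hcomp n p (fst f) (snd f)) (fst g) (snd g))"
      using c'(2)[OF p] c(2)[OF hcomp_coeff_top(2)[OF rat_deg_le(1)[of f] rat_deg_le(2)[of f], of n p]] by simp
    also have "hcomp (n * rat_deg f) (hcomp n p (fst f) (snd f)) (fst g) (snd g) = hcomp n p P Q"
      unfolding P_def Q_def by (rule hcomp_hcomp[OF nondeg_snd[OF g] rat_deg_le(1) rat_deg_le(2), symmetric])
    finally show "hn (berk_map av (rat_comp f g) z) n p * c'' ^ n = hn (berk_map av f w) n p * (c' * c ^ rat_deg f) ^ n"
      using c''(2)[OF p] by (simp add: d_def mult.assoc)
  qed
qed

lemma nondeg_ident: "nondeg ([:0, 1:], 1)" "rat_deg ([:0, 1:] :: 'k poly, 1) = 1"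
proof -
  show "rat_deg ([:0, 1:] :: 'k poly, 1) = 1" by (simp add: rat_deg_def)
  then show "nondeg ([:0, 1:], 1)" unfolding nondeg_def by (auto elim!: BP_cases simp: sn_1)
qed

lemma berk_map_ident: assumes "z \<in> BP av" shows "berk_map av ([:0, 1:], 1) z = z"
proof (cases rule: BP_cases[OF assms])
  case (2 s)
  have "hcomp (degree g) g [:0, 1:] 1 = g" for g :: "'k poly"
    by (rule poly_eqI_off[of 1]) (auto simp: poly_hcomp_eval)
  then show ?thesis using 2 by (simp add: berk_map_def sn_1)
qed (simp add: berk_map_def)

lemma rat_iter_correct:
  assumes f: "nondeg f"
  shows "nondeg (rat_iter f n) \<and> (\<forall>z\<in>BP av. berk_map av (rat_iter f n) z = (berk_map av f ^^ n) z)"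
proof (induction n)
  case 0 then show ?case using nondeg_ident berk_map_ident by simp
next
  case (Suc n)
  then show ?case using rat_comp_correct[OF f, of "rat_iter f n"] by auto
qed

text \<open>A seminorm killing both polynomials kills \<open>Lin a\<close> and \<open>Lin b\<close>
  for a root of each; then \<open>a = b\<close> is a common root.\<close>

lemma coprime_nondeg:
  assumes "coprime (fst f) (snd f)" "rat_deg f \<ge> 1" shows "nondeg f"
  unfolding nondeg_def
proof (intro conjI ballI)
  fix z assume z: "z \<in> BP av"
  have nocommon: False if "poly (fst f) x = 0" "poly (snd f) x = 0" for x
  proof -
    have "[:- x, 1:] dvd fst f" "[:- x, 1:] dvd snd f" using that by (auto simp: poly_eq_0_iff_dvd)
    then have "is_unit [:- x, 1:]" using assms(1) coprime_common_divisor by blast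
    then show False by (simp add: is_unit_pCons_iff)
  qed
  show "hn z (rat_deg f) (fst f) \<noteq> 0 \<or> hn z (rat_deg f) (snd f) \<noteq> 0"
  proof (cases rule: BP_cases[OF z])
    case (2 s)
    show ?thesis
    proof (rule ccontr)
      assume "\<not> ?thesis"
      then have s: "s (fst f) = 0" "s (snd f) = 0" using 2 by auto
      consider "fst f = 0" | "snd f = 0" | "fst f \<noteq> 0" "snd f \<noteq> 0" by auto
      then show False
      proof cases
        case 1
        then have "degree (snd f) \<ge> 1" using assms(2) by (simp add: rat_deg_def)
        then show False using poly_root nocommon 1 by fastforce
      next
        case x: 2
        then have "degree (fst f) \<ge> 1" using assms(2) by (simp add: rat_deg_def)
        then show False using poly_root nocommon x by fastforce
      next
        case 3
        obtain a where a: "s (Lin a) = 0" "poly (fst f) a = 0" using sn_zero_root[OF 2(2) s(1) 3(1)] by auto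
        obtain b where b: "s (Lin b) = 0" "poly (snd f) b = 0" using sn_zero_root[OF 2(2) s(2) 3(2)] by auto
        have "a = b" using sn_Lin_eq[OF 2(2), of a b] a b by (cases "a = b") auto
        then show False using nocommon a b by auto
      qed
    qed
  next
    case 1
    have "fst f \<noteq> 0 \<or> snd f \<noteq> 0" using assms(2) by (auto simp: rat_deg_def)
    then have "coeff (fst f) (rat_deg f) \<noteq> 0 \<or> coeff (snd f) (rat_deg f) \<noteq> 0"
      using assms(2) by (auto simp: rat_deg_def max_def split: if_splits)
    then show ?thesis using 1 by simp
  qed
qed fact

section \<open>The inversion\<close>

definition iota :: "'k poly \<times> 'k poly" where "iota = (1, [:0, 1:])"

lemma nondeg_iota: "nondeg iota" "rat_deg iota = 1"
proof -
  show "rat_deg iota = 1" by (simp add: rat_deg_def iota_def)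
  then show "nondeg iota" unfolding nondeg_def iota_def by (auto elim!: BP_cases simp: sn_1)
qed

lemma rat_comp_iota_left: "rat_comp iota f = (snd f, fst f)"
  by (simp add: rat_comp_def nondeg_iota, simp add: iota_def hcomp_def)

lemma iota_iota: "z \<in> BP av \<Longrightarrow> berk_map av iota (berk_map av iota z) = z"
  using rat_comp_correct(3)[OF nondeg_iota(1) nondeg_iota(1), of z] berk_map_ident[of z]
  by (simp add: rat_comp_iota_left) (simp add: iota_def)

text \<open>Links \<open>rev_deg\<close>, which defines the multiplier at infinity, to composition
  with the inversion.\<close>

lemma hcomp_rev_deg: fixes p :: "'k poly" assumes "degree p \<le> d" shows "hcomp d p 1 [:0, 1:] = rev_deg d p"
proof (rule poly_eqI)
  fix j
  have X: "[:0, 1:] ^ n = monom (1 :: 'k) n" for n by (simp add: monom_altdef)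
  have "coeff (hcomp d p 1 [:0, 1:]) j = (\<Sum>i\<le>d. if d - i = j then coeff p i else 0)"
    unfolding hcomp_def by (simp only: X coeff_sum coeff_smult coeff_monom power_one mult_1_left if_distrib mult_1_right mult_zero_right)
  also have "\<dots> = (if j \<le> d then coeff p (d - j) else 0)"
  proof (cases "j \<le> d")
    case True
    then have "(\<Sum>i\<le>d. if d - i = j then coeff p i else 0) = (\<Sum>i\<in>{d - j}. if d - i = j then coeff p i else 0)"
      by (intro sum.mono_neutral_right) auto
    then show ?thesis using True by simp
  next
    case False
    then show ?thesis by (auto intro!: sum.neutral)
  qed
  also have "\<dots> = coeff (rev_deg d p) j"
    by (auto simp: rev_deg_def coeff_Poly_eq nth_default_def simp del: upt_Suc)
  finally show "coeff (hcomp d p 1 [:0, 1:]) j = coeff (rev_deg d p) j" .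
qed

end

section \<open>Topology of open disks\<close>

context nonarch_field
begin

abbreviation "bt \<equiv> berk_top av"

lemma berk_subbasis_eval: "open U \<Longrightarrow> {Fin s | s. sn s \<and> s g \<in> U} \<in> berk_subbasis av"
  unfolding berk_subbasis_def by (rule UnI1, rule CollectI, intro exI conjI, rule refl)

lemma berk_subbasis_infty: "insert Inf {Fin s | s. sn s \<and> s [:0, 1:] > R} \<in> berk_subbasis av"
  unfolding berk_subbasis_def by (rule UnI2, rule CollectI, intro exI conjI, rule refl, rule TrueI)

lemma berk_subbasis_cases:
  assumes "W \<in> berk_subbasis av"
  obtains g U where "W = {Fin s | s. sn s \<and> s g \<in> U}" "open U" | R where "W = insert Inf {Fin s | s. sn s \<and> s [:0, 1:] > R}"
  using assms unfolding berk_subbasis_def by (elim UnE CollectE exE conjE) auto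

lemma berk_subbasis_subset: "W \<in> berk_subbasis av \<Longrightarrow> W \<subseteq> BP av"
  by (erule berk_subbasis_cases) auto

lemma topspace_bt: "topspace bt = BP av"
proof -
  have "z \<in> \<Union>(berk_subbasis av)" if "z \<in> BP av" for z
  proof (cases rule: BP_cases[OF that])
    case 1
    then show ?thesis using berk_subbasis_infty by (intro UnionI) auto
  next
    case (2 s)
    then have "z \<in> {Fin s | s. sn s \<and> s 0 \<in> UNIV}" by auto
    then show ?thesis using berk_subbasis_eval[OF open_UNIV] by (intro UnionI)
  qed
  then show ?thesis unfolding berk_top_def by (auto simp: topology_generated_by_topspace)
qed

lemma openin_bt_subbasis: "W \<in> berk_subbasis av \<Longrightarrow> openin bt W"
  unfolding berk_top_def using berk_subbasis_subset[of W]
  by (auto simp: openin_subtopology intro!: exI[of _ W] topology_generated_by_Basis)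

lemma openin_bt_eval: "open U \<Longrightarrow> openin bt {Fin s | s. sn s \<and> s g \<in> U}"
  by (rule openin_bt_subbasis[OF berk_subbasis_eval])

lemma openin_bt_infty: "openin bt (insert Inf {Fin s | s. sn s \<and> s (Lin 0) > R})"
  using openin_bt_subbasis[OF berk_subbasis_infty] by (simp add: Lin_def)

text \<open>Exact agreement on a finite set replaces the usual tolerances; it is enough because
  \<open>finite_poly_agree\<close> produces exact agreement.\<close>

lemma generated_nhd_Fin:
  assumes "generate_topology_on (berk_subbasis av) W" "Fin s \<in> W"
  shows "\<exists>F. finite F \<and> (\<forall>s'. sn s' \<longrightarrow> (\<forall>p\<in>F. s' p = s p) \<longrightarrow> Fin s' \<in> W)"
  using assms
proof (induction W rule: generate_topology_on.induct)
  case (Int a b)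
  then obtain F F' where "finite F" "\<forall>s'. sn s' \<longrightarrow> (\<forall>p\<in>F. s' p = s p) \<longrightarrow> Fin s' \<in> a"
    "finite F'" "\<forall>s'. sn s' \<longrightarrow> (\<forall>p\<in>F'. s' p = s p) \<longrightarrow> Fin s' \<in> b" by auto
  then show ?case by (intro exI[of _ "F \<union> F'"]) auto
next
  case (UN K)
  then obtain k where "k \<in> K" "Fin s \<in> k" by auto
  then show ?case using UN.IH[of k] by (metis UnionI)
next
  case (Basis a)
  then consider g U where "a = {Fin s | s. sn s \<and> s g \<in> U}" | R where "a = insert Inf {Fin s | s. sn s \<and> s [:0, 1:] > R}"
    by (auto elim: berk_subbasis_cases)
  then show ?case
  proof cases
    case 1
    then show ?thesis using Basis by (intro exI[of _ "{g}"]) auto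
  next
    case 2
    then show ?thesis using Basis by (intro exI[of _ "{[:0, 1:]}"]) auto
  qed
qed auto

lemma generated_nhd_Inf:
  assumes "generate_topology_on (berk_subbasis av) W" "Inf \<in> W"
  shows "\<exists>R. \<forall>s. sn s \<longrightarrow> s (Lin 0) > R \<longrightarrow> Fin s \<in> W"
  using assms
proof (induction W rule: generate_topology_on.induct)
  case (Int a b)
  then obtain R R' where "\<forall>s. sn s \<longrightarrow> s (Lin 0) > R \<longrightarrow> Fin s \<in> a" "\<forall>s. sn s \<longrightarrow> s (Lin 0) > R' \<longrightarrow> Fin s \<in> b" by auto
  then show ?case by (intro exI[of _ "max R R'"]) auto
next
  case (UN K)
  then obtain k where "k \<in> K" "Inf \<in> k" by auto
  then show ?case using UN.IH[of k] by (metis UnionI)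
next
  case (Basis a)
  show ?case
    by (rule berk_subbasis_cases[OF Basis(1)]) (use Basis(2) in \<open>auto simp: Lin_def\<close>)
qed auto

lemma openin_bt_generated:
  assumes "openin bt W" obtains V where "generate_topology_on (berk_subbasis av) V" "W = V \<inter> BP av"
  using assms unfolding berk_top_def openin_subtopology openin_topology_generated_by_iff by blast

lemma bt_nhd_Fin:
  assumes "openin bt W" "Fin s \<in> W"
  shows "\<exists>F. finite F \<and> (\<forall>s'. sn s' \<longrightarrow> (\<forall>p\<in>F. s' p = s p) \<longrightarrow> Fin s' \<in> W)"
proof -
  obtain V where V: "generate_topology_on (berk_subbasis av) V" "W = V \<inter> BP av" using assms(1) by (rule openin_bt_generated)
  then obtain F where "finite F" "\<forall>s'. sn s' \<longrightarrow> (\<forall>p\<in>F. s' p = s p) \<longrightarrow> Fin s' \<in> V"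
    using generated_nhd_Fin[OF V(1), of s] assms(2) by auto
  then show ?thesis using V(2) by (intro exI[of _ F]) auto
qed

lemma bt_nhd_Inf:
  assumes "openin bt W" "Inf \<in> W" shows "\<exists>R. \<forall>s. sn s \<longrightarrow> s (Lin 0) > R \<longrightarrow> Fin s \<in> W"
proof -
  obtain V where V: "generate_topology_on (berk_subbasis av) V" "W = V \<inter> BP av" using assms(1) by (rule openin_bt_generated)
  then obtain R where "\<forall>s. sn s \<longrightarrow> s (Lin 0) > R \<longrightarrow> Fin s \<in> V"
    using generated_nhd_Inf[OF V(1)] assms(2) by auto
  then show ?thesis using V(2) by (intro exI[of _ R]) auto
qed

lemma gs_path_continuous:
  assumes "I \<subseteq> {0..}" shows "continuous_map (top_of_set I) bt (\<lambda>t. Fin (gs a t))"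
  unfolding berk_top_def continuous_map_in_subtopology
proof
  show "continuous_map (top_of_set I) (topology_generated_by (berk_subbasis av)) (\<lambda>t. Fin (gs a t))"
  proof (rule continuous_on_generated_topo)
    have pre: "openin (top_of_set I) {t \<in> I. gs a t g \<in> U}" if "open U" for g U
    proof -
      have "continuous_on I (\<lambda>t. gs a t g)" by (rule continuous_on_subset[OF gs_continuous assms])
      then have "openin (top_of_set I) (I \<inter> (\<lambda>t. gs a t g) -` U)" using that by (rule continuous_openin_preimage_gen)
      moreover have "I \<inter> (\<lambda>t. gs a t g) -` U = {t \<in> I. gs a t g \<in> U}" by auto
      ultimately show ?thesis by simp
    qed
    fix W assume "W \<in> berk_subbasis av"
    then consider g U where "W = {Fin s | s. sn s \<and> s g \<in> U}" "open U" | R where "W = insert Inf {Fin s | s. sn s \<and> s [:0, 1:] > R}"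
      by (auto elim: berk_subbasis_cases)
    then show "openin (top_of_set I) ((\<lambda>t. Fin (gs a t)) -` W \<inter> topspace (top_of_set I))"
    proof cases
      case 1
      have "(\<lambda>t. Fin (gs a t)) -` W \<inter> topspace (top_of_set I) = {t \<in> I. gs a t g \<in> U}"
        using 1 gs_sn assms by auto
      then show ?thesis using pre[OF 1(2)] by simp
    next
      case 2
      have "(\<lambda>t. Fin (gs a t)) -` W \<inter> topspace (top_of_set I) = {t \<in> I. gs a t [:0, 1:] \<in> {R<..}}"
        using 2 gs_sn assms by auto
      then show ?thesis using pre[of "{R<..}" "[:0, 1:]"] by simp
    qed
  next
    have "Fin (gs a t) \<in> \<Union>(berk_subbasis av)" if "t \<in> I" for t
    proof -
      have "Fin (gs a t) \<in> topspace bt" using topspace_bt gs_sn[of t a] that assms by auto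
      then show ?thesis unfolding berk_top_def by (auto simp: topology_generated_by_topspace)
    qed
    then show "(\<lambda>t. Fin (gs a t)) ` topspace (top_of_set I) \<subseteq> \<Union>(berk_subbasis av)" by auto
  qed
  show "(\<lambda>t. Fin (gs a t)) \<in> topspace (top_of_set I) \<rightarrow> BP av" using gs_sn assms by auto
qed

lemma gs_path_connected:
  assumes "connected I" "I \<subseteq> {0..}" shows "connectedin bt ((\<lambda>t. Fin (gs a t)) ` I)"
  by (rule connectedin_continuous_map_image[OF gs_path_continuous[OF assms(2)]]) (simp add: connectedin_subtopology assms(1) connectedin_iff_connected)

section \<open>Open disks, their connectedness and their boundary points\<close>

definition disk :: "'k \<Rightarrow> real \<Rightarrow> 'k berk set" where
  "disk a r = {Fin s | s. sn s \<and> s (Lin a) < r}"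

definition disk_infty :: "real \<Rightarrow> 'k berk set" where
  "disk_infty R = insert Inf {Fin s | s. sn s \<and> s (Lin 0) > R}"

lemma disk_BP: "disk a r \<subseteq> BP av" and disk_infty_BP: "disk_infty R \<subseteq> BP av"
  unfolding disk_def disk_infty_def BP_def by auto

lemma disk_open: "openin bt (disk a r)"
  using openin_bt_eval[of "{..<r}" "Lin a"] by (simp add: disk_def)

lemma disk_infty_open: "openin bt (disk_infty R)"
  unfolding disk_infty_def by (rule openin_bt_infty)

text \<open>\<open>C\<close> is dense in \<open>D\<close>: adjoin the test polynomial
  \<open>q\<close> to the finite set of a neighbourhood and take an agreeing disk point;
  \<open>q\<close> certifies that it lies in \<open>C\<close>. A set between a connected set and its
  closure is connected.\<close>

lemma connectedin_dense:
  assumes conn: "connectedin bt C" and C: "C \<subseteq> D" and D: "D \<subseteq> BP av"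
    and dense: "\<And>s. Fin s \<in> D \<Longrightarrow> \<exists>q. \<forall>b t. t \<ge> 0 \<longrightarrow> gs b t q = s q \<longrightarrow> Fin (gs b t) \<in> C"
    and inf: "Inf \<in> D \<Longrightarrow> Inf \<in> C"
  shows "connectedin bt D"
proof (rule connectedin_intermediate_closure_of[OF conn C])
  show "D \<subseteq> bt closure_of C"
  proof
    fix z assume z: "z \<in> D"
    show "z \<in> bt closure_of C"
    proof (cases z)
      case Inf
      then show ?thesis using z inf closure_of_subset[of C bt] C D topspace_bt by auto
    next
      case (Fin s)
      then have s: "sn s" using z D by auto
      obtain q where q: "\<And>b t. t \<ge> 0 \<Longrightarrow> gs b t q = s q \<Longrightarrow> Fin (gs b t) \<in> C" using dense Fin z by blast
      show ?thesis unfolding in_closure_of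
      proof (intro conjI allI impI)
        show "z \<in> topspace bt" using z D topspace_bt by auto
        fix W assume W: "z \<in> W \<and> openin bt W"
        obtain F where F: "finite F" "\<forall>s'. sn s' \<longrightarrow> (\<forall>p\<in>F. s' p = s p) \<longrightarrow> Fin s' \<in> W"
          using bt_nhd_Fin W Fin by blast
        obtain b where b: "\<forall>p\<in>insert q F. s p = gs b (s (Lin b)) p"
          using finite_poly_agree[OF s, of "insert q F"] F by auto
        have t: "s (Lin b) \<ge> 0" by (rule sn_nonneg[OF s])
        then have "Fin (gs b (s (Lin b))) \<in> W" using F(2) gs_sn[OF t] b by auto
        moreover have "Fin (gs b (s (Lin b))) \<in> C" using q[OF t] b by auto
        ultimately show "\<exists>y. y \<in> C \<and> y \<in> W" by blast
      qed
    qed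
  qed
qed

lemma disk_connected: "connectedin bt (disk a r)"
proof (cases "r > 0")
  case True
  \<comment> \<open>Vertical paths over all centres \<open>b\<close> in the disk; the one over
    \<open>b\<close> joins the one over \<open>a\<close> at radius
    \<open>av (b - a)\<close>.\<close>
  define C where "C = (\<Union>b\<in>{b. av (b - a) < r}. (\<lambda>t. Fin (gs b t)) ` {0..<r} \<union> (\<lambda>t. Fin (gs a t)) ` {0..<r})"
  have cb: "connectedin bt ((\<lambda>t. Fin (gs b t)) ` {0..<r} \<union> (\<lambda>t. Fin (gs a t)) ` {0..<r})" if "av (b - a) < r" for b
  proof (rule connectedin_Un)
    have "gs b (av (b - a)) = gs a (av (b - a))" by (rule gs_recenter) auto
    then have "Fin (gs b (av (b - a))) \<in> (\<lambda>t. Fin (gs b t)) ` {0..<r} \<inter> (\<lambda>t. Fin (gs a t)) ` {0..<r}"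
      using that by (auto intro!: image_eqI[of _ _ "av (b - a)"])
    then show "(\<lambda>t. Fin (gs b t)) ` {0..<r} \<inter> (\<lambda>t. Fin (gs a t)) ` {0..<r} \<noteq> {}" by blast
  qed (auto intro!: gs_path_connected)
  have "connectedin bt C" unfolding C_def
  proof (rule connectedin_Union)
    have "Fin (gs a 0) \<in> \<Inter> ((\<lambda>b. (\<lambda>t. Fin (gs b t)) ` {0..<r} \<union> (\<lambda>t. Fin (gs a t)) ` {0..<r}) ` {b. av (b - a) < r})"
      using True by auto
    then show "\<Inter> ((\<lambda>b. (\<lambda>t. Fin (gs b t)) ` {0..<r} \<union> (\<lambda>t. Fin (gs a t)) ` {0..<r}) ` {b. av (b - a) < r}) \<noteq> {}" by blast
  qed (use cb in auto)
  moreover have "C \<subseteq> disk a r" unfolding C_def disk_def using gs_sn by (auto simp: gs_Lin)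
  moreover have "Fin (gs b t) \<in> C" if "t \<ge> 0" "gs b t (Lin a) < r" for b t
    using that unfolding C_def by (auto simp: gs_Lin)
  note facts = this
  show ?thesis
  proof (rule connectedin_dense[OF \<open>connectedin bt C\<close> \<open>C \<subseteq> disk a r\<close> disk_BP])
    fix s assume "Fin s \<in> disk a r"
    then have "s (Lin a) < r" by (auto simp: disk_def)
    then show "\<exists>q. \<forall>b t. t \<ge> 0 \<longrightarrow> gs b t q = s q \<longrightarrow> Fin (gs b t) \<in> C"
      using facts by (intro exI[of _ "Lin a"]) auto
  qed (auto simp: disk_def)
next
  case False
  then have "disk a r = {}" unfolding disk_def using sn_nonneg by (auto simp: not_less intro: order_trans)
  then show ?thesis by simp
qed

lemma disk_infty_connected: assumes "R \<ge> 0" shows "connectedin bt (disk_infty R)"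
proof -
  \<comment> \<open>Paths of growing radius; \<open>Inf\<close> is a limit point of each of them, so
    they all meet there.\<close>
  define K where "K = (\<lambda>(b, t). insert Inf ((\<lambda>t. Fin (gs b t)) ` {t..}))"
  have K: "connectedin bt (K (b, t))" if "t \<ge> 0" for b t
  proof -
    have c: "connectedin bt ((\<lambda>t. Fin (gs b t)) ` {t..})" using that by (intro gs_path_connected) auto
    have sub: "(\<lambda>t. Fin (gs b t)) ` {t..} \<subseteq> topspace bt" using connectedin_subset_topspace[OF c] .
    have "Inf \<in> bt closure_of ((\<lambda>t. Fin (gs b t)) ` {t..})" unfolding in_closure_of
    proof (intro conjI allI impI)
      show "Inf \<in> topspace bt" by (simp add: topspace_bt)
      fix W :: "'k berk set" assume W: "Inf \<in> W \<and> openin bt W"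
      obtain M where M: "\<forall>s. sn s \<longrightarrow> s (Lin 0) > M \<longrightarrow> Fin s \<in> W" using bt_nhd_Inf W by blast
      define u where "u = max t (M + 1)"
      have "Fin (gs b u) \<in> W" using M gs_sn[of u b] that by (auto simp: u_def gs_Lin)
      then show "\<exists>y. y \<in> (\<lambda>t. Fin (gs b t)) ` {t..} \<and> y \<in> W" by (auto simp: u_def)
    qed
    then show ?thesis unfolding K_def
      using closure_of_subset[OF sub] by (auto intro!: connectedin_intermediate_closure_of[OF c])
  qed
  define J where "J = {(b, t). t \<ge> 0 \<and> gs b t (Lin 0) > R}"
  define C where "C = insert Inf (\<Union>(K ` J))"
  have "connectedin bt C"
  proof (cases "J = {}")
    case True
    then show ?thesis unfolding C_def by (simp add: connectedin_sing topspace_bt)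
  next
    case False
    have "connectedin bt (\<Union>(K ` J))"
    proof (rule connectedin_Union)
      have "Inf \<in> \<Inter> (K ` J)" by (auto simp: K_def)
      then show "\<Inter> (K ` J) \<noteq> {}" by blast
    qed (auto simp: J_def K)
    moreover have "C = \<Union>(K ` J)" using False unfolding C_def K_def by auto
    ultimately show ?thesis by simp
  qed
  moreover have "C \<subseteq> disk_infty R" unfolding C_def K_def J_def disk_infty_def
    using gs_sn by (auto simp: gs_Lin) 
  moreover have "Fin (gs b t) \<in> C" if "t \<ge> 0" "gs b t (Lin 0) > R" for b t
    using that unfolding C_def K_def J_def by auto
  note facts = this
  show ?thesis
  proof (rule connectedin_dense[OF \<open>connectedin bt C\<close> \<open>C \<subseteq> disk_infty R\<close> disk_infty_BP])
    fix s assume "Fin s \<in> disk_infty R"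
    then have "s (Lin 0) > R" by (auto simp: disk_infty_def)
    then show "\<exists>q. \<forall>b t. t \<ge> 0 \<longrightarrow> gs b t q = s q \<longrightarrow> Fin (gs b t) \<in> C"
      using facts by (intro exI[of _ "Lin 0"]) auto
  qed (auto simp: C_def)
qed

lemma frontier_of_eq_sing:
  assumes "openin bt D" "b \<in> bt closure_of D" "b \<notin> D"
    and "\<And>z. z \<in> BP av \<Longrightarrow> z \<notin> D \<Longrightarrow> z \<noteq> b \<Longrightarrow> \<exists>W. openin bt W \<and> z \<in> W \<and> W \<inter> D = {}"
  shows "bt frontier_of D = {b}"
proof -
  have "bt closure_of D \<subseteq> insert b D"
  proof
    fix z assume z: "z \<in> bt closure_of D"
    then have "z \<in> BP av" using topspace_bt by (metis in_closure_of)
    then show "z \<in> insert b D" using assms(4)[of z] z unfolding in_closure_of by blast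
  qed
  moreover have "bt interior_of D = D" using assms(1) by (simp add: interior_of_openin)
  moreover have "D \<subseteq> bt closure_of D" using assms(1) by (intro closure_of_subset openin_subset)
  ultimately show ?thesis using assms(2,3) unfolding frontier_of_def by auto
qed

lemma gs_path_limit:
  assumes I: "I \<subseteq> {0..}" and t: "t \<in> closure I" "t \<ge> 0" and D: "\<And>u. u \<in> I \<Longrightarrow> Fin (gs a u) \<in> D"
  shows "Fin (gs a t) \<in> bt closure_of D"
proof -
  have "(\<lambda>u. Fin (gs a u)) ` (top_of_set {0..} closure_of I) \<subseteq> bt closure_of ((\<lambda>u. Fin (gs a u)) ` I)"
    by (rule continuous_map_image_closure_subset[OF gs_path_continuous]) auto
  moreover have "t \<in> top_of_set {0..} closure_of I" using t I by (simp add: closure_of_subtopology Int_absorb1)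
  ultimately have "Fin (gs a t) \<in> bt closure_of ((\<lambda>u. Fin (gs a u)) ` I)" by blast
  moreover have "bt closure_of ((\<lambda>u. Fin (gs a u)) ` I) \<subseteq> bt closure_of D" using D by (intro closure_of_mono) auto
  ultimately show ?thesis by blast
qed

lemma disk_frontier: assumes r: "r > 0" shows "bt frontier_of disk a r = {Fin (gs a r)}"
proof (rule frontier_of_eq_sing[OF disk_open])
  show "Fin (gs a r) \<in> bt closure_of disk a r"
    by (rule gs_path_limit[of "{0..<r}"]) (use r gs_sn in \<open>auto simp: disk_def gs_Lin\<close>)
  show "Fin (gs a r) \<notin> disk a r" using r by (auto simp: disk_def gs_Lin)
  fix z assume z: "z \<in> BP av" "z \<notin> disk a r" "z \<noteq> Fin (gs a r)"
  show "\<exists>W. openin bt W \<and> z \<in> W \<and> W \<inter> disk a r = {}"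
  proof (cases rule: BP_cases[OF z(1)])
    case 1
    have "disk_infty (max r (av a)) \<inter> disk a r = {}"
    proof -
      have False if "sn s" "s (Lin a) < r" "s (Lin 0) > max r (av a)" for s
        using sn_Lin[OF that(1), of 0 a] that by auto
      then show ?thesis unfolding disk_def disk_infty_def by blast
    qed
    moreover have "z \<in> disk_infty (max r (av a))" using 1 by (simp add: disk_infty_def)
    ultimately show ?thesis using disk_infty_open by blast
  next
    case (2 s)
    then have ge: "s (Lin a) \<ge> r" using z by (auto simp: disk_def)
    show ?thesis
    proof (cases "s (Lin a) = r")
      case False
      then show ?thesis using ge 2 openin_bt_eval[of "{r<..}" "Lin a"]
        by (intro exI[of _ "{Fin s |s. sn s \<and> s (Lin a) \<in> {r<..}}"]) (auto simp: disk_def)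
    next
      case True
      \<comment> \<open>A point at distance exactly \<open>r\<close> from \<open>a\<close>, other
        than the boundary point, lies in another residue disk: some \<open>b\<close> with
        \<open>av (a - b) = r\<close> has \<open>s (Lin b) < r\<close>, and that open disk misses
        \<open>disk a r\<close>.\<close>
      obtain b where b: "s (Lin b) \<noteq> max r (av (a - b))" using gs_eqI[OF 2(2), of r a] r z 2 by auto
      then have ab: "av (a - b) = r" "s (Lin b) < r"
        using sn_Lin[OF 2(2), of b a] sn_Lin_eq2[OF 2(2), of a b] sn_Lin_eq[OF 2(2), of a b] True
        by (cases "av (a - b)" r rule: linorder_cases; force)+
      have "{Fin s |s. sn s \<and> s (Lin b) \<in> {..<r}} \<inter> disk a r = {}"
      proof -
        have False if "sn s" "s (Lin a) < r" "s (Lin b) < r" for s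
          using sn_Lin_eq[OF that(1), of a b] that ab by auto
        then show ?thesis unfolding disk_def by blast
      qed
      then show ?thesis using 2 ab openin_bt_eval[of "{..<r}" "Lin b"]
        by (intro exI[of _ "{Fin s |s. sn s \<and> s (Lin b) \<in> {..<r}}"]) auto
    qed
  qed
qed

lemma disk_infty_frontier: assumes R: "R > 0" shows "bt frontier_of disk_infty R = {Fin (gs 0 R)}"
proof (rule frontier_of_eq_sing[OF disk_infty_open])
  show "Fin (gs 0 R) \<in> bt closure_of disk_infty R"
    by (rule gs_path_limit[of "{R<..}"]) (use R gs_sn in \<open>auto simp: disk_infty_def gs_Lin\<close>)
  show "Fin (gs 0 R) \<notin> disk_infty R" using R by (auto simp: disk_infty_def gs_Lin)
  fix z assume z: "z \<in> BP av" "z \<notin> disk_infty R" "z \<noteq> Fin (gs 0 R)"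
  show "\<exists>W. openin bt W \<and> z \<in> W \<and> W \<inter> disk_infty R = {}"
  proof (cases rule: BP_cases[OF z(1)])
    case 1
    then show ?thesis using z by (simp add: disk_infty_def)
  next
    case (2 s)
    then have ge: "s (Lin 0) \<le> R" using z by (auto simp: disk_infty_def)
    show ?thesis
    proof (cases "s (Lin 0) = R")
      case False
      then show ?thesis using ge 2 openin_bt_eval[of "{..<R}" "Lin 0"]
        by (intro exI[of _ "{Fin s |s. sn s \<and> s (Lin 0) \<in> {..<R}}"]) (auto simp: disk_infty_def)
    next
      case True
      obtain b where b: "s (Lin b) \<noteq> max R (av (0 - b))" using gs_eqI[OF 2(2), of R 0] R z 2 by auto
      then have ab: "av (0 - b) = R" "s (Lin b) < R"
        using sn_Lin[OF 2(2), of b 0] sn_Lin_eq2[OF 2(2), of 0 b] sn_Lin_eq[OF 2(2), of 0 b] True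
        by (cases "av (0 - b)" R rule: linorder_cases; force)+
      have "{Fin s |s. sn s \<and> s (Lin b) \<in> {..<R}} \<inter> disk_infty R = {}"
      proof -
        have False if "sn s" "s (Lin 0) > R" "s (Lin b) < R" for s
          using sn_Lin_eq2[OF that(1), of 0 b] that ab by auto
        then show ?thesis unfolding disk_infty_def by blast
      qed
      then show ?thesis using 2 ab openin_bt_eval[of "{..<R}" "Lin b"]
        by (intro exI[of _ "{Fin s |s. sn s \<and> s (Lin b) \<in> {..<R}}"]) auto
    qed
  qed
qed

lemma iota_Fin: assumes "sn s" "s (Lin 0) \<noteq> 0"
  shows "\<exists>s'. berk_map av iota (Fin s) = Fin s' \<and> sn s' \<and> (\<forall>b. s' (Lin b) = s (1 - smult b (Lin 0)) / s (Lin 0))"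
  using berk_map_Lin[OF nondeg_iota(1) assms(1)] assms(2) by (simp add: iota_def Lin_0)

text \<open>In the coordinate 1/z, the disk with centre a not equal to 0 and radius at most |a| is again
  a disk in the coordinate z; the disks around 0 become neighbourhoods of infinity.\<close>
lemma iota_disk_away:
  assumes "0 < r" "r \<le> av a"
  shows "berk_map av iota ` disk a r \<subseteq> disk (1 / a) (r / av a ^ 2)"
proof
  fix z assume "z \<in> berk_map av iota ` disk a r"
  then obtain s where s: "z = berk_map av iota (Fin s)" "sn s" "s (Lin a) < r" by (auto simp: disk_def)
  have a0: "a \<noteq> 0" using assms by auto
  have s0: "s (Lin 0) = av a" using sn_Lin_eq[OF s(2), of a 0] s assms by simp
  then obtain s' where s': "z = Fin s'" "sn s'" "\<forall>b. s' (Lin b) = s (1 - smult b (Lin 0)) / s (Lin 0)"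
    using iota_Fin[OF s(2)] s a0 by auto
  have "1 - smult (1 / a) (Lin 0) = smult (- 1 / a) (Lin a)"
    using a0 by (simp add: Lin_def one_pCons)
  then have "s' (Lin (1 / a)) = s (Lin a) / av a / av a"
    using s'(3) s0 sn_smult[OF s(2), of "-1 / a" "Lin a"] by (simp add: av_divide del: smult_minus_left)
  also have "\<dots> < r / av a ^ 2" using s(3) a0 by (simp add: power2_eq_square divide_strict_right_mono)
  finally show "z \<in> disk (1 / a) (r / av a ^ 2)" using s' by (auto simp: disk_def)
qed

lemma disk_iota_away:
  assumes "0 < r" "r \<le> av a"
  shows "berk_map av iota ` disk a r = disk (1 / a) (r / av a ^ 2)"
proof
  show "berk_map av iota ` disk a r \<subseteq> disk (1 / a) (r / av a ^ 2)" by (rule iota_disk_away[OF assms])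
  have a0: "a \<noteq> 0" using assms by auto
  have "berk_map av iota ` disk (1 / a) (r / av a ^ 2) \<subseteq> disk (1 / (1 / a)) (r / av a ^ 2 / av (1 / a) ^ 2)"
    using assms a0 by (intro iota_disk_away) (auto simp: av_divide field_simps power2_eq_square)
  also have "\<dots> = disk a r" using a0 by (simp add: av_divide power_divide)
  finally have sub: "berk_map av iota ` disk (1 / a) (r / av a ^ 2) \<subseteq> disk a r" .
  show "disk (1 / a) (r / av a ^ 2) \<subseteq> berk_map av iota ` disk a r"
  proof
    fix z assume z: "z \<in> disk (1 / a) (r / av a ^ 2)"
    then have "berk_map av iota (berk_map av iota z) = z" using iota_iota disk_BP by blast
    then show "z \<in> berk_map av iota ` disk a r" using sub z by (metis imageI image_subset_iff)
  qed
qed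

lemma disk_iota_zero:
  assumes "0 < r" shows "berk_map av iota ` disk 0 r = disk_infty (1 / r)"
proof
  show "berk_map av iota ` disk 0 r \<subseteq> disk_infty (1 / r)"
  proof
    fix z assume "z \<in> berk_map av iota ` disk 0 r"
    then obtain s where s: "z = berk_map av iota (Fin s)" "sn s" "s (Lin 0) < r" by (auto simp: disk_def)
    show "z \<in> disk_infty (1 / r)"
    proof (cases "s (Lin 0) = 0")
      case True
      then have "z = Inf" using s by (simp add: berk_map_def iota_def Lin_0)
      then show ?thesis by (simp add: disk_infty_def)
    next
      case False
      then obtain s' where s': "z = Fin s'" "sn s'" "\<forall>b. s' (Lin b) = s (1 - smult b (Lin 0)) / s (Lin 0)"
        using iota_Fin[OF s(2)] s by auto
      have "s' (Lin 0) = 1 / s (Lin 0)" using s'(3) by (simp add: sn_1[OF s(2)])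
      moreover have "1 / s (Lin 0) > 1 / r" using s(3) False sn_nonneg[OF s(2), of "Lin 0"] assms by (simp add: frac_less2)
      ultimately show ?thesis using s' by (auto simp: disk_infty_def)
    qed
  qed
  show "disk_infty (1 / r) \<subseteq> berk_map av iota ` disk 0 r"
  proof
    fix z assume z: "z \<in> disk_infty (1 / r)"
    then have zB: "z \<in> BP av" using disk_infty_BP by auto
    have "berk_map av iota z \<in> disk 0 r"
    proof (cases rule: BP_cases[OF zB])
      case 1
      then show ?thesis using assms gs_sn[of 0 0] by (simp add: berk_map_def iota_def typeI_gs disk_def gs_Lin)
    next
      case (2 s)
      then have s: "s (Lin 0) > 1 / r" using z by (auto simp: disk_infty_def)
      then have pos: "s (Lin 0) > 0" using assms by (meson divide_pos_pos less_trans zero_less_one)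
      then obtain s' where s': "berk_map av iota z = Fin s'" "sn s'" "\<forall>b. s' (Lin b) = s (1 - smult b (Lin 0)) / s (Lin 0)"
        using iota_Fin[OF 2(2)] 2 by auto
      have "s' (Lin 0) = 1 / s (Lin 0)" using s'(3) by (simp add: sn_1[OF 2(2)])
      also have "\<dots> < r" using s pos assms by (simp add: field_simps)
      finally show ?thesis using s' by (auto simp: disk_def)
    qed
    then show "z \<in> berk_map av iota ` disk 0 r" using iota_iota[OF zB] by (metis imageI)
  qed
qed

text \<open>The only boundary point lies in \<open>G\<close>, so \<open>D\<close> is open and closed
  in the complement of \<open>G\<close>; being connected, it is a component.\<close>

lemma Gamma_domainI:
  assumes "openin bt D" "connectedin bt D" "D \<noteq> {}" "bt frontier_of D = {b}" "b \<in> G" "D \<inter> G = {}"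
  shows "Gamma_domain av G D"
proof -
  define Y where "Y = subtopology bt (BP av - G)"
  have D: "D \<subseteq> BP av" using openin_subset[OF assms(1)] topspace_bt by auto
  have cl: "bt closure_of D = insert b D"
    using assms(1,4) openin_subset[OF assms(1)] closure_of_subset[of D bt] unfolding frontier_of_def by (auto simp: interior_of_openin)
  have o: "openin Y D" unfolding Y_def openin_subtopology using assms(1,6) D by blast
  have "bt closure_of D \<inter> (BP av - G) = D" unfolding cl using assms(5,6) D by auto
  then have c: "closedin Y D" unfolding Y_def closedin_subtopology by (metis closedin_closure_of)
  have cY: "connectedin Y D" unfolding Y_def connectedin_subtopology using assms(2,6) D by auto
  obtain x where x: "x \<in> D" using assms(3) by auto
  have xY: "x \<in> topspace Y" using x o openin_subset by blast
  have "connected_component_of_set Y x = D"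
  proof
    show "D \<subseteq> connected_component_of_set Y x" using cY x by (simp add: connected_component_of_maximal)
    show "connected_component_of_set Y x \<subseteq> D"
      using connectedin_clopen_cases[OF connectedin_connected_component_of[of Y x] c o] x xY
      by (metis connected_component_of_refl disjnt_iff mem_Collect_eq)
  qed
  then show ?thesis unfolding Gamma_domain_def Y_def[symmetric] connected_components_of_def using xY by blast
qed

lemma Gamma_domain_unique:
  assumes "Gamma_domain av G U" "Gamma_domain av G V" "x \<in> U" "x \<in> V" shows "U = V"
  using assms unfolding Gamma_domain_def
  by (meson connected_components_of_overlap disjoint_iff)

lemma Gamma_domain_disjoint: "Gamma_domain av G U \<Longrightarrow> U \<subseteq> BP av - G"
  unfolding Gamma_domain_def using connected_components_of_subset by fastforce

end

section \<open>Dynamics on rooted trees\<close>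

lemma funpow_app: "(f ^^ (m + n)) x = (f ^^ m) ((f ^^ n) x)"
  by (simp add: funpow_add)

locale rooted_tree =
  fixes T :: "'a set" and root :: 'a and par :: "'a \<Rightarrow> 'a" and ht :: "'a \<Rightarrow> nat"
  assumes root_in: "root \<in> T" and ht_root: "ht root = 0"
    and par_in: "\<And>x. x \<in> T \<Longrightarrow> x \<noteq> root \<Longrightarrow> par x \<in> T"
    and ht_par: "\<And>x. x \<in> T \<Longrightarrow> x \<noteq> root \<Longrightarrow> ht x = Suc (ht (par x))"
begin

text \<open>The bound \<open>j \<le> ht y\<close> stops the ascent at the root, where
  \<open>par\<close> is unspecified. Heights grow away from the root.\<close>

definition anc :: "'a \<Rightarrow> 'a \<Rightarrow> bool" (infix "\<sqsubseteq>" 50) where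
  "x \<sqsubseteq> y \<longleftrightarrow> (\<exists>j\<le>ht y. (par ^^ j) y = x)"

lemma iter_par: "y \<in> T \<Longrightarrow> j \<le> ht y \<Longrightarrow> (par ^^ j) y \<in> T \<and> ht ((par ^^ j) y) = ht y - j"
proof (induction j)
  case (Suc j)
  then have *: "(par ^^ j) y \<in> T" "ht ((par ^^ j) y) = ht y - j" by auto
  then have "(par ^^ j) y \<noteq> root" using Suc.prems ht_root by auto
  then show ?case using * par_in ht_par[of "(par ^^ j) y"] Suc.prems by auto
qed auto

lemma anc_iff: "y \<in> T \<Longrightarrow> x \<sqsubseteq> y \<longleftrightarrow> ht x \<le> ht y \<and> (par ^^ (ht y - ht x)) y = x"
  unfolding anc_def using iter_par by (metis diff_diff_cancel diff_le_self)

lemma anc_in: "y \<in> T \<Longrightarrow> x \<sqsubseteq> y \<Longrightarrow> x \<in> T"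
  unfolding anc_def using iter_par by auto

lemma anc_refl [simp]: "x \<sqsubseteq> x"
  unfolding anc_def by (rule exI[of _ 0]) auto

lemma anc_trans: "z \<in> T \<Longrightarrow> x \<sqsubseteq> y \<Longrightarrow> y \<sqsubseteq> z \<Longrightarrow> x \<sqsubseteq> z"
proof -
  assume "z \<in> T" "x \<sqsubseteq> y" "y \<sqsubseteq> z"
  then obtain i j where "i \<le> ht y" "(par ^^ i) y = x" "j \<le> ht z" "(par ^^ j) z = y"
    unfolding anc_def by auto
  then show ?thesis unfolding anc_def using iter_par[OF \<open>z \<in> T\<close>, of j]
    by (intro exI[of _ "i + j"]) (auto simp: funpow_add)
qed

lemma anc_ht: "y \<in> T \<Longrightarrow> x \<sqsubseteq> y \<Longrightarrow> ht x \<le> ht y"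
  using anc_iff by auto

lemma anc_eq: "y \<in> T \<Longrightarrow> x \<sqsubseteq> y \<Longrightarrow> ht x = ht y \<Longrightarrow> x = y"
  using anc_iff[of y x] by auto

lemma anc_antisym: "y \<in> T \<Longrightarrow> x \<sqsubseteq> y \<Longrightarrow> y \<sqsubseteq> x \<Longrightarrow> x = y"
  by (metis anc_eq anc_ht anc_in le_antisym)

lemma anc_comparable:
  assumes "z \<in> T" "x \<sqsubseteq> z" "y \<sqsubseteq> z" "ht x \<le> ht y" shows "x \<sqsubseteq> y"
proof -
  have 1: "(par ^^ (ht z - ht x)) z = x" "ht x \<le> ht z" "(par ^^ (ht z - ht y)) z = y" "ht y \<le> ht z"
    using assms anc_iff by auto
  have "(par ^^ (ht y - ht x)) y = (par ^^ ((ht y - ht x) + (ht z - ht y))) z"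
    using 1 by (simp only: funpow_add o_apply)
  also have "\<dots> = x" using 1 assms(4) by simp
  finally show ?thesis unfolding anc_def by (intro exI[of _ "ht y - ht x"]) auto
qed

lemma anc_par: "x \<in> T \<Longrightarrow> x \<noteq> root \<Longrightarrow> par x \<sqsubseteq> x"
  unfolding anc_def by (rule exI[of _ 1]) (auto simp: ht_par)

lemma anc_par_ne: "x \<in> T \<Longrightarrow> x \<noteq> root \<Longrightarrow> par x \<noteq> x"
  by (metis ht_par n_not_Suc_n)

lemma anc_par_cases: "y \<in> T \<Longrightarrow> x \<sqsubseteq> y \<Longrightarrow> x = y \<or> (y \<noteq> root \<and> x \<sqsubseteq> par y)"
proof -
  assume y: "y \<in> T" "x \<sqsubseteq> y"
  then obtain j where j: "j \<le> ht y" "(par ^^ j) y = x" unfolding anc_def by auto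
  show ?thesis
  proof (cases j)
    case (Suc i)
    then have "y \<noteq> root" using j ht_root by auto
    moreover have "(par ^^ i) (par y) = x" using j Suc by (simp add: funpow_swap1)
    moreover have "i \<le> ht (par y)" using j Suc y \<open>y \<noteq> root\<close> ht_par by auto
    ultimately show ?thesis unfolding anc_def by auto
  qed (use j in auto)
qed

lemma child_toward:
  assumes "y \<in> T" "x \<sqsubseteq> y" "x \<noteq> y"
  shows "\<exists>c. c \<in> T \<and> c \<noteq> root \<and> par c = x \<and> c \<sqsubseteq> y"
proof -
  obtain j where j: "j \<le> ht y" "(par ^^ j) y = x" using assms unfolding anc_def by auto
  then obtain i where i: "j = Suc i" using assms(3) by (cases j) auto
  have "(par ^^ i) y \<in> T" "ht ((par ^^ i) y) > 0" using iter_par[OF assms(1), of i] j i by auto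
  moreover have "(par ^^ i) y \<sqsubseteq> y" unfolding anc_def using j i by (intro exI[of _ i]) auto
  ultimately show ?thesis using j i ht_root by (intro exI[of _ "(par ^^ i) y"]) auto
qed

lemma child_unique:
  assumes "y \<in> T" "c \<sqsubseteq> y" "c' \<sqsubseteq> y" "c \<noteq> root" "c' \<noteq> root" "par c = par c'"
  shows "c = c'"
  using assms anc_comparable anc_in anc_eq ht_par by (metis le_refl)

lemma finite_anc: "y \<in> T \<Longrightarrow> finite {x. x \<sqsubseteq> y}"
proof -
  have "{x. x \<sqsubseteq> y} = (\<lambda>j. (par ^^ j) y) ` {..ht y}" unfolding anc_def by auto
  then show ?thesis by simp
qed

end

text \<open>A vertex x other than the root also stands for the edge above it, or for the open disk at
  \<open>par x\<close> that contains x; f acts on vertices, g on disks, and g need not agree with f. The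
  disks in B are those with uncontrolled image.\<close>
locale tree_dynamics = rooted_tree T root par ht
  for T :: "'a set" and root :: 'a and par :: "'a \<Rightarrow> 'a" and ht :: "'a \<Rightarrow> nat" +
  fixes f g :: "'a \<Rightarrow> 'a" and B :: "'a set" and C :: "'c set" and crit :: "'c \<Rightarrow> 'a \<Rightarrow> bool"
  assumes f_in: "\<And>x. x \<in> T \<Longrightarrow> f x \<in> T"
    and fin_B: "finite B" and root_B: "root \<in> B"
    and B_anc: "\<And>x y. y \<in> B \<Longrightarrow> x \<sqsubseteq> y \<Longrightarrow> x \<in> B"
    and g_in: "\<And>x. x \<in> T \<Longrightarrow> x \<notin> B \<Longrightarrow> g x \<in> T \<and> g x \<noteq> root \<and> par (g x) = f (par x)"
    and g_le: "\<And>x y. x \<in> T \<Longrightarrow> x \<notin> B \<Longrightarrow> y \<in> T \<Longrightarrow> x \<sqsubseteq> y \<Longrightarrow> g x \<sqsubseteq> f y"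
    and fin_C: "finite C"
    and crit_comp: "\<And>c x y. c \<in> C \<Longrightarrow> x \<in> T \<Longrightarrow> y \<in> T \<Longrightarrow> x \<noteq> root \<Longrightarrow> y \<noteq> root \<Longrightarrow>
        crit c x \<Longrightarrow> crit c y \<Longrightarrow> x \<sqsubseteq> y \<or> y \<sqsubseteq> x"
    and noncrit: "\<And>x. x \<in> T \<Longrightarrow> x \<notin> B \<Longrightarrow> (\<And>c. c \<in> C \<Longrightarrow> \<not> crit c x) \<Longrightarrow> g x = f x"
begin

lemma fn_in: "x \<in> T \<Longrightarrow> (f ^^ n) x \<in> T"
  by (induction n) (auto simp: f_in)

lemma notB_root: "x \<notin> B \<Longrightarrow> x \<noteq> root" using root_B by auto

text \<open>The child \<open>c\<close> of \<open>x\<close> towards \<open>y\<close> is outside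
  \<open>B\<close> too. Its image disk \<open>g c\<close> is attached to \<open>f x\<close> and
  contains \<open>f y\<close>, which puts \<open>f y\<close> strictly below
  \<open>f x\<close>.\<close>

lemma f_strict:
  assumes "x \<in> T" "x \<notin> B" "y \<in> T" "x \<sqsubseteq> y" "x \<noteq> y"
  shows "f x \<sqsubseteq> f y \<and> f x \<noteq> f y"
proof -
  obtain c where c: "c \<in> T" "c \<noteq> root" "par c = x" "c \<sqsubseteq> y"
    using child_toward assms by blast
  have "c \<notin> B" using B_anc anc_par[of c] c assms by auto
  then have 1: "g c \<sqsubseteq> f y" "par (g c) = f x" "g c \<in> T" "g c \<noteq> root" using c g_in g_le assms by auto
  then have 2: "f x \<sqsubseteq> g c" "f x \<noteq> g c" using anc_par[of "g c"] anc_par_ne[of "g c"] by auto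
  then have "f x \<sqsubseteq> f y" using 1 anc_trans f_in assms by blast
  moreover have "f x \<noteq> f y" using 1 2 anc_antisym by metis
  ultimately show ?thesis by simp
qed

lemma f_mono: "x \<in> T \<Longrightarrow> x \<notin> B \<Longrightarrow> y \<in> T \<Longrightarrow> x \<sqsubseteq> y \<Longrightarrow> f x \<sqsubseteq> f y"
  using f_strict by (cases "x = y") auto

section \<open>Vertices whose orbits avoid the bad set\<close>

definition stays_good :: "'a \<Rightarrow> bool" where "stays_good x \<longleftrightarrow> x \<in> T \<and> (\<forall>n. (f ^^ n) x \<notin> B)"
definition infinite_orbit :: "'a \<Rightarrow> bool" where "infinite_orbit x \<longleftrightarrow> inj (\<lambda>n. (f ^^ n) x)"

lemma stays_good_T: "stays_good x \<Longrightarrow> x \<in> T" and stays_good_B: "stays_good x \<Longrightarrow> x \<notin> B"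
  unfolding stays_good_def by (auto dest: spec[of _ 0])

lemma stays_good_f: "stays_good x \<Longrightarrow> stays_good (f x)"
  unfolding stays_good_def by (auto simp: f_in funpow_swap1 simp del: funpow.simps) (metis funpow.simps(2) funpow_swap1 o_apply)

lemma stays_good_fn: "stays_good x \<Longrightarrow> stays_good ((f ^^ n) x)"
  by (induction n) (auto simp: stays_good_f)

lemma stays_good_fn_mono: "stays_good x \<Longrightarrow> y \<in> T \<Longrightarrow> x \<sqsubseteq> y \<Longrightarrow> (f ^^ n) x \<sqsubseteq> (f ^^ n) y"
  by (induction n) (auto intro!: f_mono simp: fn_in stays_good_T stays_good_B stays_good_fn)

lemma stays_good_fn_strict: "stays_good x \<Longrightarrow> y \<in> T \<Longrightarrow> x \<sqsubseteq> y \<Longrightarrow> x \<noteq> y \<Longrightarrow> (f ^^ n) x \<sqsubseteq> (f ^^ n) y \<and> (f ^^ n) x \<noteq> (f ^^ n) y"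
proof (induction n)
  case (Suc n)
  then show ?case using f_strict[of "(f ^^ n) x" "(f ^^ n) y"] by (auto simp: fn_in stays_good_T stays_good_B stays_good_fn)
qed auto

text \<open>\<open>B\<close> contains all ancestors of its elements, and iteration keeps the order
  as long as the upper vertex avoids \<open>B\<close>.\<close>

lemma stays_good_down: "stays_good x \<Longrightarrow> y \<in> T \<Longrightarrow> x \<sqsubseteq> y \<Longrightarrow> stays_good y"
  unfolding stays_good_def using stays_good_fn_mono B_anc by (metis stays_good_def)

lemma infinite_orbit_iff: "infinite_orbit x \<longleftrightarrow> (\<forall>n p. p \<ge> 1 \<longrightarrow> (f ^^ (n + p)) x \<noteq> (f ^^ n) x)"
proof
  assume r: "\<forall>n p. p \<ge> 1 \<longrightarrow> (f ^^ (n + p)) x \<noteq> (f ^^ n) x"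
  have "(f ^^ m) x \<noteq> (f ^^ n) x" if "n < m" for m n
    using r[rule_format, of "m - n" n] that by auto
  then show "infinite_orbit x" unfolding infinite_orbit_def by (intro linorder_injI) metis
qed (fastforce simp: infinite_orbit_def inj_def)

lemma finite_orbit: "\<not> infinite_orbit x \<Longrightarrow> finite (range (\<lambda>n. (f ^^ n) x))"
proof -
  assume "\<not> infinite_orbit x"
  then obtain n p where np: "p \<ge> 1" "(f ^^ (n + p)) x = (f ^^ n) x" unfolding infinite_orbit_iff by auto
  have "(f ^^ m) x \<in> (\<lambda>n. (f ^^ n) x) ` {..n + p}" for m
  proof (induction m rule: less_induct)
    case (less m)
    show ?case
    proof (cases "m \<le> n + p")
      case False
      then have "(f ^^ m) x = (f ^^ ((m - n - p) + (n + p))) x" by simp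
      also have "\<dots> = (f ^^ (m - n - p)) ((f ^^ n) x)" using np(2) by (simp only: funpow_add[of "m - n - p"] o_apply)
      also have "\<dots> = (f ^^ ((m - n - p) + n)) x" by (simp only: funpow_add o_apply)
      also have "(m - n - p) + n = m - p" using False by simp
      finally show ?thesis using less.IH[of "m - p"] np False by auto
    qed auto
  qed
  then have "range (\<lambda>n. (f ^^ n) x) \<subseteq> (\<lambda>n. (f ^^ n) x) ` {..n + p}" by auto
  then show ?thesis by (meson finite_atMost finite_imageI finite_subset)
qed

lemma infinite_orbit_inf: "infinite_orbit x \<Longrightarrow> finite S \<Longrightarrow> \<exists>N. \<forall>n\<ge>N. (f ^^ n) x \<notin> S"
proof -
  assume "infinite_orbit x" "finite S"
  then have "finite ((\<lambda>n. (f ^^ n) x) -` S)" unfolding infinite_orbit_def by (intro finite_vimageI)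
  then obtain N where N: "\<forall>n\<in>(\<lambda>n. (f ^^ n) x) -` S. n < N"
    unfolding finite_nat_set_iff_bounded by blast
  have "(f ^^ n) x \<notin> S" if "n \<ge> N" for n
  proof
    assume "(f ^^ n) x \<in> S"
    then have "n \<in> (\<lambda>n. (f ^^ n) x) -` S" by simp
    then show False using N that by (meson leD)
  qed
  then show ?thesis by blast
qed

lemma infinite_orbit_fn: "infinite_orbit x \<Longrightarrow> infinite_orbit ((f ^^ n) x)"
  unfolding infinite_orbit_iff
proof (intro allI impI)
  fix m p :: nat assume "\<forall>n p. 1 \<le> p \<longrightarrow> (f ^^ (n + p)) x \<noteq> (f ^^ n) x" "1 \<le> p"
  then have "(f ^^ ((m + n) + p)) x \<noteq> (f ^^ (m + n)) x" by blast
  moreover have "(f ^^ ((m + n) + p)) x = (f ^^ (m + p)) ((f ^^ n) x)"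
    "(f ^^ (m + n)) x = (f ^^ m) ((f ^^ n) x)"
    using funpow_app[of "m + p" n f x] funpow_app[of m n f x] by (simp_all add: add_ac)
  ultimately show "(f ^^ (m + p)) ((f ^^ n) x) \<noteq> (f ^^ m) ((f ^^ n) x)" by simp
qed

lemma infinite_orbit_f_conv: "infinite_orbit (f x) \<Longrightarrow> infinite_orbit x"
  unfolding infinite_orbit_iff
proof (intro allI impI)
  fix n p :: nat assume *: "\<forall>n p. 1 \<le> p \<longrightarrow> (f ^^ (n + p)) (f x) \<noteq> (f ^^ n) (f x)" "1 \<le> p"
  then have "f ((f ^^ (n + p)) x) \<noteq> f ((f ^^ n) x)" by (metis funpow_swap1)
  then show "(f ^^ (n + p)) x \<noteq> (f ^^ n) x" by auto
qed

text \<open>The orbit of \<open>x\<close> consists of ancestors of the orbit of \<open>y\<close>,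
  and a finite set of vertices has only finitely many ancestors.\<close>

lemma good_wandering_down: assumes "stays_good x" "infinite_orbit x" "y \<in> T" "x \<sqsubseteq> y" shows "infinite_orbit y"
proof (rule ccontr)
  assume "\<not> infinite_orbit y"
  then have "finite (range (\<lambda>n. (f ^^ n) y))" by (rule finite_orbit)
  then have "finite (\<Union>z\<in>range (\<lambda>n. (f ^^ n) y). {w. w \<sqsubseteq> z})"
    using finite_anc fn_in assms by (intro finite_UN_I) auto
  moreover have "range (\<lambda>n. (f ^^ n) x) \<subseteq> (\<Union>z\<in>range (\<lambda>n. (f ^^ n) y). {w. w \<sqsubseteq> z})"
    using stays_good_fn_mono assms by auto
  ultimately have "finite (range (\<lambda>n. (f ^^ n) x))" using finite_subset by blast
  then show False using assms(2) unfolding infinite_orbit_def using finite_imageD by blast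
qed

text \<open>The disk of t, attached to b, is mapped strictly into itself by the p-th iterate and is entered
  by the orbit of z.\<close>
definition trap :: "'a \<Rightarrow> 'a \<Rightarrow> 'a \<Rightarrow> nat \<Rightarrow> bool" where
  "trap z b t p \<longleftrightarrow> t \<in> T \<and> t \<noteq> root \<and> par t = b \<and> stays_good t \<and> stays_good (f b) \<and> p \<ge> 1 \<and> t \<sqsubseteq> (f ^^ p) b \<and> (\<exists>n. t \<sqsubseteq> (f ^^ n) z)"

lemma wandering_dichotomy:
  assumes z: "z \<in> T" "infinite_orbit z"
  shows "(\<exists>b t p. trap z b t p) \<or>
    (\<exists>t p. p \<ge> 1 \<and> inj t \<and> (\<forall>n. stays_good (t n) \<and> g (t n) = t (Suc n) \<and> par (t (n + p)) = par (t n) \<and> f (par (t n)) = par (t (Suc n))) \<and> (\<exists>n. t 0 \<sqsubseteq> (f ^^ n) z))"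
proof -
  define \<zeta> where "\<zeta> n = (f ^^ n) z" for n
  have \<zeta>T: "\<zeta> n \<in> T" for n unfolding \<zeta>_def by (simp add: fn_in z)
  have \<zeta>S: "f (\<zeta> n) = \<zeta> (Suc n)" for n unfolding \<zeta>_def by simp
  have \<zeta>k: "(f ^^ k) (\<zeta> n) = \<zeta> (n + k)" for n k unfolding \<zeta>_def by (simp only: funpow_app[symmetric] add.commute[of k])
  obtain N where N: "\<And>n. n \<ge> N \<Longrightarrow> \<zeta> n \<notin> B" using infinite_orbit_inf[OF z(2) fin_B] unfolding \<zeta>_def by auto
  have \<zeta>infinite_orbit: "infinite_orbit (\<zeta> n)" for n unfolding \<zeta>_def using infinite_orbit_fn z by auto
  have \<zeta>stays_good: "stays_good (\<zeta> n)" if "n \<ge> N" for n unfolding stays_good_def using \<zeta>k \<zeta>T N that by auto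
  \<comment> \<open>\<open>P n\<close> collects the candidates on the branch above
    \<open>\<zeta> n\<close>; a topmost one exists because heights are natural numbers. The orbit is
    known to avoid \<open>B\<close> only from \<open>N\<close> on, hence the restriction
    \<open>n \<ge> N\<close> below.\<close>
  define P where "P n x \<longleftrightarrow> x \<sqsubseteq> \<zeta> n \<and> stays_good x \<and> infinite_orbit x" for n x
  define \<tau> where "\<tau> n = (SOME x. P n x \<and> (\<forall>y. P n y \<longrightarrow> ht x \<le> ht y))" for n
  have \<tau>0: "P n (\<tau> n) \<and> (\<forall>y. P n y \<longrightarrow> ht (\<tau> n) \<le> ht y)" if "n \<ge> N" for n
  proof -
    have "P n (\<zeta> n)" unfolding P_def using \<zeta>stays_good \<zeta>infinite_orbit that by auto
    then have "\<exists>x. P n x \<and> (\<forall>y. P n y \<longrightarrow> ht x \<le> ht y)"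
      using ex_has_least_nat[of "P n" "\<zeta> n" ht] by auto
    then show ?thesis unfolding \<tau>_def by (rule someI_ex)
  qed
  have \<tau>1: "\<tau> n \<sqsubseteq> \<zeta> n" "stays_good (\<tau> n)" "infinite_orbit (\<tau> n)" "\<tau> n \<in> T" "\<tau> n \<noteq> root" "\<tau> n \<notin> B" if "n \<ge> N" for n
    using \<tau>0[OF that] stays_good_T stays_good_B notB_root unfolding P_def by auto
  have \<tau>2: "\<tau> n \<sqsubseteq> x" if "n \<ge> N" "x \<sqsubseteq> \<zeta> n" "stays_good x" "infinite_orbit x" for n x
    using \<tau>0[OF that(1)] that anc_comparable[OF \<zeta>T] unfolding P_def by blast
  have \<tau>3: "n = m \<or> \<tau> n = \<tau> m" if "n \<ge> N" "m \<ge> N" "\<tau> n \<sqsubseteq> \<tau> m" for n m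
    using \<tau>2[of m "\<tau> n"] that \<tau>1 anc_antisym anc_trans \<zeta>T by metis
  \<comment> \<open>The \<open>k\<close>-th image of \<open>\<tau> n\<close> is again a candidate
    above \<open>\<zeta> (n + k)\<close>, so the topmost candidate lies above it. Equality may fail,
    and these drops are what has to be controlled.\<close>
  have \<tau>4: "\<tau> (n + k) \<sqsubseteq> (f ^^ k) (\<tau> n)" if "n \<ge> N" for n k
    using \<tau>2[of "n + k" "(f ^^ k) (\<tau> n)"] that stays_good_fn_mono[of "\<tau> n" "\<zeta> n" k] \<tau>1[OF that] \<zeta>T \<zeta>k stays_good_fn infinite_orbit_fn by auto
  show ?thesis
  proof (cases "inj_on \<tau> {N..}")
    case False
    then obtain n m where nm: "N \<le> n" "n < m" "\<tau> n = \<tau> m"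
      unfolding inj_on_def by (metis atLeast_iff linorder_neqE_nat)
    define b where "b = \<tau> n"
    define p where "p = m - n"
    have b: "stays_good b" "infinite_orbit b" "b \<in> T" using \<tau>1 nm b_def by auto
    have p: "p \<ge> 1" "m = n + p" using nm p_def by auto
    \<comment> \<open>The descent is strict, since \<open>b\<close> has an infinite orbit; the child
      of \<open>b\<close> towards its image is the trapped disk.\<close>
    have "b \<sqsubseteq> (f ^^ p) b" using \<tau>4[of n p] nm p b_def by auto
    moreover have "b \<noteq> (f ^^ p) b" using b(2) p unfolding infinite_orbit_iff by (metis add_0 funpow_0)
    ultimately obtain t where t: "t \<in> T" "t \<noteq> root" "par t = b" "t \<sqsubseteq> (f ^^ p) b"
      using child_toward fn_in b by metis
    have "stays_good t" using stays_good_down[OF b(1) t(1)] t anc_par by auto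
    moreover have "t \<sqsubseteq> \<zeta> m" using anc_trans[OF \<zeta>T t(4)] stays_good_fn_mono[of b "\<zeta> n" p] b nm \<tau>1 b_def p \<zeta>k \<zeta>T by metis
    ultimately have "trap z b t p" unfolding trap_def using t b p stays_good_f \<zeta>_def by auto
    then show ?thesis by blast
  next
    case inj: True
    \<comment> \<open>Disks containing the same critical point are comparable, while the
      \<open>\<tau> n\<close> are pairwise incomparable; so each critical point is met at most
      once.\<close>
    have "finite {n. n \<ge> N \<and> crit c (\<tau> n)}" if "c \<in> C" for c
    proof -
      have "n = m" if "n \<ge> N" "m \<ge> N" "crit c (\<tau> n)" "crit c (\<tau> m)" for n m
        using crit_comp[OF \<open>c \<in> C\<close>, of "\<tau> n" "\<tau> m"] \<tau>1 that \<tau>3 inj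
        by (metis atLeast_iff inj_on_def)
      then have "{n. n \<ge> N \<and> crit c (\<tau> n)} \<subseteq> {SOME n. n \<ge> N \<and> crit c (\<tau> n)}"
        by (metis (mono_tags, lifting) mem_Collect_eq singletonI someI_ex subsetI)
      then show ?thesis using finite_subset by blast
    qed
    then have "finite (\<Union>c\<in>C. {n. n \<ge> N \<and> crit c (\<tau> n)})" using fin_C by auto
    then obtain N0 where N0: "\<forall>n\<in>(\<Union>c\<in>C. {n. n \<ge> N \<and> crit c (\<tau> n)}). n < N0"
      using finite_nat_set_iff_bounded by auto
    define N1 where "N1 = max N N0"
    have N1: "n \<ge> N" if "n \<ge> N1" for n using that N1_def by auto
    have geq: "g (\<tau> n) = f (\<tau> n)" if "n \<ge> N1" for n
    proof (rule noncrit)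
      show "\<tau> n \<in> T" "\<tau> n \<notin> B" using \<tau>1 N1 that by auto
      show "\<not> crit c (\<tau> n)" if "c \<in> C" for c
        using N0 that \<open>n \<ge> N1\<close> N1_def by fastforce
    qed
    define \<sigma> where "\<sigma> n = par (\<tau> n)" for n
    have f\<sigma>: "f (\<sigma> n) = par (f (\<tau> n))" if "n \<ge> N1" for n
      using g_in[of "\<tau> n"] \<tau>1[of n] geq[OF that] that N1 \<sigma>_def by auto
    have \<sigma>T: "\<sigma> n \<in> T" if "n \<ge> N" for n using \<tau>1 that par_in \<sigma>_def by auto
    \<comment> \<open>By the choice of \<open>\<tau> n\<close>, its parent has a finite orbit or
      meets \<open>B\<close> at some time.\<close>
    have \<sigma>n: "\<not> (stays_good (\<sigma> n) \<and> infinite_orbit (\<sigma> n))" if "n \<ge> N" for n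
    proof
      assume "stays_good (\<sigma> n) \<and> infinite_orbit (\<sigma> n)"
      moreover have "\<sigma> n \<sqsubseteq> \<zeta> n" unfolding \<sigma>_def
        using anc_trans[OF \<zeta>T anc_par[of "\<tau> n"]] \<tau>1[OF that] by blast
      ultimately have "\<tau> n \<sqsubseteq> \<sigma> n" using \<tau>2 that by auto
      then show False using anc_par[of "\<tau> n"] anc_par_ne[of "\<tau> n"] \<tau>1[OF that] anc_antisym \<sigma>T \<sigma>_def that by metis
    qed
    show ?thesis
    proof (cases "\<exists>N2. \<forall>n\<ge>N2. f (\<tau> n) = \<tau> (Suc n)")
      case False
      define I where "I = {n. n \<ge> N1 \<and> f (\<tau> n) \<noteq> \<tau> (Suc n)}"
      have "infinite I" unfolding infinite_nat_iff_unbounded_le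
      proof
        fix m
        obtain n where "n \<ge> max m N1" "f (\<tau> n) \<noteq> \<tau> (Suc n)" using False by blast
        then show "\<exists>n\<ge>m. n \<in> I" unfolding I_def by auto
      qed
      have I: "\<tau> (Suc n) \<sqsubseteq> f (\<sigma> n) \<and> \<sigma> n \<in> B" if "n \<in> I" for n
      proof -
        have n: "n \<ge> N1" "n \<ge> N" "f (\<tau> n) \<noteq> \<tau> (Suc n)" using that N1 unfolding I_def by auto
        have "\<tau> (Suc n) \<sqsubseteq> f (\<tau> n)" using \<tau>4[of n 1] n by simp
        \<comment> \<open>A drop at time \<open>n\<close> puts \<open>\<tau> (Suc n)\<close> above
          \<open>f (\<sigma> n)\<close>, so this image satisfies both requirements; the parent
          itself must then be the element of \<open>B\<close>.\<close>
        then have 1: "\<tau> (Suc n) \<sqsubseteq> f (\<sigma> n)"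
          using anc_par_cases[of "f (\<tau> n)" "\<tau> (Suc n)"] n f\<sigma>[OF n(1)] f_in \<tau>1 by metis
        have fT: "f (\<sigma> n) \<in> T" using f_in \<sigma>T n by auto
        have 2: "stays_good (f (\<sigma> n))" "infinite_orbit (f (\<sigma> n))"
          using stays_good_down[OF _ fT 1] good_wandering_down[OF _ _ fT 1] \<tau>1[of "Suc n"] n by auto
        have "\<sigma> n \<in> B"
        proof (rule ccontr)
          assume "\<sigma> n \<notin> B"
          then have "stays_good (\<sigma> n)" using 2(1) \<sigma>T n unfolding stays_good_def
            by (metis funpow_0 funpow_swap1 not0_implies_Suc funpow.simps(2) o_apply)
          then show False using \<sigma>n n infinite_orbit_f_conv 2(2) by auto
        qed
        then show ?thesis using 1 by simp
      qed
      \<comment> \<open>\<open>B\<close> is finite, so two drops share a parent \<open>b\<close>.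
        From \<open>f b\<close> on the orbit of \<open>b\<close> avoids \<open>B\<close>, and at the
        second drop it is found below a child of \<open>b\<close>: this is a trap with
        \<open>b\<close> in \<open>B\<close>.\<close>
      have "\<not> inj_on \<sigma> I" using I fin_B \<open>infinite I\<close> by (metis finite_imageD finite_subset image_subsetI)
      then obtain n m where nm: "n \<in> I" "m \<in> I" "n < m" "\<sigma> n = \<sigma> m"
        unfolding inj_on_def by (metis linorder_neqE_nat)
      define b where "b = \<sigma> n"
      have nN: "n \<ge> N" "m \<ge> N" using nm N1 I_def by auto
      have fT: "f b \<in> T" using f_in \<sigma>T nN b_def by auto
      have Fb: "stays_good (f b)" using stays_good_down[OF _ fT, of "\<tau> (Suc n)"] I[OF nm(1)] \<tau>1[of "Suc n"] nN b_def by auto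
      obtain k where k: "m = Suc n + k" using nm(3) less_iff_Suc_add by auto
      have "(f ^^ k) (\<tau> (Suc n)) \<sqsubseteq> (f ^^ k) (f b)"
        using stays_good_fn_mono[of "\<tau> (Suc n)" "f b" k] \<tau>1[of "Suc n"] nN I[OF nm(1)] fT b_def by auto
      moreover have "\<tau> m \<sqsubseteq> (f ^^ k) (\<tau> (Suc n))" using \<tau>4[of "Suc n" k] nN k by auto
      ultimately have "\<tau> m \<sqsubseteq> (f ^^ k) (f b)" using anc_trans fn_in fT by blast
      then have "\<tau> m \<sqsubseteq> (f ^^ Suc k) b" by (simp add: funpow_swap1)
      moreover have "par (\<tau> m) = b" using nm b_def \<sigma>_def by auto
      ultimately have "trap z b (\<tau> m) (Suc k)" unfolding trap_def using \<tau>1[OF nN(2)] Fb \<zeta>_def by auto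
      then show ?thesis by blast
    next
      case True
      then obtain N2 where N2: "\<And>n. n \<ge> N2 \<Longrightarrow> f (\<tau> n) = \<tau> (Suc n)" by auto
      define M where "M = max N1 N2"
      have M: "n \<ge> N1" "n \<ge> N2" "n \<ge> N" if "n \<ge> M" for n using that N1 M_def by auto
      have \<sigma>S: "f (\<sigma> n) = \<sigma> (Suc n)" if "n \<ge> M" for n using f\<sigma> N2 M that \<sigma>_def by auto
      have \<sigma>k: "(f ^^ k) (\<sigma> n) = \<sigma> (n + k)" if "n \<ge> M" for n k
        by (induction k) (use that \<sigma>S in auto)
      \<comment> \<open>With an infinite orbit the parents would leave the finite set
        \<open>B\<close> for good, and late parents would satisfy both requirements. Hence they are
        eventually periodic.\<close>
      have "\<not> infinite_orbit (\<sigma> M)"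
      proof
        assume w: "infinite_orbit (\<sigma> M)"
        obtain K where K: "\<forall>n\<ge>K. (f ^^ n) (\<sigma> M) \<notin> B" using infinite_orbit_inf[OF w fin_B] by auto
        have "(f ^^ n) (\<sigma> (M + K)) \<notin> B" for n
          using K[rule_format, of "K + n"] \<sigma>k[of M "K + n"] \<sigma>k[of "M + K" n] by (simp add: add.assoc)
        moreover have MK: "M + K \<ge> N" using M(3)[of "M + K"] by simp
        ultimately have "stays_good (\<sigma> (M + K))" unfolding stays_good_def using \<sigma>T by blast
        moreover have "infinite_orbit (\<sigma> (M + K))" using infinite_orbit_fn[OF w, of K] \<sigma>k[of M K] by simp
        ultimately show False using \<sigma>n[OF MK] by blast
      qed
      then obtain n p where np: "p \<ge> 1" "\<sigma> (M + (n + p)) = \<sigma> (M + n)"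
        unfolding infinite_orbit_iff using \<sigma>k by auto
      \<comment> \<open>The shift by \<open>n\<close> starts the sequence where the parents already
        run through their cycle.\<close>
      define t where "t j = \<tau> (M + n + j)" for j
      have tN: "M + n + j \<ge> N" "M + n + j \<ge> N1" "M + n + j \<ge> N2" for j using M[of "M + n + j"] by auto
      have "inj t" using inj tN unfolding t_def inj_on_def by (metis atLeast_iff add_left_cancel)
      moreover have "stays_good (t j)" "g (t j) = t (Suc j)" for j
        using \<tau>1 tN geq N2 t_def by auto
      moreover have "par (t (j + p)) = par (t j)" for j
      proof -
        have "\<sigma> (M + n + (j + p)) = (f ^^ j) (\<sigma> (M + (n + p)))"
          using \<sigma>k[of "M + (n + p)" j] by (simp add: algebra_simps)
        also have "\<dots> = \<sigma> (M + n + j)" using np \<sigma>k[of "M + n" j] by simp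
        finally show ?thesis unfolding \<sigma>_def t_def by simp
      qed
      moreover have "f (par (t j)) = par (t (Suc j))" for j using \<sigma>S[of "M + n + j"] unfolding \<sigma>_def t_def by auto
      moreover have "t 0 \<sqsubseteq> (f ^^ (M + n)) z" using \<tau>1 tN[of 0] unfolding t_def \<zeta>_def by auto
      ultimately show ?thesis using np by (intro disjI2 exI[of _ t] exI[of _ p]) blast
    qed
  qed
qed

text \<open>The two kinds of disks behind alternatives (ii) and (iii): a disk with periodic boundary
  point that passes through infinitely many distinct disks of the system, and a disk mapped into a
  strictly smaller one inside itself.\<close>

definition drifting :: "'a set \<Rightarrow> 'a \<Rightarrow> bool" where
  "drifting Om t \<longleftrightarrow> (\<exists>p\<ge>1. (f ^^ p) (par t) = par t) \<and> inj (\<lambda>n. (g ^^ n) t) \<and> (\<forall>n. (g ^^ n) t \<in> Om)"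
definition contracting :: "'a \<Rightarrow> bool" where
  "contracting t \<longleftrightarrow> (\<exists>p\<ge>1. t \<sqsubseteq> (g ^^ p) t \<and> t \<noteq> (g ^^ p) t \<and> (\<forall>j\<le>p. (g ^^ j) t \<in> T - B))"

text \<open>Om consists of the disks into which orbits are to be absorbed, S of their boundary points.\<close>
definition disk_system :: "'a set \<Rightarrow> 'a set \<Rightarrow> 'a set \<Rightarrow> bool" where
  "disk_system A S Om \<longleftrightarrow> finite S \<and> S \<subseteq> T \<and> Om \<subseteq> T - B \<and>
     (\<forall>t\<in>Om. par t \<in> S \<and> (\<exists>t'\<in>Om. t' \<sqsubseteq> g t)) \<and>
     (\<forall>t\<in>Om. \<forall>a\<in>A \<union> S. \<not> t \<sqsubseteq> a) \<and>
     (\<forall>s\<in>S. f s \<in> S \<or> (\<exists>t\<in>Om. t \<sqsubseteq> f s)) \<and>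
     (\<forall>t\<in>Om. drifting Om t \<or> contracting t)"

definition enters :: "'a set \<Rightarrow> 'a \<Rightarrow> bool" where
  "enters Om x \<longleftrightarrow> (\<exists>t\<in>Om. t \<sqsubseteq> x)"

text \<open>The trapped disk is followed along its orbit. The points \<open>\<beta> i\<close> sink
  deeper every \<open>p\<close> steps, so a window of \<open>p\<close> consecutive disks
  \<open>\<omega> i\<close> far down avoids \<open>A\<close>, and its union is still mapped into
  itself.\<close>

lemma disk_system_of_trap:
  assumes z: "z \<in> T" and tr: "trap z b0 t0 p0" and A: "finite A" "A \<subseteq> T"
  shows "\<exists>S Om. disk_system A S Om \<and> (\<forall>s\<in>S. \<exists>t\<in>Om. \<exists>n. par t = s \<and> t \<sqsubseteq> (f ^^ n) z) \<and>
     (\<exists>n. enters Om ((f ^^ n) z))"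
proof -
  \<comment> \<open>The period is taken least among all traps for the orbit of \<open>z\<close>;
    this will separate the disks of the window from the boundary points of the others.\<close>
  define p where "p = (LEAST p. \<exists>b t. trap z b t p)"
  obtain b t where tb: "trap z b t p" using LeastI_ex[of "\<lambda>p. \<exists>b t. trap z b t p"] tr p_def by blast
  have pmin: "p \<le> p'" if "trap z b' t' p'" for b' t' p' unfolding p_def using Least_le that by (metis (mono_tags, lifting))
  have p1: "p \<ge> 1" and t: "t \<in> T" "t \<noteq> root" "par t = b" "stays_good t" "stays_good (f b)" "t \<sqsubseteq> (f ^^ p) b"
    using tb unfolding trap_def by auto
  obtain n0 where n0: "t \<sqsubseteq> (f ^^ n0) z" using tb unfolding trap_def by auto
  have bT: "b \<in> T" using t par_in by auto
  define \<beta> where "\<beta> i = (f ^^ i) b" for i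
  have \<beta>T: "\<beta> i \<in> T" for i unfolding \<beta>_def using fn_in bT by auto
  have \<beta>S: "f (\<beta> i) = \<beta> (Suc i)" for i unfolding \<beta>_def by auto
  have \<beta>k: "(f ^^ k) (\<beta> i) = \<beta> (i + k)" for i k unfolding \<beta>_def by (simp only: funpow_app[symmetric] add.commute[of k])
  have \<beta>1: "\<beta> 1 = f b" unfolding \<beta>_def by auto
  have \<beta>stays_good: "stays_good (\<beta> (Suc i))" for i using stays_good_fn[OF t(5), of i] unfolding \<beta>_def by (simp add: funpow_swap1)
  have lt0: "\<beta> i \<sqsubseteq> \<beta> (i + p) \<and> \<beta> i \<noteq> \<beta> (i + p)" for i
  proof (cases i)
    case 0
    have "b \<sqsubseteq> t" "b \<noteq> t" using anc_par anc_par_ne t by auto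
    then show ?thesis using 0 t anc_trans[OF \<beta>T, of b t p] anc_antisym[OF \<beta>T, of t p] unfolding \<beta>_def by auto
  next
    \<comment> \<open>\<open>b\<close> may lie in \<open>B\<close>, so monotonicity cannot be
      applied to \<open>b\<close> itself. The disk \<open>t\<close> gives the comparison for
      \<open>f b\<close>, and from there on it propagates.\<close>
    case (Suc j)
    have "g t \<sqsubseteq> f (\<beta> p)" "par (g t) = f b" "g t \<in> T" "g t \<noteq> root"
      using g_le[of t "\<beta> p"] g_in[of t] t \<beta>T stays_good_B unfolding \<beta>_def by auto
    then have "f b \<sqsubseteq> \<beta> (Suc p)" "f b \<noteq> \<beta> (Suc p)"
      using anc_par[of "g t"] anc_par_ne[of "g t"] anc_trans[OF \<beta>T[of "Suc p"]] anc_antisym[of "g t" "f b"] \<beta>S[of p] by auto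
    then have "(f ^^ j) (f b) \<sqsubseteq> (f ^^ j) (\<beta> (Suc p)) \<and> (f ^^ j) (f b) \<noteq> (f ^^ j) (\<beta> (Suc p))"
      using stays_good_fn_strict[OF t(5) \<beta>T[of "Suc p"]] by auto
    then show ?thesis using \<beta>k[of j 1] \<beta>k[of j "Suc p"] \<beta>1 Suc by (simp add: add.commute)
  qed
  have hstep: "ht (\<beta> i) < ht (\<beta> (i + p))" for i
    using lt0[of i] anc_ht[OF \<beta>T, of "\<beta> i" "i + p"] anc_eq[OF \<beta>T, of "\<beta> i" "i + p"] by fastforce
  have hk: "k \<le> ht (\<beta> (i + k * p))" for i k
  proof (induction k)
    case (Suc k)
    then show ?case using hstep[of "i + k * p"] by (simp add: algebra_simps)
  qed auto
  \<comment> \<open>The disk at \<open>\<beta> i\<close> in the direction of the return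
    \<open>\<beta> (i + p)\<close>. The map \<open>g\<close> shifts these disks, because
    \<open>g (\<omega> i)\<close> is the child of \<open>\<beta> (Suc i)\<close> towards the next
    return.\<close>
  define \<omega> where "\<omega> i = (SOME c. c \<in> T \<and> c \<noteq> root \<and> par c = \<beta> i \<and> c \<sqsubseteq> \<beta> (i + p))" for i
  have \<omega>: "\<omega> i \<in> T" "\<omega> i \<noteq> root" "par (\<omega> i) = \<beta> i" "\<omega> i \<sqsubseteq> \<beta> (i + p)" for i
    using someI_ex[OF child_toward[OF \<beta>T[of "i + p"], of "\<beta> i"]] lt0[of i] unfolding \<omega>_def by auto
  have \<omega>0: "\<omega> 0 = t"
    using child_unique[OF \<beta>T[of p], of "\<omega> 0" t] \<omega>[of 0] t unfolding \<beta>_def by auto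
  have \<omega>stays_good: "stays_good (\<omega> i)" for i
  proof (cases i)
    case (Suc j)
    then show ?thesis using stays_good_down[OF \<beta>stays_good[of j] \<omega>(1)[of i]] \<omega>[of i] anc_par[of "\<omega> i"] by auto
  qed (use \<omega>0 t in auto)
  have g\<omega>: "g (\<omega> i) = \<omega> (Suc i)" for i
  proof -
    have "g (\<omega> i) \<sqsubseteq> \<beta> (Suc (i + p))"
      using g_le[of "\<omega> i" "\<beta> (i + p)"] \<omega>[of i] \<beta>T \<omega>stays_good[of i] stays_good_B \<beta>S[of "i + p"] by auto
    moreover have "g (\<omega> i) \<noteq> root" "par (g (\<omega> i)) = \<beta> (Suc i)"
      using g_in[of "\<omega> i"] \<omega>[of i] \<omega>stays_good[of i] stays_good_B \<beta>S[of i] by auto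
    ultimately show ?thesis
      using child_unique[OF \<beta>T[of "Suc (i + p)"], of "g (\<omega> i)" "\<omega> (Suc i)"] \<omega>[of "Suc i"] by auto
  qed
  have g\<omega>k: "(g ^^ k) (\<omega> i) = \<omega> (i + k)" for i k by (induction k) (auto simp: g\<omega>)
  have \<omega>z: "\<omega> i \<sqsubseteq> (f ^^ (n0 + i)) z" for i
  proof (induction i)
    case (Suc i)
    then show ?case using g_le[of "\<omega> i" "(f ^^ (n0 + i)) z"] \<omega>[of i] \<omega>stays_good[of i] stays_good_B g\<omega>[of i] fn_in[OF z] by auto
  qed (use \<omega>0 n0 in auto)
  have \<omega>trap: "trap z (\<beta> i) (\<omega> i) p'" if "p' \<ge> 1" "\<omega> i \<sqsubseteq> \<beta> (i + p')" for i p'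
    unfolding trap_def using \<omega>[of i] \<omega>stays_good[of i] \<beta>stays_good[of i] \<beta>S[of i] \<beta>k[of p' i] \<omega>z that by auto
  have \<omega>lt: "\<omega> i \<sqsubseteq> \<omega> (i + p)" "\<omega> i \<noteq> \<omega> (i + p)" for i
  proof -
    have "\<beta> (i + p) \<sqsubseteq> \<omega> (i + p)" "\<beta> (i + p) \<noteq> \<omega> (i + p)" using \<omega>[of "i + p"] anc_par anc_par_ne by metis+
    then show "\<omega> i \<sqsubseteq> \<omega> (i + p)" "\<omega> i \<noteq> \<omega> (i + p)"
      using anc_trans[OF \<omega>(1)[of "i + p"] \<omega>(4)[of i]] anc_antisym[OF \<omega>(1)[of "i + p"], of "\<beta> (i + p)"] \<omega>(4)[of i] by auto
  qed
  define H where "H = Suc (Max (insert 0 (ht ` A)))"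
  have H: "ht a < H" if "a \<in> A" for a unfolding H_def using A that by (auto simp: less_Suc_eq_le)
  \<comment> \<open>Each return adds at least one to the height, so after \<open>H\<close> returns
    all disks lie deeper than every point of \<open>A\<close>.\<close>
  define i where "i = H * p"
  have hbig: "H \<le> ht (\<omega> j)" if "i \<le> j" "j < i + p" for j
    using hk[of H "j - i"] that i_def \<omega>[of j] ht_par[of "\<omega> j"] by auto
  define Om where "Om = \<omega> ` {i..<i + p}"
  define S where "S = \<beta> ` {i..<i + p}"
  have noAS: "\<not> \<omega> j \<sqsubseteq> a" if "i \<le> j" "j < i + p" "a \<in> A \<union> S" for j a
  proof
    assume le: "\<omega> j \<sqsubseteq> a"
    have "a \<notin> A" using hbig[OF that(1,2)] H anc_ht[OF _ le] A by fastforce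
    then have "a \<in> S" using that by auto
    then obtain k where k: "a = \<beta> k" "i \<le> k" "k < i + p" unfolding S_def by auto
    \<comment> \<open>If \<open>\<omega> j\<close> is above a later \<open>\<beta> k\<close>, this
      is a trap of period \<open>k - j < p\<close>. If it is above an earlier one, continuing to
      \<open>\<beta> (k + p)\<close> gives the period \<open>k + p - j < p\<close>.\<close>
    consider "k = j" | "k > j" | "k < j" by linarith
    then show False
    proof cases
      case 1
      then show False using le k anc_ht[OF \<beta>T le[unfolded k]] \<omega>[of j] ht_par[of "\<omega> j"] by auto
    next
      case 2
      then have "trap z (\<beta> j) (\<omega> j) (k - j)" using \<omega>trap le k by auto
      then have "p \<le> k - j" using pmin by auto
      then show False using k that 2 by auto
    next
      case 3
      have "\<omega> j \<sqsubseteq> \<beta> (k + p)" using anc_trans[OF \<beta>T le[unfolded k]] lt0[of k] by auto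
      then have "trap z (\<beta> j) (\<omega> j) (k + p - j)" using \<omega>trap[of "k + p - j" j] k that by auto
      then have "p \<le> k + p - j" using pmin by auto
      then show False using k that 3 by auto
    qed
  qed
  \<comment> \<open>Only the last index of the window is exceptional. There
    \<open>\<omega> i\<close> lies above \<open>\<omega> (i + p)\<close> and above
    \<open>\<beta> (i + p)\<close>, which closes the cycle.\<close>
  have next_le: "(\<omega> (Suc j) \<in> Om \<and> \<beta> (Suc j) \<in> S) \<or> Suc j = i + p" if "i \<le> j" "j < i + p" for j
    using that unfolding Om_def S_def by (cases "Suc j = i + p") auto
  have "disk_system A S Om" unfolding disk_system_def
  proof (intro conjI ballI)
    show "finite S" "S \<subseteq> T" unfolding S_def using \<beta>T by auto
    show "Om \<subseteq> T - B" unfolding Om_def using \<omega> \<omega>stays_good stays_good_B by auto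
    fix t assume "t \<in> Om"
    then obtain j where j: "t = \<omega> j" "i \<le> j" "j < i + p" unfolding Om_def by auto
    show "par t \<in> S" using j \<omega> S_def by auto
    have "\<omega> i \<in> Om" using p1 Om_def by auto
    then show "\<exists>t'\<in>Om. t' \<sqsubseteq> g t" using next_le[OF j(2,3)] g\<omega>[of j] j \<omega>lt[of i] by (metis anc_refl)
    show "\<not> t \<sqsubseteq> a" if "a \<in> A \<union> S" for a using noAS j that by auto
    show "drifting Om t \<or> contracting t" unfolding contracting_def
      using j g\<omega>k[of _ j] \<omega>lt[of j] p1 \<omega> \<omega>stays_good stays_good_B by (intro disjI2 exI[of _ p]) auto
  next
    fix s assume "s \<in> S"
    then obtain j where j: "s = \<beta> j" "i \<le> j" "j < i + p" unfolding S_def by auto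
    have "\<omega> i \<in> Om" using p1 Om_def by auto
    then show "f s \<in> S \<or> (\<exists>t\<in>Om. t \<sqsubseteq> f s)" using next_le[OF j(2,3)] \<beta>S[of j] j \<omega>(4)[of i] by metis
  qed
  moreover have "\<exists>t\<in>Om. \<exists>n. par t = s \<and> t \<sqsubseteq> (f ^^ n) z" if "s \<in> S" for s
    using that \<omega>(3) \<omega>z unfolding S_def Om_def by blast
  moreover have "enters Om ((f ^^ (n0 + i)) z)" unfolding enters_def Om_def using \<omega>z[of i] p1 by auto
  ultimately show ?thesis by blast
qed

text \<open>By injectivity only finitely many disks \<open>t n\<close> contain a point of
  \<open>A\<close> or of the finite cycle of parents; the system consists of the later ones.\<close>

lemma disk_system_of_wandering:
  assumes z: "z \<in> T" and A: "finite A" "A \<subseteq> T" and p: "p \<ge> 1" and inj: "inj t"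
    and t: "\<And>n. stays_good (t n)" "\<And>n. g (t n) = t (Suc n)" "\<And>n. par (t (n + p)) = par (t n)" "\<And>n. f (par (t n)) = par (t (Suc n))"
    and n0: "t 0 \<sqsubseteq> (f ^^ n0) z"
  shows "\<exists>S Om. disk_system A S Om \<and> (\<forall>s\<in>S. \<exists>t\<in>Om. \<exists>n. par t = s \<and> t \<sqsubseteq> (f ^^ n) z) \<and>
     (\<exists>n. enters Om ((f ^^ n) z))"
proof -
  have tT: "t n \<in> T" "t n \<notin> B" "t n \<noteq> root" for n using t stays_good_T stays_good_B notB_root by auto
  have tz: "t n \<sqsubseteq> (f ^^ (n0 + n)) z" for n
  proof (induction n)
    case (Suc n)
    then show ?case using g_le[of "t n" "(f ^^ (n0 + n)) z"] tT t(2)[of n] fn_in[OF z] by auto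
  qed (use n0 in auto)
  have gk: "(g ^^ k) (t n) = t (n + k)" for k n by (induction k) (auto simp: t)
  have fk: "(f ^^ k) (par (t n)) = par (t (n + k))" for k n by (induction k) (auto simp: t)
  have "finite (t -` (\<Union>a\<in>A. {x. x \<sqsubseteq> a}))" using A finite_anc inj by (intro finite_vimageI) auto
  then obtain M where M0: "\<forall>n\<in>t -` (\<Union>a\<in>A. {x. x \<sqsubseteq> a}). n < M"
    unfolding finite_nat_set_iff_bounded by blast
  have M: "\<not> t n \<sqsubseteq> a" if "n \<ge> M" "a \<in> A" for n a
  proof
    assume "t n \<sqsubseteq> a"
    then have "n \<in> t -` (\<Union>a\<in>A. {x. x \<sqsubseteq> a})" using that by blast
    then show False using M0 that by (meson leD)
  qed
  define S where "S = (\<lambda>n. par (t n)) ` UNIV"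
  have "par (t n) \<in> (\<lambda>n. par (t n)) ` {..<p}" for n
  proof (induction n rule: less_induct)
    case (less n)
    show ?case
    proof (cases "n < p")
      case False
      then show ?thesis using less.IH[of "n - p"] t(3)[of "n - p"] p by auto
    qed auto
  qed
  then have S2: "S = (\<lambda>n. par (t n)) ` {..<p}" unfolding S_def by blast
  then have finS: "finite S" by simp
  have ST: "S \<subseteq> T" unfolding S_def using tT par_in by auto
  have "finite (t -` (\<Union>a\<in>S. {x. x \<sqsubseteq> a}))" using finS ST finite_anc inj by (intro finite_vimageI) auto
  then obtain M' where M0': "\<forall>n\<in>t -` (\<Union>a\<in>S. {x. x \<sqsubseteq> a}). n < M'"
    unfolding finite_nat_set_iff_bounded by blast
  have M': "\<not> t n \<sqsubseteq> a" if "n \<ge> M'" "a \<in> S" for n a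
  proof
    assume "t n \<sqsubseteq> a"
    then have "n \<in> t -` (\<Union>a\<in>S. {x. x \<sqsubseteq> a})" using that by blast
    then show False using M0' that by (meson leD)
  qed
  define K where "K = max M M'"
  define Om where "Om = t ` {K..}"
  have "disk_system A S Om" unfolding disk_system_def
  proof (intro conjI ballI)
    show "finite S" "S \<subseteq> T" by fact+
    show "Om \<subseteq> T - B" unfolding Om_def using tT by auto
    fix x assume "x \<in> Om"
    then obtain j where j: "x = t j" "K \<le> j" unfolding Om_def by auto
    show "par x \<in> S" using j S_def by auto
    show "\<exists>t'\<in>Om. t' \<sqsubseteq> g x" using j t(2)[of j] unfolding Om_def by (intro bexI[of _ "t (Suc j)"]) auto
    show "\<not> x \<sqsubseteq> a" if "a \<in> A \<union> S" for a using M M' j K_def that by auto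
    have "inj (\<lambda>n. (g ^^ n) x)" using inj j gk unfolding inj_def by (metis add_left_cancel)
    moreover have "(g ^^ n) x \<in> Om" for n using gk j Om_def by auto
    moreover have "(f ^^ p) (par x) = par x" using fk t(3) j by auto
    ultimately show "drifting Om x \<or> contracting x" unfolding drifting_def using p by auto
  next
    fix s assume "s \<in> S"
    then show "f s \<in> S \<or> (\<exists>t\<in>Om. t \<sqsubseteq> f s)" using t(4) unfolding S_def by auto
  qed
  moreover have "\<exists>x\<in>Om. \<exists>n. par x = s \<and> x \<sqsubseteq> (f ^^ n) z" if "s \<in> S" for s
  proof -
    from that obtain n where n: "s = par (t n)" unfolding S_def by blast
    \<comment> \<open>Deleting an initial segment loses no boundary point, because each parent
      recurs with period \<open>p\<close>.\<close>
    have "par (t (n + k * p)) = par (t n)" for k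
    proof (induction k)
      case (Suc k)
      have "n + Suc k * p = n + k * p + p" by simp
      then show ?case using t(3)[of "n + k * p"] Suc by presburger
    qed auto
    then have "par (t (n + K * p)) = s" using n by simp
    moreover have "t (n + K * p) \<in> Om" unfolding Om_def using p
      by (intro imageI) (metis atLeast_iff le_trans le_add2 mult.right_neutral mult_le_mono2)
    ultimately show ?thesis using tz by blast
  qed
  moreover have "enters Om ((f ^^ (n0 + K)) z)" unfolding enters_def Om_def using tz[of K] by auto
  ultimately show ?thesis by blast
qed

text \<open>The clause that every point of \<open>S\<close> carries a disk visited by the orbit of
  \<open>z\<close> is what allows several systems to be united.\<close>

lemma disk_system_single:
  assumes "z \<in> T" "infinite_orbit z" "finite A" "A \<subseteq> T"
  shows "\<exists>S Om. disk_system A S Om \<and> (\<forall>s\<in>S. \<exists>t\<in>Om. \<exists>n. par t = s \<and> t \<sqsubseteq> (f ^^ n) z) \<and>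
     (\<exists>n. enters Om ((f ^^ n) z))"
  using wandering_dichotomy[OF assms(1,2)]
proof (elim disjE exE conjE)
  fix b t p assume "trap z b t p"
  then show ?thesis using disk_system_of_trap[OF assms(1) _ assms(3,4)] by blast
next
  fix t p n assume "1 \<le> p" "inj t" "t 0 \<sqsubseteq> (f ^^ n) z"
    "\<forall>n. stays_good (t n) \<and> g (t n) = t (Suc n) \<and> par (t (n + p)) = par (t n) \<and> f (par (t n)) = par (t (Suc n))"
  then show ?thesis using disk_system_of_wandering[OF assms(1,3,4), of p t n] by auto
qed

text \<open>A further system is built only for an orbit that is not yet absorbed, and the old
  boundary points are among the points it has to avoid.\<close>

lemma disk_system_finite:
  assumes A: "finite A" "A \<subseteq> T" and Z: "finite Z" "Z \<subseteq> T"
  shows "\<exists>S Om. disk_system A S Om \<and> (\<forall>z\<in>Z. infinite_orbit z \<longrightarrow> (\<exists>n. enters Om ((f ^^ n) z)))"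
  using Z
proof (induction Z rule: finite_induct)
  case empty
  have "disk_system A {} {}" unfolding disk_system_def by auto
  then show ?case by blast
next
  case (insert z Z)
  then obtain S Om where SO: "disk_system A S Om" "\<And>z. z \<in> Z \<Longrightarrow> infinite_orbit z \<Longrightarrow> \<exists>n. enters Om ((f ^^ n) z)" by auto
  show ?case
  proof (cases "infinite_orbit z \<and> (\<forall>n. \<not> enters Om ((f ^^ n) z))")
    case False
    then show ?thesis using SO by blast
  next
    case True
    have zT: "z \<in> T" using insert by auto
    have AS: "finite (A \<union> S)" "A \<union> S \<subseteq> T" using A SO(1) unfolding disk_system_def by auto
    obtain S' Om' where S': "disk_system (A \<union> S) S' Om'" "\<And>s. s \<in> S' \<Longrightarrow> \<exists>t\<in>Om'. \<exists>n. par t = s \<and> t \<sqsubseteq> (f ^^ n) z"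
       "\<exists>n. enters Om' ((f ^^ n) z)" using disk_system_single[OF zT _ AS] True by blast
    \<comment> \<open>Conversely, no old disk contains a new boundary point: that point lies above a
      point of the orbit of \<open>z\<close>, so the orbit would have entered the old disk.\<close>
    have no: "\<not> t \<sqsubseteq> a" if "t \<in> Om" "a \<in> S'" for t a
    proof
      assume ta: "t \<sqsubseteq> a"
      obtain t' n where t': "t' \<in> Om'" "par t' = a" "t' \<sqsubseteq> (f ^^ n) z" using S'(2) \<open>a \<in> S'\<close> by blast
      have "t' \<in> T" "t' \<noteq> root" using t' S'(1) notB_root unfolding disk_system_def by auto
      then have "t \<sqsubseteq> (f ^^ n) z" using ta t' anc_par anc_trans fn_in[OF zT] by metis
      then show False using True that unfolding enters_def by auto
    qed
    have k2: "drifting (Om \<union> Om') t" if "drifting Om t \<or> drifting Om' t" for t using that unfolding drifting_def by auto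
    have "disk_system A (S \<union> S') (Om \<union> Om')"
      unfolding disk_system_def
    proof (intro conjI ballI)
      show "finite (S \<union> S')" "S \<union> S' \<subseteq> T" "Om \<union> Om' \<subseteq> T - B" using SO(1) S'(1) unfolding disk_system_def by auto
      fix t assume t: "t \<in> Om \<union> Om'"
      show "par t \<in> S \<union> S'" "\<exists>t'\<in>Om \<union> Om'. t' \<sqsubseteq> g t" using SO(1) S'(1) t unfolding disk_system_def by blast+
      show "\<not> t \<sqsubseteq> a" if "a \<in> A \<union> (S \<union> S')" for a
        using SO(1) S'(1) t that no unfolding disk_system_def by blast
      show "drifting (Om \<union> Om') t \<or> contracting t" using SO(1) S'(1) t k2 unfolding disk_system_def by blast
    next
      fix s assume "s \<in> S \<union> S'"
      then show "f s \<in> S \<union> S' \<or> (\<exists>t\<in>Om \<union> Om'. t \<sqsubseteq> f s)" using SO(1) S'(1) unfolding disk_system_def by blast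
    qed
    moreover have "\<exists>n. enters (Om \<union> Om') ((f ^^ n) x)" if "x \<in> insert z Z" "infinite_orbit x" for x
      using that SO(2) S'(3) unfolding enters_def by blast
    ultimately show ?thesis by blast
  qed
qed

theorem stable_extension:
  assumes G: "finite G" "G \<subseteq> T"
  shows "\<exists>G' Om. finite G' \<and> G \<subseteq> G' \<and> G' \<subseteq> T \<and> Om \<subseteq> T - B \<and>
     (\<forall>t\<in>Om. par t \<in> G' \<and> (\<exists>t'\<in>Om. t' \<sqsubseteq> g t) \<and> (\<forall>a\<in>G'. \<not> t \<sqsubseteq> a) \<and> (drifting Om t \<or> contracting t)) \<and>
     (\<forall>a\<in>G'. f a \<in> G' \<or> enters Om (f a))"
proof -
  \<comment> \<open>Finite orbits are included whole, and before the disks are chosen, so that the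
    disks can avoid them.\<close>
  define P where "P = (\<Union>z\<in>{z\<in>G. \<not> infinite_orbit z}. range (\<lambda>n. (f ^^ n) z))"
  have finP: "finite P" unfolding P_def using finite_orbit G by auto
  have PT: "P \<subseteq> T" unfolding P_def using fn_in G by auto
  have Pf: "f a \<in> P" if "a \<in> P" for a using that unfolding P_def
  proof clarify
    fix z n assume "z \<in> G" "\<not> infinite_orbit z"
    moreover have "f ((f ^^ n) z) = (f ^^ Suc n) z" by simp
    ultimately show "f ((f ^^ n) z) \<in> (\<Union>z\<in>{z \<in> G. \<not> infinite_orbit z}. range (\<lambda>n. (f ^^ n) z))" by blast
  qed
  obtain S Om where SO: "disk_system (G \<union> P) S Om" "\<And>z. z \<in> G \<Longrightarrow> infinite_orbit z \<Longrightarrow> \<exists>n. enters Om ((f ^^ n) z)"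
    using disk_system_finite[of "G \<union> P" G] G finP PT by auto
  \<comment> \<open>Infinite orbits are cut just before their first entry; thus no disk contains a
    point of \<open>Q\<close>, and the last image enters one.\<close>
  define Q where "Q = (\<Union>z\<in>{z\<in>G. infinite_orbit z}. {(f ^^ n) z | n. \<forall>i\<le>n. \<not> enters Om ((f ^^ i) z)})"
  have "finite {(f ^^ n) z | n. \<forall>i\<le>n. \<not> enters Om ((f ^^ i) z)}" if "z \<in> G" "infinite_orbit z" for z
  proof -
    obtain m where m: "enters Om ((f ^^ m) z)" using SO(2) \<open>z \<in> G\<close> \<open>infinite_orbit z\<close> by blast
    then have "{(f ^^ n) z | n. \<forall>i\<le>n. \<not> enters Om ((f ^^ i) z)} \<subseteq> (\<lambda>n. (f ^^ n) z) ` {..<m}"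
    proof clarify
      fix n assume "\<forall>i\<le>n. \<not> enters Om ((f ^^ i) z)"
      then have "n < m" using m linorder_not_less by blast
      then show "(f ^^ n) z \<in> (\<lambda>n. (f ^^ n) z) ` {..<m}" by auto
    qed
    then show ?thesis using finite_subset by blast
  qed
  then have finQ: "finite Q" unfolding Q_def using G by auto
  have QT: "Q \<subseteq> T" unfolding Q_def using fn_in G by auto
  have noG: "\<not> enters Om a" if "a \<in> G \<union> P \<union> S \<union> Q" for a
  proof (cases "a \<in> Q")
    case False
    then show ?thesis using that SO(1) unfolding disk_system_def enters_def by blast
  qed (auto simp: Q_def)
  have "f a \<in> G \<union> P \<union> S \<union> Q \<or> enters Om (f a)" if "a \<in> G \<union> P \<union> S \<union> Q" for a
  proof -
    have infinite_orbit: "f a \<in> Q \<or> enters Om (f a)" if "a \<in> Q" for a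
    proof -
      from that obtain z n where zn: "z \<in> G" "infinite_orbit z" "a = (f ^^ n) z" "\<forall>i\<le>n. \<not> enters Om ((f ^^ i) z)"
        unfolding Q_def by blast
      then have "\<forall>i\<le>Suc n. \<not> enters Om ((f ^^ i) z)" if "\<not> enters Om (f a)" using that by (auto simp: le_Suc_eq)
      moreover have "f a = (f ^^ Suc n) z" using zn by simp
      ultimately show ?thesis unfolding Q_def using zn by blast
    qed
    have "a \<in> Q \<or> a \<in> P" if "a \<in> G"
    proof (cases "infinite_orbit a")
      case True
      have "\<forall>i\<le>0. \<not> enters Om ((f ^^ i) a)" using noG that by auto
      moreover have "a = (f ^^ 0) a" by simp
      ultimately have "a \<in> Q" unfolding Q_def using that True by blast
      then show ?thesis ..
    next
      case False
      have "a = (f ^^ 0) a" by simp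
      then have "a \<in> P" unfolding P_def using that False by blast
      then show ?thesis ..
    qed
    moreover have "f a \<in> S \<or> enters Om (f a)" if "a \<in> S"
      using SO(1) that unfolding disk_system_def enters_def by blast
    ultimately show ?thesis using that infinite_orbit Pf by blast
  qed
  moreover have "Om \<subseteq> T - B" "S \<subseteq> T" "finite S"
     "\<And>t. t \<in> Om \<Longrightarrow> par t \<in> S \<and> (\<exists>t'\<in>Om. t' \<sqsubseteq> g t) \<and> (drifting Om t \<or> contracting t)"
    using SO(1) unfolding disk_system_def by auto
  moreover have "finite (G \<union> P \<union> S \<union> Q)" "G \<union> P \<union> S \<union> Q \<subseteq> T"
    using G finP finQ PT QT calculation(3,4) by auto
  moreover have "\<not> t \<sqsubseteq> a" if "t \<in> Om" "a \<in> G \<union> P \<union> S \<union> Q" for t a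
    using noG that unfolding enters_def by blast
  ultimately show ?thesis
    by (intro exI[of _ "G \<union> P \<union> S \<union> Q"] exI[of _ Om]) auto
qed

end

section \<open>The tree of split points\<close>

locale berk = nonarch_field av for av :: "'k::field \<Rightarrow> real" +
  fixes L :: "'k set"
  assumes subfield: "is_subfield L" and discrete: "discretely_valued av L" and complete: "absv_complete av"
begin

lemma L_0 [simp]: "0 \<in> L" and L_1 [simp]: "1 \<in> L"
  and L_add: "x \<in> L \<Longrightarrow> y \<in> L \<Longrightarrow> x + y \<in> L"
  and L_mult: "x \<in> L \<Longrightarrow> y \<in> L \<Longrightarrow> x * y \<in> L"
  and L_minus: "x \<in> L \<Longrightarrow> - x \<in> L"
  and L_inverse: "x \<in> L \<Longrightarrow> inverse x \<in> L"
proof -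
  have *: "0 \<in> L" "1 \<in> L" "\<forall>x\<in>L. \<forall>y\<in>L. x + y \<in> L \<and> x * y \<in> L \<and> - x \<in> L" "\<forall>x\<in>L. x \<noteq> 0 \<longrightarrow> inverse x \<in> L"
    using subfield unfolding is_subfield_def by auto
  show "0 \<in> L" "1 \<in> L" by fact+
  show "x \<in> L \<Longrightarrow> y \<in> L \<Longrightarrow> x + y \<in> L" "x \<in> L \<Longrightarrow> y \<in> L \<Longrightarrow> x * y \<in> L" "x \<in> L \<Longrightarrow> - x \<in> L" using * by auto
  show "x \<in> L \<Longrightarrow> inverse x \<in> L" using * by (cases "x = 0") auto
qed

lemma L_diff: "x \<in> L \<Longrightarrow> y \<in> L \<Longrightarrow> x - y \<in> L"
  using L_add[of x "- y"] L_minus by simp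
lemma L_divide: "x \<in> L \<Longrightarrow> y \<in> L \<Longrightarrow> x / y \<in> L"
  by (simp add: divide_inverse L_mult L_inverse)
lemma L_power: "x \<in> L \<Longrightarrow> x ^ n \<in> L" by (induction n) (auto simp: L_mult)
lemma L_nat: "of_nat n \<in> L" by (induction n) (auto simp: L_add)
lemma L_sum: "(\<And>i. i \<in> I \<Longrightarrow> x i \<in> L) \<Longrightarrow> sum x I \<in> L"
  by (induction I rule: infinite_finite_induct) (auto simp: L_add)

definition polyL :: "'k poly \<Rightarrow> bool" where "polyL p \<longleftrightarrow> (\<forall>i. coeff p i \<in> L)"

lemma polyL_poly: "polyL p \<Longrightarrow> x \<in> L \<Longrightarrow> poly p x \<in> L"
  unfolding polyL_def poly_altdef by (intro L_sum L_mult L_power) auto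
lemma polyL_mult: "polyL p \<Longrightarrow> polyL r \<Longrightarrow> polyL (p * r)"
  unfolding polyL_def coeff_mult by (auto intro: L_sum L_mult)
lemma polyL_1: "polyL 1" unfolding polyL_def by (auto simp: coeff_1)
lemma polyL_power: "polyL p \<Longrightarrow> polyL (p ^ n)"
  by (induction n) (auto simp: polyL_mult polyL_1)
lemma polyL_hcomp: "polyL g \<Longrightarrow> polyL p \<Longrightarrow> polyL r \<Longrightarrow> polyL (hcomp n g p r)"
  unfolding hcomp_def using polyL_mult polyL_power
  by (auto simp: polyL_def coeff_sum intro!: L_sum L_mult)
lemma polyL_coeffs: "set (coeffs p) \<subseteq> L \<Longrightarrow> polyL p"
  unfolding polyL_def by (metis L_0 coeff_in_coeffs coeff_0 le_degree subsetD)

definition ratL :: "'k poly \<times> 'k poly \<Rightarrow> bool" where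
  "ratL f \<longleftrightarrow> nondeg f \<and> polyL (fst f) \<and> polyL (snd f)"

lemma ratL_comp: "ratL f \<Longrightarrow> ratL g \<Longrightarrow> ratL (rat_comp f g)"
  unfolding ratL_def using rat_comp_correct(1)[of f g] by (simp add: rat_comp_def polyL_hcomp)

lemma ratL_iota: "ratL iota"
  unfolding ratL_def using nondeg_iota by (auto simp: iota_def polyL_1 polyL_def coeff_pCons split: nat.splits)

definition unif :: 'k where
  "unif = (SOME p. p \<in> L \<and> 0 < av p \<and> av p < 1 \<and> av ` (L - {0}) = {av p powi n | n. True})"
definition q :: real where "q = av unif"

lemma unif: "unif \<in> L" "0 < q" "q < 1" "av ` (L - {0}) = {q powi n | n. True}"
proof -
  have "\<exists>p. p \<in> L \<and> 0 < av p \<and> av p < 1 \<and> av ` (L - {0}) = {av p powi n | n. True}"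
    using discrete unfolding discretely_valued_def by auto
  from someI_ex[OF this] show "unif \<in> L" "0 < q" "q < 1" "av ` (L - {0}) = {q powi n | n. True}"
    unfolding unif_def[symmetric] q_def by auto
qed

lemma q_pow [simp]: "0 < q ^ n" "q ^ n \<le> 1" using unif by (auto simp: power_le_one)
lemma q_pow_less: "q ^ n < q ^ m \<longleftrightarrow> m < n" using unif by (simp add: power_strict_decreasing_iff)
lemma q_pow_le: "q ^ n \<le> q ^ m \<longleftrightarrow> m \<le> n" using unif by (simp add: power_decreasing_iff)
lemma q_pow_inj: "q ^ n = q ^ m \<longleftrightarrow> n = m" using q_pow_less by (metis linorder_neqE_nat less_irrefl)
lemma q_pow_lt1: "n > 0 \<Longrightarrow> q ^ n < 1" using q_pow_less[of n 0] by simp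
lemma av_unif_pow: "av (unif ^ n) = q ^ n" by (simp add: av_power q_def)
lemma unif_pow: "unif ^ n \<in> L" "unif ^ n \<noteq> 0" using unif L_power by (auto simp: q_def)

lemma L_value_le1: assumes "x \<in> L" "x \<noteq> 0" "av x \<le> 1" shows "\<exists>n. av x = q ^ n"
proof -
  obtain n where n: "av x = q powi n" using unif(4) assms(1,2) by auto
  show ?thesis
  proof (cases "n \<ge> 0")
    case True
    then show ?thesis using n by (intro exI[of _ "nat n"]) (simp add: power_int_def)
  next
    case False
    then have "inverse q ^ nat (- n) \<le> 1" "nat (- n) > 0" using n assms(3) by (auto simp: power_int_def)
    moreover have "inverse q > 1" using unif(2,3) by (simp add: one_less_inverse)
    ultimately have "1 < inverse q ^ nat (- n)" using one_less_power by blast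
    then show ?thesis using \<open>inverse q ^ nat (- n) \<le> 1\<close> by linarith
  qed
qed

text \<open>Discreteness: for split centres the open condition of radius \<open>q ^ m\<close> is the
  closed one of radius \<open>q ^ Suc m\<close>. This matches open disks with vertices one level
  deeper.\<close>

lemma L_value_gap: assumes "x \<in> L" "av x < q ^ m" shows "av x \<le> q ^ Suc m"
proof (cases "x = 0")
  case True
  then show ?thesis using unif(2) by simp
next
  case False
  have "av x \<le> 1" using assms(2) q_pow(2)[of m] by linarith
  then obtain n where n: "av x = q ^ n" using L_value_le1 assms(1) False by blast
  then have "m < n" using assms(2) q_pow_less by metis
  then have "q ^ n \<le> q ^ Suc m" unfolding q_pow_le by simp
  then show ?thesis using n by simp
qed

definition T :: "'k berk set" where "T = {z. L_split av L z}"

lemma T_iff: "z \<in> T \<longleftrightarrow> (\<exists>a\<in>L. \<exists>\<rho>\<in>L - {0}. z = Fin (gs a (av \<rho>)))"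
proof -
  have "zeta av a (av \<rho>) = Fin (gs a (av \<rho>))" if "\<rho> \<in> L - {0}" for a \<rho>
    using that by (intro zeta_gs) auto
  then show ?thesis unfolding T_def L_split_def by auto
qed

lemma T_BP: "z \<in> T \<Longrightarrow> z \<in> BP av" using gs_sn by (auto simp: T_iff)

text \<open>The centre \<open>a\<close> may be a pole or too close to one, hence the auxiliary
  \<open>u\<close>, at which the denominator attains its norm. The image has centre
  \<open>f u\<close>, and its radius is the norm of \<open>f - f u\<close> on the disk.\<close>

lemma berk_map_gs:
  assumes f: "nondeg f" and r: "r > 0" "av (u - a) \<le> r" "av (poly (snd f) u) = gs a r (snd f)"
    and c: "c = poly (fst f) u / poly (snd f) u" and R: "R = gs a r (fst f - smult c (snd f)) / gs a r (snd f)"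
  shows "berk_map av f (Fin (gs a r)) = Fin (gs c R)" "R > 0"
proof -
  define P Q where "P = fst f" and "Q = snd f"
  have s: "sn (gs a r)" using gs_sn r by auto
  have Q: "gs a r Q > 0" using gs_pos[OF r(1) nondeg_snd[OF f]] Q_def by auto
  obtain t where t: "berk_map av f (Fin (gs a r)) = Fin t" "sn t" "\<And>b. t (Lin b) = gs a r (P - smult b Q) / gs a r Q"
    using berk_map_Lin[OF f s] Q unfolding P_def Q_def by auto
  show "R > 0" using Q gs_pos[OF r(1) nondeg_diff[OF f, of c]] by (simp add: R Q_def)
  define P1 where "P1 = P - smult c Q"
  have u: "poly Q u \<noteq> 0" "poly P1 u = 0" using r Q c by (auto simp: P1_def P_def Q_def)
  have Reg: "R * gs a r Q = gs a r P1" using Q by (simp add: R P1_def P_def Q_def)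
  have "t (Lin b) = max R (av (c - b))" for b
  proof -
    have eq: "P - smult b Q = P1 + smult (c - b) Q" by (simp add: P1_def smult_diff_left)
    have sm: "gs a r (smult (c - b) Q) = av (c - b) * gs a r Q" by (rule sn_smult[OF s])
    have "gs a r (P - smult b Q) = max (gs a r P1) (av (c - b) * gs a r Q)"
    proof (cases "gs a r P1" "av (c - b) * gs a r Q" rule: linorder_cases)
      case less
      then show ?thesis using sn_ultra_eq[OF s, of P1 "smult (c - b) Q"] sm eq by simp
    next
      case greater
      then show ?thesis using sn_ultra_eq[OF s, of "smult (c - b) Q" P1] sm eq by (simp add: add.commute)
    next
      \<comment> \<open>For terms of equal size cancellation is excluded by evaluating at
        \<open>u\<close>, where \<open>P1\<close> vanishes and the other term attains its
        norm.\<close>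
      case equal
      have "av (c - b) * gs a r Q = av (poly (P1 + smult (c - b) Q) u)" using u r by (simp add: av_mult Q_def)
      also have "\<dots> \<le> gs a r (P1 + smult (c - b) Q)" by (rule poly_le_gs[OF r(2)])
      finally show ?thesis using equal eq sm sn_ultra[OF s, of P1 "smult (c - b) Q"] by simp
    qed
    also have "\<dots> = max R (av (c - b)) * gs a r Q" using Reg Q by (simp add: max_mult_distrib_right)
    finally show ?thesis using t(3)[of b] Q by simp
  qed
  then show "berk_map av f (Fin (gs a r)) = Fin (gs c R)"
    using gs_eqI[OF t(2)] t(1) \<open>R > 0\<close> by auto
qed

text \<open>Both \<open>u\<close> and a point \<open>u'\<close> at which the numerator of
  \<open>f - c\<close> attains its norm can be found in \<open>L\<close> by
  \<open>gs_integer_points\<close>; so the image has a centre in \<open>L\<close> and a radius in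
  the value group of \<open>L\<close>.\<close>

lemma T_image: assumes f: "ratL f" and z: "z \<in> T" shows "berk_map av f z \<in> T"
proof -
  obtain a \<rho> where z: "a \<in> L" "\<rho> \<in> L" "\<rho> \<noteq> 0" "z = Fin (gs a (av \<rho>))" using z by (auto simp: T_iff)
  have ex: "\<exists>u\<in>L. av (u - a) \<le> av \<rho> \<and> av (poly p u) = gs a (av \<rho>) p" if "p \<noteq> 0" for p
  proof -
    from gs_integer_points[OF that \<open>\<rho> \<noteq> 0\<close>, of a]
    obtain i :: nat where "av (poly p (a + \<rho> * of_nat i)) = gs a (av \<rho>) p" by (auto simp: eventually_sequentially)
    moreover have "av (a + \<rho> * of_nat i - a) \<le> av \<rho>" using av_nat_le[of i] by (simp add: av_mult mult_left_le)
    ultimately show ?thesis using z by (intro bexI[of _ "a + \<rho> * of_nat i"]) (auto intro: L_add L_mult L_nat)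
  qed
  have nd: "nondeg f" and PL: "polyL (fst f)" "polyL (snd f)" using f by (auto simp: ratL_def)
  obtain u where u: "u \<in> L" "av (u - a) \<le> av \<rho>" "av (poly (snd f) u) = gs a (av \<rho>) (snd f)"
    using ex[OF nondeg_snd[OF nd]] by auto
  define c where "c = poly (fst f) u / poly (snd f) u"
  have cL: "c \<in> L" unfolding c_def using u PL by (intro L_divide polyL_poly)
  obtain u' where u': "u' \<in> L" "av (poly (fst f - smult c (snd f)) u') = gs a (av \<rho>) (fst f - smult c (snd f))"
    using ex[OF nondeg_diff[OF nd, of c]] by auto
  define \<sigma> where "\<sigma> = poly (fst f - smult c (snd f)) u' / poly (snd f) u"
  have "\<sigma> \<in> L" unfolding \<sigma>_def using u u' PL cL
    by (simp add: L_divide L_diff L_mult polyL_poly)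
  have R: "av \<sigma> = gs a (av \<rho>) (fst f - smult c (snd f)) / gs a (av \<rho>) (snd f)"
    unfolding \<sigma>_def av_divide using u(3) u'(2) by simp
  have r: "av \<rho> > 0" using z by simp
  note * = berk_map_gs[OF nd r u(2,3) c_def R]
  have "\<sigma> \<noteq> 0" using *(2) by auto
  then show ?thesis unfolding T_iff using *(1) z cL \<open>\<sigma> \<in> L\<close> by auto
qed

section \<open>Two charts and the vertices of the tree\<close>

definition J :: "bool \<Rightarrow> 'k berk \<Rightarrow> 'k berk" where "J e z = (if e then berk_map av iota z else z)"

lemma J_BP: "z \<in> BP av \<Longrightarrow> J e z \<in> BP av" and J_J: "z \<in> BP av \<Longrightarrow> J e (J e z) = z"
  unfolding J_def using berk_map_BP[OF nondeg_iota(1)] iota_iota by auto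
lemma J_T: "z \<in> T \<Longrightarrow> J e z \<in> T" unfolding J_def using T_image[OF ratL_iota] by auto
lemma J_inj: "z \<in> BP av \<Longrightarrow> w \<in> BP av \<Longrightarrow> J e z = J e w \<Longrightarrow> z = w" using J_J by metis

text \<open>Two charts, z and 1/z, cover the projective line: \<open>e = True\<close> selects the chart 1/z. To make the
  chart of a point unique, the residue class |z| = 1 is assigned to the first one.\<close>
definition chart :: "bool \<Rightarrow> 'k berk \<Rightarrow> bool" where
  "chart e z \<longleftrightarrow> (case z of Fin s \<Rightarrow> (if e then s (Lin 0) > 1 else s (Lin 0) \<le> 1) | Inf \<Rightarrow> e)"
definition valid :: "bool \<Rightarrow> 'k \<Rightarrow> bool" where
  "valid e a \<longleftrightarrow> a \<in> L \<and> (if e then av a < 1 else av a \<le> 1)"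

lemma valid_L: "valid e a \<Longrightarrow> a \<in> L" and valid_le: "valid e a \<Longrightarrow> av a \<le> 1"
  by (auto simp: valid_def split: if_splits)

lemma chart_unique: "chart e z \<Longrightarrow> chart e' z \<Longrightarrow> e = e'"
  unfolding chart_def by (auto split: berk_pt.splits if_splits)

lemma chart_iota: assumes "sn s" "s (Lin 0) < 1" shows "chart True (J True (Fin s))"
proof (cases "s (Lin 0) = 0")
  case True
  then show ?thesis by (simp add: J_def berk_map_def iota_def Lin_0 chart_def)
next
  case False
  then obtain s' where s': "berk_map av iota (Fin s) = Fin s'" "s' (Lin 0) = s 1 / s (Lin 0)"
    using iota_Fin[OF assms(1)] by auto
  have "s (Lin 0) > 0" using False sn_nonneg[OF assms(1), of "Lin 0"] by linarith
  then show ?thesis using s' assms by (simp add: J_def chart_def sn_1)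
qed

lemma chart_disk: assumes "valid e b" "r \<le> 1" "z \<in> J e ` disk b r" shows "chart e z"
proof -
  obtain s where s: "sn s" "s (Lin b) < r" "z = J e (Fin s)" using assms(3) unfolding disk_def by blast
  have "s (Lin 0) \<le> max (s (Lin b)) (av b)" using sn_Lin[OF s(1), of 0 b] by simp
  then have "if e then s (Lin 0) < 1 else s (Lin 0) \<le> 1" using s(2) assms(1,2) by (auto simp: valid_def)
  then show ?thesis using s(3) chart_iota[OF s(1)] by (cases e) (simp_all, simp add: J_def chart_def)
qed

definition Zt :: "bool \<Rightarrow> 'k \<Rightarrow> nat \<Rightarrow> 'k berk" where "Zt e a n = J e (Fin (gs a (q ^ n)))"
definition v0 :: "'k berk" where "v0 = Fin (gs 0 1)"

lemma gsq_sn [simp]: "sn (gs a (q ^ n))" using gs_sn q_pow(1)[of n] by (simp add: less_imp_le)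

lemma Zt_T: assumes "valid e a" shows "Zt e a n \<in> T"
proof -
  have "Fin (gs a (q ^ n)) \<in> T" unfolding T_iff av_unif_pow[symmetric]
    by (rule bexI[of _ a], rule bexI[of _ "unif ^ n"]) (use valid_L[OF assms] unif_pow in auto)
  then show ?thesis unfolding Zt_def by (rule J_T)
qed

lemma v0_T: "v0 \<in> T" using Zt_T[of False 0 0] by (simp add: v0_def Zt_def J_def valid_def)

lemma Zt_rep: assumes "z \<in> T" shows "\<exists>e a n. valid e a \<and> z = Zt e a n \<and> chart e z"
proof -
  have *: "\<exists>a n. a \<in> L \<and> av a \<le> w (Lin 0) \<and> y = Fin (gs a (q ^ n))" if "y \<in> T" "y = Fin w" "w (Lin 0) \<le> 1" for y w
  proof -
    obtain a \<rho> where a: "a \<in> L" "\<rho> \<in> L" "\<rho> \<noteq> 0" "y = Fin (gs a (av \<rho>))" using \<open>y \<in> T\<close> by (auto simp: T_iff)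
    have w: "w (Lin 0) = max (av \<rho>) (av a)" using a that by (simp add: gs_Lin)
    then have "av \<rho> \<le> 1" using that(3) by simp
    then obtain n where "av \<rho> = q ^ n" using L_value_le1[OF a(2,3)] by auto
    then show ?thesis using a w by (intro exI[of _ a] exI[of _ n]) auto
  qed
  obtain a \<rho> where a: "a \<in> L" "\<rho> \<in> L" "\<rho> \<noteq> 0" "z = Fin (gs a (av \<rho>))" using assms by (auto simp: T_iff)
  define s where "s = gs a (av \<rho>)"
  have s: "sn s" using gs_sn s_def by auto
  show ?thesis
  proof (cases "s (Lin 0) \<le> 1")
    case True
    then obtain b n where "b \<in> L" "av b \<le> s (Lin 0)" "z = Fin (gs b (q ^ n))" using *[OF assms] a s_def by blast
    then have "valid False b \<and> z = Zt False b n \<and> chart False z" using True a s_def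
      by (auto simp: valid_def Zt_def J_def chart_def)
    then show ?thesis by blast
  next
    case False
    then obtain s' where s': "J True z = Fin s'" "sn s'" "s' (Lin 0) = s 1 / s (Lin 0)"
      using iota_Fin[OF s] a s_def by (auto simp: J_def)
    have lt: "s' (Lin 0) < 1" using s' False sn_1[OF s] by simp
    obtain b n where b: "b \<in> L" "av b \<le> s' (Lin 0)" "J True z = Fin (gs b (q ^ n))"
      using *[OF J_T[OF assms] s'(1)] lt by auto
    have "z = Zt True b n" unfolding Zt_def b(3)[symmetric] using J_J T_BP[OF assms] by simp
    moreover have "valid True b" using b lt by (auto simp: valid_def)
    moreover have "chart True z" using False a s_def by (auto simp: chart_def)
    ultimately show ?thesis by blast
  qed
qed

lemma Zt_eq: "av (a - b) \<le> q ^ n \<Longrightarrow> Zt e a n = Zt e b n"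
  unfolding Zt_def using gs_recenter[of "q ^ n" a b] q_pow(1)[of n] by (simp add: less_imp_le)

lemma iota_v0: "berk_map av iota v0 = v0"
proof -
  have eq: "1 - Lin 0 = - Lin (1 :: 'k)" by (simp add: Lin_def one_pCons)
  have "berk_map av iota (Fin (gs 0 1)) = Fin (gs 1 1)"
    by (rule berk_map_gs[OF nondeg_iota(1), of 1 1]) (auto simp: iota_def Lin_0[symmetric] gs_Lin eq sn_minus[OF gs_sn])
  also have "gs 1 1 = gs 0 1" by (rule gs_recenter) auto
  finally show ?thesis by (simp add: v0_def)
qed

lemma Zt_0: "valid e a \<Longrightarrow> Zt e a 0 = v0"
  using Zt_eq[of a 0 0 e] valid_le[of e a] iota_v0 by (simp add: Zt_def J_def v0_def)

lemma Zt_chart: assumes "valid e a" "n > 0" shows "chart e (Zt e a n)"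
  using assms q_pow_lt1[OF assms(2)] chart_iota[OF gsq_sn[of a n]]
  by (cases e) (auto simp: Zt_def J_def chart_def gs_Lin valid_def less_imp_le)

text \<open>Height, chart and the centre up to precision \<open>q ^ n\<close> can be read off from a
  vertex, the root alone belonging to both families. This makes \<open>ht\<close>,
  \<open>par\<close> and \<open>Dd\<close> well defined.\<close>

lemma Zt_inj: assumes "valid e a" "valid e' b" "Zt e a n = Zt e' b m"
  shows "n = m \<and> (n > 0 \<longrightarrow> e = e' \<and> av (a - b) \<le> q ^ n)"
proof -
  have same: "n = m \<and> av (a - b) \<le> q ^ n" if "Zt e a n = Zt e b m" for e a b n m
  proof -
    have "gs a (q ^ n) = gs b (q ^ m)"
      using J_inj[of "Fin (gs a (q ^ n))" "Fin (gs b (q ^ m))" e] that unfolding Zt_def by simp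
    moreover have "q ^ n \<ge> 0" "q ^ m \<ge> 0" using q_pow(1) by (simp_all add: less_imp_le)
    ultimately have "q ^ n = q ^ m \<and> av (a - b) \<le> q ^ n" by (metis gs_inj)
    then show ?thesis unfolding q_pow_inj .
  qed
  have v: "valid e 0" for e by (auto simp: valid_def)
  have n0: "n = 0" if "Zt e a n = v0" "valid e a" for e a n
    using same[of e a n 0 0] Zt_0[OF v[of e]] that by simp
  show ?thesis
  proof (cases "n = 0 \<or> m = 0")
    case True
    then have "Zt e a n = v0 \<and> Zt e' b m = v0" using assms Zt_0 by metis
    then have "n = 0" "m = 0" using n0 assms by blast+
    then show ?thesis by simp
  next
    case False
    then have "chart e (Zt e a n)" "chart e' (Zt e a n)"
      using Zt_chart[OF assms(1), of n] Zt_chart[OF assms(2), of m] assms(3) by simp_all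
    then have "e = e'" by (rule chart_unique)
    then show ?thesis using same assms by auto
  qed
qed

definition ht :: "'k berk \<Rightarrow> nat" where "ht z = (THE n. \<exists>e a. valid e a \<and> z = Zt e a n)"
definition par :: "'k berk \<Rightarrow> 'k berk" where
  "par z = (SOME w. \<exists>e a n. valid e a \<and> z = Zt e a (Suc n) \<and> w = Zt e a n)"
text \<open>The disk D(t) of the overview: open, with the radius \<open>q ^ n\<close> of the parent.
  All representations of a vertex give the same disk by \<open>Dd_Zt\<close>; at the root the union
  is empty.\<close>

definition Dd :: "'k berk \<Rightarrow> 'k berk set" where
  "Dd z = \<Union>{J e ` disk a (q ^ n) | e a n. valid e a \<and> z = Zt e a (Suc n)}"

lemma ht_Zt: "valid e a \<Longrightarrow> ht (Zt e a n) = n"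
  unfolding ht_def using Zt_inj by (intro the_equality) blast+

lemma par_Zt: assumes "valid e a" shows "par (Zt e a (Suc n)) = Zt e a n"
proof -
  have "\<exists>w. \<exists>e' a' n'. valid e' a' \<and> Zt e a (Suc n) = Zt e' a' (Suc n') \<and> w = Zt e' a' n'" using assms by blast
  from someI_ex[OF this] obtain e' a' n' where *: "valid e' a'" "Zt e a (Suc n) = Zt e' a' (Suc n')"
    "par (Zt e a (Suc n)) = Zt e' a' n'" unfolding par_def by blast
  then have i: "n = n'" "e = e'" "av (a - a') \<le> q ^ Suc n" using Zt_inj[OF assms *(1,2)] by auto
  have "q ^ Suc n \<le> q ^ n" by (simp only: q_pow_le)
  then have "Zt e a n = Zt e a' n" using i(3) by (intro Zt_eq) linarith
  then show ?thesis using * i by simp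
qed

lemma disk_recenter: assumes "av (a - b) < r" shows "disk a r = disk b r"
proof -
  have "disk a r \<subseteq> disk b r" if "av (a - b) < r" for a b
  proof
    fix z assume "z \<in> disk a r"
    then obtain s where s: "z = Fin s" "sn s" "s (Lin a) < r" by (auto simp: disk_def)
    then show "z \<in> disk b r" using sn_Lin[OF s(2), of b a] that by (auto simp: disk_def)
  qed
  then show ?thesis using assms av_commute[of a b] by (metis subset_antisym)
qed

lemma Dd_Zt: assumes "valid e a" shows "Dd (Zt e a (Suc n)) = J e ` disk a (q ^ n)"
proof -
  have "J e' ` disk b (q ^ m) = J e ` disk a (q ^ n)" if "valid e' b" "Zt e a (Suc n) = Zt e' b (Suc m)" for e' b m
  proof -
    have i: "n = m" "e = e'" "av (a - b) \<le> q ^ Suc n" using Zt_inj[OF assms that] by auto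
    have "q ^ Suc n < q ^ n" by (simp only: q_pow_less)
    then have "disk a (q ^ n) = disk b (q ^ n)" using i(3) by (intro disk_recenter) linarith
    then show ?thesis using i by simp
  qed
  then show ?thesis unfolding Dd_def using assms by blast
qed

lemma T_ne_v0: assumes "z \<in> T" "z \<noteq> v0" obtains e a n where "valid e a" "z = Zt e a (Suc n)" "chart e z"
proof -
  obtain e a n where *: "valid e a" "z = Zt e a n" "chart e z" using Zt_rep[OF assms(1)] by blast
  then have "n \<noteq> 0" using Zt_0[of e a] assms(2) by metis
  then show ?thesis using * that by (cases n) auto
qed

sublocale rooted_tree T v0 par ht
proof
  show "v0 \<in> T" by (rule v0_T)
  show "ht v0 = 0" using ht_Zt[of False 0 0] Zt_0[of False 0] by (simp add: valid_def)
  show "par x \<in> T" if "x \<in> T" "x \<noteq> v0" for x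
    using T_ne_v0[OF that] by (metis par_Zt Zt_T)
  show "ht x = Suc (ht (par x))" if "x \<in> T" "x \<noteq> v0" for x
    using T_ne_v0[OF that] by (metis par_Zt ht_Zt)
qed

lemma Zt_ne_v0: "valid e a \<Longrightarrow> Zt e a (Suc n) \<noteq> v0"
  using ht_Zt[of e a "Suc n"] ht_root by auto

lemma par_iter_Zt: "valid e a \<Longrightarrow> j \<le> n \<Longrightarrow> (par ^^ j) (Zt e a n) = Zt e a (n - j)"
proof (induction j)
  case (Suc j)
  then have "n - j = Suc (n - Suc j)" by auto
  then show ?case using Suc par_Zt by simp
qed auto

lemma anc_Zt: assumes "valid e a" shows "anc x (Zt e a n) \<longleftrightarrow> (\<exists>m\<le>n. x = Zt e a m)"
proof
  assume "anc x (Zt e a n)"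
  then show "\<exists>m\<le>n. x = Zt e a m" unfolding anc_def using par_iter_Zt[OF assms] ht_Zt[OF assms]
    by (metis diff_le_self)
next
  assume "\<exists>m\<le>n. x = Zt e a m"
  then obtain m where "m \<le> n" "x = Zt e a m" by auto
  then show "anc x (Zt e a n)" unfolding anc_def using par_iter_Zt[OF assms, of "n - m" n] ht_Zt[OF assms]
    by (intro exI[of _ "n - m"]) auto
qed

text \<open>The dictionary between disks and tree order. Both centres lie in \<open>L\<close>, so a
  distance below \<open>q ^ m\<close> is at most \<open>q ^ Suc m\<close>, and the two centres
  define the same vertex at that level.\<close>

lemma Dd_iff: assumes t: "t \<in> T" "t \<noteq> v0" and x: "x \<in> T" shows "x \<in> Dd t \<longleftrightarrow> anc t x"
proof -
  obtain e b m where b: "valid e b" "t = Zt e b (Suc m)" by (rule T_ne_v0[OF t])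
  obtain e' a n where a: "valid e' a" "x = Zt e' a n" "chart e' x" using Zt_rep[OF x] by blast
  show ?thesis
  proof
    assume "x \<in> Dd t"
    then have xd: "x \<in> J e ` disk b (q ^ m)" using Dd_Zt b by simp
    then have "e' = e" using chart_disk[OF b(1) q_pow(2)] a(3) chart_unique by blast
    then obtain s where s: "sn s" "s (Lin b) < q ^ m" "J e (Fin (gs a (q ^ n))) = J e (Fin s)"
      using xd a by (auto simp: Zt_def disk_def)
    then have "gs a (q ^ n) = s" using J_inj[of "Fin (gs a (q ^ n))" "Fin s" e] by simp
    then have lt: "q ^ n < q ^ m" "av (a - b) < q ^ m" using s q_pow(1)[of n] by (auto simp: gs_Lin less_imp_le)
    then have "av (b - a) \<le> q ^ Suc m" using L_value_gap[of "b - a" m] L_diff valid_L a b av_commute by metis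
    then have "t = Zt e a (Suc m)" using Zt_eq b by auto
    moreover have "Suc m \<le> n" using lt q_pow_less by auto
    ultimately show "anc t x" using anc_Zt a \<open>e' = e\<close> by auto
  next
    assume "anc t x"
    then obtain k where k: "k \<le> n" "t = Zt e' a k" using anc_Zt a by auto
    then obtain j where j: "k = Suc j" using t Zt_0[OF a(1)] by (cases k) auto
    have "q ^ n < q ^ j" using q_pow_less k j by auto
    then have "Fin (gs a (q ^ n)) \<in> disk a (q ^ j)" using q_pow(1)[of n] by (auto simp: disk_def gs_Lin less_imp_le)
    then show "x \<in> Dd t" using Dd_Zt[OF a(1), of j] k j a(2) by (auto simp: Zt_def)
  qed
qed

text \<open>Ultrametric disks that meet are nested; a common point also forces a common
  chart.\<close>

lemma Dd_comparable:
  assumes t: "t \<in> T" "t \<noteq> v0" and t': "t' \<in> T" "t' \<noteq> v0" and x: "x \<in> Dd t" "x \<in> Dd t'"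
  shows "anc t t' \<or> anc t' t"
proof -
  have main: "anc (Zt e b (Suc m)) (Zt e b' (Suc m'))"
    if "valid e b" "valid e b'" "sn s" "s (Lin b) < q ^ m" "s (Lin b') < q ^ m'" "m \<le> m'" for e b m b' m' s
  proof -
    have "q ^ m' \<le> q ^ m" using that by (simp only: q_pow_le)
    moreover have "av (b - b') \<le> max (s (Lin b)) (s (Lin b'))"
      using sn_Lin_eq[OF that(3), of b b'] by (cases "s (Lin b) < av (b - b')") auto
    ultimately have "av (b - b') < q ^ m" using that by linarith
    then have "av (b - b') \<le> q ^ Suc m" using L_value_gap L_diff valid_L that by metis
    then show ?thesis using Zt_eq anc_Zt that by (metis Suc_le_mono)
  qed
  obtain e b m where b: "valid e b" "t = Zt e b (Suc m)" by (rule T_ne_v0[OF t])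
  obtain e' b' m' where b': "valid e' b'" "t' = Zt e' b' (Suc m')" by (rule T_ne_v0[OF t'])
  have xd: "x \<in> J e ` disk b (q ^ m)" "x \<in> J e' ` disk b' (q ^ m')" using x Dd_Zt b b' by auto
  then have ee: "e' = e" using chart_disk[OF b(1) q_pow(2)] chart_disk[OF b'(1) q_pow(2)] chart_unique by blast
  then obtain s s' where s: "sn s" "s (Lin b) < q ^ m" "x = J e (Fin s)" "sn s'" "s' (Lin b') < q ^ m'" "x = J e (Fin s')"
    using xd by (auto simp: disk_def)
  then have "s' = s" using J_inj[of "Fin s" "Fin s'" e] by simp
  then show ?thesis using main[of e b b' s m m'] main[of e b' b s m' m] s b b' ee by (cases "m \<le> m'") auto
qed

lemma Dd_mono: assumes t: "t' \<in> T" "t \<noteq> v0" and "anc t t'" shows "Dd t' \<subseteq> Dd t"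
proof -
  have "t' \<noteq> v0" using anc_par_cases[of v0 t] assms root_in by auto
  then obtain e b m where b: "valid e b" "t' = Zt e b (Suc m)" by (rule T_ne_v0[OF t(1)])
  obtain k where k: "k \<le> Suc m" "t = Zt e b k" using assms(3) anc_Zt b by auto
  then obtain j where j: "k = Suc j" using t Zt_0[OF b(1)] by (cases k) auto
  have "q ^ m \<le> q ^ j" using k j by (simp add: q_pow_le)
  then have "disk b (q ^ m) \<subseteq> disk b (q ^ j)" by (auto simp: disk_def)
  then show ?thesis using Dd_Zt b k j by auto
qed

lemma Dd_self: "t \<in> T \<Longrightarrow> t \<noteq> v0 \<Longrightarrow> t \<in> Dd t" by (simp add: Dd_iff)

text \<open>In the chart 1/z the inversion turns a disk missing 0 into an ordinary disk and a disk
  around 0 into a neighbourhood of infinity; in both cases the boundary point has to be carried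
  along.\<close>

lemma Dd_topology:
  assumes t: "t \<in> T" "t \<noteq> v0"
  shows "openin bt (Dd t)" "connectedin bt (Dd t)" "bt frontier_of (Dd t) = {par t}"
proof -
  obtain e a n where a: "valid e a" "t = Zt e a (Suc n)" by (rule T_ne_v0[OF t])
  define r where "r = q ^ n"
  have r: "r > 0" by (simp add: r_def)
  have D: "Dd t = J e ` disk a r" and p: "par t = J e (Fin (gs a r))" using Dd_Zt par_Zt a by (auto simp: r_def Zt_def)
  have "openin bt (Dd t) \<and> connectedin bt (Dd t) \<and> bt frontier_of (Dd t) = {par t}"
  proof (cases e)
    case False
    then have "Dd t = disk a r" "par t = Fin (gs a r)" using D p by (auto simp: J_def)
    then show ?thesis using disk_open disk_connected disk_frontier[OF r] by auto
  next
    case True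
    show ?thesis
    proof (cases "r \<le> av a")
      case le: True
      have a0: "a \<noteq> 0" using le r by auto
      have "Dd t = disk (1 / a) (r / av a ^ 2)" using D True disk_iota_away[OF r le] by (simp add: J_def image_def)
      moreover have "berk_map av iota (Fin (gs a r)) = Fin (gs (1 / a) (r / av a ^ 2))"
      proof (rule berk_map_gs(1)[OF nondeg_iota(1) r])
        show "av (a - a) \<le> r" using r by simp
        show "av (poly (snd iota) a) = gs a r (snd iota)" using le r by (simp add: iota_def Lin_0[symmetric] gs_Lin)
        show "1 / a = poly (fst iota) a / poly (snd iota) a" by (simp add: iota_def)
        have "1 - smult (1 / a) (Lin 0) = smult (- 1 / a) (Lin a)" using a0 by (simp add: Lin_def one_pCons)
        then have "gs a r (1 - smult (1 / a) (Lin 0)) = av (1 / a) * r"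
          using sn_smult[OF gs_sn[of r a], of "- 1 / a" "Lin a"] r by (simp add: gs_Lin del: smult_minus_left)
        then show "r / (av a)\<^sup>2 = gs a r (fst iota - smult (1 / a) (snd iota)) / gs a r (snd iota)"
          using le r by (simp add: iota_def Lin_0[symmetric] gs_Lin av_divide power2_eq_square)
      qed
      moreover have "r / av a ^ 2 > 0" using r a0 by simp
      ultimately show ?thesis using p True disk_open disk_connected disk_frontier by (simp add: J_def)
    next
      case gt: False
      have "disk a r = disk 0 r" using gt by (intro disk_recenter) auto
      then have "Dd t = disk_infty (1 / r)" using D True disk_iota_zero[OF r] by (simp add: J_def image_def)
      \<comment> \<open>The inversion has its pole at 0, so the image is computed from
        \<open>unif ^ n\<close>, a point of absolute value exactly \<open>r\<close>.\<close>
      moreover have "berk_map av iota (Fin (gs 0 r)) = Fin (gs (1 / unif ^ n) (1 / r))"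
      proof (rule berk_map_gs(1)[OF nondeg_iota(1) r])
        have u: "av (unif ^ n) = r" "unif ^ n \<noteq> 0" using av_unif_pow unif_pow by (auto simp: r_def)
        show "av (unif ^ n - 0) \<le> r" using u by simp
        show "av (poly (snd iota) (unif ^ n)) = gs 0 r (snd iota)" using u r by (simp add: iota_def Lin_0[symmetric] gs_Lin)
        show "1 / unif ^ n = poly (fst iota) (unif ^ n) / poly (snd iota) (unif ^ n)" by (simp add: iota_def)
        have "1 - smult (1 / unif ^ n) (Lin 0) = smult (- 1 / unif ^ n) (Lin (unif ^ n))" using u by (simp add: Lin_def one_pCons)
        then have "gs 0 r (1 - smult (1 / unif ^ n) (Lin 0)) = av (1 / unif ^ n) * r"
          using sn_smult[OF gs_sn[of r 0], of "- 1 / unif ^ n" "Lin (unif ^ n)"] r u by (simp add: gs_Lin del: smult_minus_left)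
        then show "1 / r = gs 0 r (fst iota - smult (1 / unif ^ n) (snd iota)) / gs 0 r (snd iota)"
          using r u by (simp add: iota_def Lin_0[symmetric] gs_Lin av_divide)
      qed
      moreover have "gs (1 / unif ^ n) (1 / r) = gs 0 (1 / r)"
        using r by (intro gs_recenter) (simp_all add: av_divide av_unif_pow r_def less_imp_le)
      moreover have "gs a r = gs 0 r" using gt r by (intro gs_recenter) auto
      moreover have "1 / r > 0" using r by simp
      ultimately show ?thesis using p True disk_infty_open disk_infty_connected[of "1 / r"] disk_infty_frontier[of "1 / r"]
        by (simp add: J_def)
    qed
  qed
  then show "openin bt (Dd t)" "connectedin bt (Dd t)" "bt frontier_of (Dd t) = {par t}" by auto
qed

end

section \<open>Images of disks and critical points\<close>

text \<open>The numerator of the derivative of \<open>f\<close>; its zeros are the affine critical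
  points, multiple poles included. Subtracting a multiple of the denominator from the numerator does
  not change it.\<close>

definition wronskian :: "'k::field poly \<times> 'k poly \<Rightarrow> 'k poly" where
  "wronskian f = pderiv (fst f) * snd f - fst f * pderiv (snd f)"

context berk
begin

lemma gs_left_le:
  assumes "r > 0" "\<And>t. 0 \<le> t \<Longrightarrow> t < r \<Longrightarrow> gs a t p \<le> M" shows "gs a r p \<le> M"
proof (rule continuous_le_on_closure[of "{0..<r}" "\<lambda>t. gs a t p"])
  have "closure {0..<r} \<subseteq> {0..}" by (intro closure_minimal) auto
  then show "continuous_on (closure {0..<r}) (\<lambda>t. gs a t p)" using continuous_on_subset[OF gs_continuous] by blast
  show "r \<in> closure {0..<r}" using assms(1) by simp
qed (use assms(2) in auto)

lemma gs_small: assumes "poly p x = 0" "\<delta> > 0" shows "\<exists>\<epsilon>>0. gs x \<epsilon> p < \<delta>"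
proof -
  obtain p' where p: "p = Lin x * p'" using assms(1) unfolding Lin_def by (meson dvdE poly_eq_0_iff_dvd)
  define M where "M = gs x 1 p' + 1"
  have M: "M > 0" using sn_nonneg[OF gs_sn[of 1 x], of p'] by (simp add: M_def)
  define e where "e = min 1 (\<delta> / (2 * M))"
  have e: "e > 0" "e \<le> 1" "e \<le> \<delta> / (2 * M)" using assms(2) M by (auto simp: e_def)
  have "gs x e p = e * gs x e p'" using e by (simp add: p gs_Lin_mult)
  also have "\<dots> \<le> e * M" using gs_mono[of e 1 x p'] e by (intro mult_left_mono) (auto simp: M_def)
  also have "\<dots> \<le> \<delta> / (2 * M) * M" using e M by (intro mult_right_mono) auto
  also have "\<dots> < \<delta>" using M assms(2) by simp
  finally show ?thesis using e by blast
qed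

lemma near_const: assumes "poly p x \<noteq> 0"
  shows "\<exists>\<epsilon>>0. \<forall>s. sn s \<longrightarrow> s (Lin x) < \<epsilon> \<longrightarrow> s p = av (poly p x)"
proof -
  obtain e where e: "e > 0" "gs x e (p - [:poly p x:]) < av (poly p x)"
    using gs_small[of "p - [:poly p x:]" x "av (poly p x)"] assms by auto
  have "s p = av (poly p x)" if s: "sn s" "s (Lin x) < e" for s
  proof -
    have "s (p - [:poly p x:]) < av (poly p x)" using gs_le[OF s(1), of x e] s(2) e(2) by (meson le_less_trans less_imp_le)
    then show ?thesis using sn_ultra_eq[OF s(1), of "p - [:poly p x:]" "[:poly p x:]"] sn_const[OF s(1)] by simp
  qed
  then show ?thesis using e by blast
qed

lemma near_zero_free: assumes "poly p x \<noteq> 0" shows "\<exists>r>0. zero_free x r p"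
proof -
  obtain e where e: "e > 0" "\<And>s. sn s \<Longrightarrow> s (Lin x) < e \<Longrightarrow> s p = av (poly p x)" using near_const[OF assms] by auto
  have "poly p y \<noteq> 0" if "av (y - x) < e" for y
    using e(2)[OF typeI_sn[of y]] that assms by auto
  then show ?thesis using e by (auto simp: zero_free_def)
qed

lemma zero_free_recenter: assumes "zero_free a r p" "av (b - a) < r" shows "zero_free b r p"
  unfolding zero_free_def
proof (intro allI impI)
  fix x assume "av (x - b) < r"
  then have "av (x - a) < r" using av_ultra[of x a b] assms(2) by linarith
  then show "poly p x \<noteq> 0" using assms(1) unfolding zero_free_def by blast
qed

lemma root_factor: fixes p :: "'k poly" assumes "poly p a = 0" obtains p' where "p = Lin a * p'"
  using assms unfolding Lin_def by (meson dvdE poly_eq_0_iff_dvd)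

lemma berk_map_typeI:
  assumes f: "nondeg f" and Q: "poly (snd f) x \<noteq> 0"
  shows "berk_map av f (Fin (gs x 0)) = Fin (gs (poly (fst f) x / poly (snd f) x) 0)"
proof -
  obtain t where t: "berk_map av f (Fin (gs x 0)) = Fin t" "sn t"
    "\<And>b. t (Lin b) = gs x 0 (fst f - smult b (snd f)) / gs x 0 (snd f)"
    using berk_map_Lin[OF f gs_sn[of 0 x]] Q by (auto simp: gs_zero)
  have "t (Lin (poly (fst f) x / poly (snd f) x)) = 0" using Q t(3) by (simp add: gs_zero)
  then show ?thesis using sn_kernel[OF t(2)] t(1) by simp
qed

text \<open>The image avoids infinity, so there are no poles and the denominator has constant size
  on the disk. The function \<open>f - c\<close> vanishes at \<open>a\<close> and is strictly
  smaller inside than at the boundary point, which gives the open disk of radius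
  \<open>R\<close>.\<close>

lemma disk_map:
  assumes f: "nondeg f" and r: "r > 0" and sub: "berk_map av f ` disk a r \<subseteq> disk c0 R0"
    and c: "c = poly (fst f) a / poly (snd f) a" and R: "R = gs a r (fst f - smult c (snd f)) / av (poly (snd f) a)"
  shows "zero_free a r (snd f)" "av (c - c0) < R0" "berk_map av f (Fin (gs a r)) = Fin (gs c R)" "R > 0" "R \<le> R0"
    "berk_map av f ` disk a r \<subseteq> disk c R"
proof -
  define P Q where "P = fst f" and "Q = snd f"
  show zf: "zero_free a r (snd f)" unfolding zero_free_def
  proof (intro allI impI notI)
    fix x assume x: "av (x - a) < r" "poly (snd f) x = 0"
    have "Fin (gs x 0) \<in> disk a r" using gs_sn[of 0 x] x by (simp add: disk_def gs_Lin)
    moreover have "berk_map av f (Fin (gs x 0)) = Inf" using x by (simp add: berk_map_def gs_zero)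
    ultimately show False using sub by (force simp: disk_def)
  qed
  have Qa: "poly (snd f) a \<noteq> 0" using zf r unfolding zero_free_def by auto
  have gQ: "gs a t (snd f) = av (poly (snd f) a)" if "0 \<le> t" "t \<le> r" for t
    using zero_free_gs[OF zf that] .
  have Q0: "gs a r (snd f) = av (poly (snd f) a)" using gQ[of r] r by simp
  have *: "av (a - a) \<le> r" "av (poly (snd f) a) = gs a r (snd f)" using r Q0 by auto
  show eq: "berk_map av f (Fin (gs a r)) = Fin (gs c R)" and R0: "R > 0"
    using berk_map_gs[OF f r * c] R Q0 by auto
  have "Fin (gs a 0) \<in> disk a r" using gs_sn[of 0 a] r by (simp add: disk_def gs_Lin)
  then have "Fin (gs c 0) \<in> disk c0 R0" using sub berk_map_typeI[OF f Qa] c by auto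
  then show cc: "av (c - c0) < R0" by (simp add: disk_def gs_Lin)
  \<comment> \<open>The hypothesis concerns only points inside the disk; the bound at the boundary
    radius is obtained as a limit from the left.\<close>
  have "gs a t (P - smult c Q) \<le> R0 * av (poly Q a)" if t: "0 \<le> t" "t < r" for t
  proof -
    have s: "sn (gs a t)" using t gs_sn by auto
    have "Fin (gs a t) \<in> disk a r" using s t by (simp add: disk_def gs_Lin)
    then have "berk_map av f (Fin (gs a t)) \<in> disk c0 R0" using sub by auto
    moreover obtain w where w: "berk_map av f (Fin (gs a t)) = Fin w" "\<And>b. w (Lin b) = gs a t (P - smult b Q) / gs a t Q"
      using berk_map_Lin[OF f s] gQ[of t] t Qa unfolding P_def Q_def by auto
    ultimately have "gs a t (P - smult c0 Q) / av (poly Q a) < R0" using gQ[of t] t by (simp add: disk_def Q_def)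
    then have 1: "gs a t (P - smult c0 Q) < R0 * av (poly Q a)" using Qa by (simp add: Q_def field_simps)
    have eqn: "P - smult c Q = (P - smult c0 Q) + smult (c0 - c) Q" by (simp add: smult_diff_left)
    moreover have "gs a t (smult (c0 - c) Q) < R0 * av (poly Q a)"
      using sn_smult[OF s] gQ[of t] t cc Qa av_commute[of c c0] by (simp add: Q_def)
    ultimately show ?thesis using 1 sn_ultra[OF s, of "P - smult c0 Q" "smult (c0 - c) Q"]
      unfolding eqn by linarith
  qed
  then have "gs a r (P - smult c Q) \<le> R0 * av (poly Q a)" by (rule gs_left_le[OF r])
  then show "R \<le> R0" using Qa by (simp add: R P_def Q_def field_simps)
  show "berk_map av f ` disk a r \<subseteq> disk c R"
  proof
    fix z assume "z \<in> berk_map av f ` disk a r"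
    then obtain s where s: "z = berk_map av f (Fin s)" "sn s" "s (Lin a) < r" by (auto simp: disk_def)
    have sQ: "s Q = av (poly Q a)" using zero_free_sn[OF s(2,3) zf] by (simp add: Q_def)
    obtain w where w: "z = Fin w" "sn w" "w (Lin c) = s (P - smult c Q) / s Q"
      using berk_map_Lin[OF f s(2)] sQ Qa s(1) unfolding P_def Q_def by auto
    have "s (P - smult c Q) < gs a r (P - smult c Q)"
      using Qa nondeg_diff[OF f, of c] by (intro sn_less_gs[OF s(2,3)]) (simp_all add: P_def Q_def c)
    then have "w (Lin c) < R" using w(3) sQ Qa by (simp add: R P_def Q_def divide_strict_right_mono)
    then show "z \<in> disk c R" using w by (auto simp: disk_def)
  qed
qed

section \<open>Derivatives and the Wronskian\<close>

lemma pcompose_pderiv: "pcompose (pderiv p) [:b, 1:] = pderiv (pcompose p [:b, 1:])" for p :: "'k poly"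
  by (simp add: pderiv_pcompose pderiv_pCons)

text \<open>The factor \<open>Suc i\<close> has absolute value 1 in residue characteristic
  zero.\<close>

lemma av_coeff_pderiv: "av (coeff (pderiv p) i) = av (coeff p (Suc i))"
  using av_nat[of "Suc i"] by (simp add: coeff_pderiv av_mult)

text \<open>When the constant term vanishes, differentiation merely shifts the index, which costs
  one factor \<open>t\<close> in the Gauss norm.\<close>

lemma gs_pderiv: assumes "poly p b = 0" "t > 0" shows "gs b t (pderiv p) * t = gs b t p"
proof -
  define p' where "p' = pcompose p [:b, 1:]"
  have p0: "coeff p' 0 = 0" using assms(1) by (simp add: p'_def poly_0_coeff_0[symmetric] poly_pcompose)
  have "gn t (pderiv p') * t = gn t p'"
  proof (rule antisym)
    obtain i where "gn t (pderiv p') = av (coeff (pderiv p') i) * t ^ i" using gn_attained by blast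
    then have "gn t (pderiv p') * t = av (coeff p' (Suc i)) * t ^ Suc i" by (simp add: av_coeff_pderiv mult_ac)
    also have "\<dots> \<le> gn t p'" using assms by (intro gn_ge) auto
    finally show "gn t (pderiv p') * t \<le> gn t p'" .
    obtain i where i: "gn t p' = av (coeff p' i) * t ^ i" using gn_attained by blast
    show "gn t p' \<le> gn t (pderiv p') * t"
    proof (cases i)
      case 0
      then show ?thesis using i p0 gn_nonneg[of t "pderiv p'"] assms by simp
    next
      case (Suc j)
      then have "gn t p' = (av (coeff (pderiv p') j) * t ^ j) * t" using i by (simp add: av_coeff_pderiv mult_ac)
      also have "\<dots> \<le> gn t (pderiv p') * t" using assms by (intro mult_right_mono gn_ge) auto
      finally show ?thesis .
    qed
  qed
  then show ?thesis unfolding gs_def p'_def[symmetric] pcompose_pderiv .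
qed

text \<open>For a zero-free polynomial the constant term is the Gauss norm even at the larger radius
  \<open>r\<close>, so at \<open>t < r\<close> every other term is strictly smaller.\<close>

lemma gs_pderiv_zero_free: assumes "zero_free b r p" "0 < t" "t < r" shows "gs b t (pderiv p) * t < av (poly p b)"
proof -
  define p' where "p' = pcompose p [:b, 1:]"
  have pb: "poly p b \<noteq> 0" using assms unfolding zero_free_def by auto
  obtain i where "gn t (pderiv p') = av (coeff (pderiv p') i) * t ^ i" using gn_attained by blast
  then have eq: "gn t (pderiv p') * t = av (coeff p' (Suc i)) * t ^ Suc i" by (simp add: av_coeff_pderiv mult_ac)
  have "gn t (pderiv p') * t < av (poly p b)"
  proof (cases "coeff p' (Suc i) = 0")
    case True
    then have "gn t (pderiv p') * t = 0" using eq by simp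
    moreover have "av (poly p b) > 0" using pb by simp
    ultimately show ?thesis by linarith
  next
    case False
    have "av (coeff p' (Suc i)) * t ^ Suc i < av (coeff p' (Suc i)) * r ^ Suc i"
      using False assms by (intro mult_strict_left_mono power_strict_mono) auto
    also have "\<dots> \<le> gn r p'" using assms by (intro gn_ge) auto
    also have "\<dots> = av (poly p b)" using zero_free_gs[OF assms(1), of r] assms by (simp add: gs_def p'_def)
    finally show ?thesis unfolding eq .
  qed
  then show ?thesis unfolding gs_def pcompose_pderiv p'_def[symmetric] .
qed

text \<open>Subtracting \<open>c\<close> makes the numerator \<open>P1\<close> vanish at
  \<open>b\<close>. In the Wronskian of \<open>P1\<close> and the zero-free denominator, the product
  with the derivative of \<open>P1\<close> dominates strictly; up to constants its size is the image
  radius divided by \<open>t\<close>.\<close>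

lemma gs_wronskian:
  assumes f: "nondeg f" and zf: "zero_free b r (snd f)" and t: "0 < t" "t < r"
    and c: "c = poly (fst f) b / poly (snd f) b"
  shows "gs b t (wronskian f) * t = gs b t (fst f - smult c (snd f)) * av (poly (snd f) b)"
proof -
  define P1 where "P1 = fst f - smult c (snd f)"
  have s: "sn (gs b t)" using gs_sn t by auto
  have Qb: "poly (snd f) b \<noteq> 0" using zf t unfolding zero_free_def by auto
  have P1: "P1 \<noteq> 0" "poly P1 b = 0" using nondeg_diff[OF f] Qb by (auto simp: P1_def c)
  have "wronskian f = pderiv P1 * snd f + - (P1 * pderiv (snd f))"
    by (simp add: wronskian_def P1_def pderiv_diff pderiv_smult algebra_simps)
  moreover have 1: "gs b t (pderiv P1 * snd f) * t = gs b t P1 * av (poly (snd f) b)"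
    using gs_pderiv[OF P1(2) t(1)] zero_free_gs[OF zf, of t] t by (simp add: sn_mult[OF s] mult_ac)
  moreover have "gs b t (- (P1 * pderiv (snd f))) * t < gs b t (pderiv P1 * snd f) * t"
    unfolding 1 sn_minus[OF s] using gs_pderiv_zero_free[OF zf t] gs_pos[OF t(1) P1(1)] by (simp add: sn_mult[OF s])
  ultimately have "gs b t (wronskian f) = gs b t (pderiv P1 * snd f)"
    using sn_ultra_eq[OF s, of "- (P1 * pderiv (snd f))" "pderiv P1 * snd f"] t
    by (metis add.commute mult_less_cancel_right_pos)
  then show ?thesis using 1 by (simp add: P1_def)
qed

lemma wronskian_nonzero: assumes f: "nondeg f" shows "wronskian f \<noteq> 0"
proof
  assume W: "wronskian f = 0"
  have "\<exists>b. poly (snd f) b \<noteq> 0"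
    using poly_eqI_off[of 1 "snd f" 0] nondeg_snd[OF f] by auto
  then obtain b r where b: "poly (snd f) b \<noteq> 0" "r > 0" "zero_free b r (snd f)" using near_zero_free by blast
  have s: "sn (gs b (r / 2))" using gs_sn b by auto
  have "gs b (r / 2) (fst f - smult (poly (fst f) b / poly (snd f) b) (snd f)) > 0"
    using b nondeg_diff[OF f] by (intro gs_pos) auto
  then show False using gs_wronskian[OF f b(3), of "r / 2"] W b sn_0[OF s] by simp
qed

text \<open>By the formula for the Wronskian, constancy of its seminorm forces the difference quotient
  to have constant seminorm, hence no zeros.\<close>
lemma noncritical_disk:
  assumes f: "nondeg f" and zf: "zero_free b r (snd f)" and r: "r > 0" and W: "zero_free b r (wronskian f)"
    and c: "c = poly (fst f) b / poly (snd f) b" and t: "0 < t" "t \<le> r"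
  shows "gs b t (fst f - smult c (snd f)) * r = gs b r (fst f - smult c (snd f)) * t"
proof -
  define P1 where "P1 = fst f - smult c (snd f)"
  have Qb: "poly (snd f) b \<noteq> 0" using zf r unfolding zero_free_def by auto
  have P1: "P1 \<noteq> 0" "poly P1 b = 0" using nondeg_diff[OF f] Qb by (auto simp: P1_def c)
  then obtain P2 where P2: "P1 = Lin b * P2" by (rule_tac root_factor) auto
  have P20: "P2 \<noteq> 0" using P1 P2 by auto
  have gP2: "gs b t P1 = t * gs b t P2" if "t > 0" for t using that by (simp add: P2 gs_Lin_mult)
  have const: "gs b t P2 * av (poly (snd f) b) = av (poly (wronskian f) b)" if "0 < t" "t < r" for t
    using gs_wronskian[OF f zf that c] zero_free_gs[OF W, of t] that gP2[of t] by (simp add: P1_def[symmetric])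
  have "zero_free b r P2" unfolding zero_free_def
  proof (intro allI impI notI)
    fix x assume x: "av (x - b) < r" "poly P2 x = 0"
    then obtain P3 where P3: "P2 = Lin x * P3" by (rule_tac root_factor) auto
    define m where "m = av (b - x)"
    have m: "m < r" "m \<ge> 0" using x av_commute[of b x] by (auto simp: m_def)
    define u v where "u = (2 * m + r) / 3" and "v = (m + 2 * r) / 3"
    have uv: "m < u" "u < v" "v < r" "0 < u" using m r by (auto simp: u_def v_def)
    have "gs b u P2 = gs b v P2" 
    proof -
      have "0 < u" "u < r" "0 < v" "v < r" using uv by linarith+
      then have "gs b u P2 * av (poly (snd f) b) = gs b v P2 * av (poly (snd f) b)" using const by metis
      then show ?thesis using Qb by simp
    qed
    moreover have "gs b u P2 = u * gs b u P3" "gs b v P2 = v * gs b v P3"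
      using uv by (simp_all add: P3 gs_Lin_mult m_def[symmetric] max_absorb1)
    moreover have "gs b u P3 > 0" using gs_pos[of u P3 b] uv P3 P20 by auto
    moreover have "gs b u P3 \<le> gs b v P3" using uv by (intro gs_mono) auto
    ultimately have "v * gs b u P3 \<le> u * gs b u P3" using uv by (smt (verit) mult_left_mono)
    then show False using uv \<open>gs b u P3 > 0\<close> by simp
  qed
  then have "gs b t P2 = gs b r P2" using zero_free_gs t r by simp
  then show ?thesis using gP2[of t] gP2[of r] t r by (simp add: P1_def[symmetric])
qed

text \<open>A nonarchimedean Schwarz lemma: at a radius \<open>t\<close> strictly between
  \<open>r'\<close> and \<open>r\<close> the difference quotients are at most
  \<open>r' / t < 1\<close>, and completeness yields a fixed point. The conclusion keeps the
  contraction estimate rather than the derivative, since the estimate transfers between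
  charts.\<close>

lemma contraction_fixed_point:
  assumes f: "nondeg f" and r: "0 < r'" "r' < r" and sub: "berk_map av f ` disk a r \<subseteq> disk a r'"
  shows "\<exists>x l e. av (x - a) < r \<and> 0 \<le> l \<and> l < 1 \<and> e > 0 \<and> poly (snd f) x \<noteq> 0 \<and> poly (fst f) x / poly (snd f) x = x \<and>
    (\<forall>y. av (y - x) < e \<longrightarrow> poly (snd f) y \<noteq> 0 \<and> av (poly (fst f) y / poly (snd f) y - x) \<le> l * av (y - x))"
proof -
  define P Q where "P = fst f" and "Q = snd f"
  define h where "h y = poly P y / poly Q y" for y
  have r0: "r > 0" using r by simp
  have zf: "zero_free a r Q" using disk_map(1)[OF f r0 sub refl refl] by (simp add: Q_def)
  have Qy: "poly Q y \<noteq> 0" if "av (y - a) < r" for y using zf that unfolding zero_free_def by auto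
  have ha: "av (h y - a) < r'" if "av (y - a) < r" for y
  proof -
    have "Fin (gs y 0) \<in> disk a r" using gs_sn[of 0 y] that by (simp add: disk_def gs_Lin)
    then have "Fin (gs (h y) 0) \<in> disk a r'" using sub berk_map_typeI[OF f, of y] Qy[OF that] by (force simp: h_def P_def Q_def)
    then show ?thesis by (simp add: disk_def gs_Lin)
  qed
  \<comment> \<open>Points of the smaller disk are within \<open>t\<close> of each other, and the
    boundary point of a disk of radius \<open>t\<close> around a point of \<open>disk a r\<close> is
    still in \<open>disk a r\<close>, hence mapped into \<open>disk a r'\<close>.\<close>
  define t where "t = (r' + r) / 2"
  have t: "r' < t" "t < r" "0 < t" using r by (auto simp: t_def)
  define l where "l = r' / t"
  have l: "0 \<le> l" "l < 1" using r t by (auto simp: l_def)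
  have contr: "av (h y - h z) \<le> l * av (y - z)" if y: "av (y - a) < r" and z: "av (z - a) < r" and yz: "av (y - z) \<le> t" for y z
  proof -
    define P1 where "P1 = P - smult (h z) Q"
    have zfz: "zero_free z r Q" by (rule zero_free_recenter[OF zf z])
    have s: "sn (gs z t)" using gs_sn t by auto
    have "Fin (gs z t) \<in> disk a r" using s t z by (simp add: disk_def gs_Lin)
    then have "berk_map av f (Fin (gs z t)) \<in> disk a r'" using sub by blast
    moreover have gQ: "gs z t Q = av (poly Q z)" using zero_free_gs[OF zfz, of t] t by simp
    moreover obtain w where w: "berk_map av f (Fin (gs z t)) = Fin w" "sn w" "w (Lin (h z)) = gs z t P1 / gs z t Q"
      using berk_map_Lin[OF f s] gQ Qy[OF z] unfolding P_def Q_def P1_def by auto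
    ultimately have "w (Lin a) < r'" by (simp add: disk_def)
    then have "w (Lin (h z)) < r'" using sn_Lin[OF w(2), of "h z" a] ha[OF z] av_commute[of a "h z"] by simp
    then have P1: "gs z t P1 < r' * av (poly Q z)" using w(3) gQ Qy[OF z] by (simp add: field_simps)
    have "poly P1 z = 0" using Qy[OF z] by (simp add: P1_def h_def)
    then obtain P2 where P2: "P1 = Lin z * P2" by (rule root_factor)
    have "t * gs z t P2 < r' * av (poly Q z)" using P1 t by (simp add: P2 gs_Lin_mult)
    then have "gs z t P2 \<le> l * av (poly Q z)" using t by (simp add: l_def field_simps)
    then have "av (poly P2 y) \<le> l * av (poly Q z)" using poly_le_gs[OF yz, of P2] by linarith
    then have "av (y - z) * av (poly P2 y) \<le> av (y - z) * (l * av (poly Q z))" by (intro mult_left_mono) auto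
    then have 1: "av (poly P1 y) \<le> l * av (y - z) * av (poly Q z)" by (simp add: P2 av_mult mult_ac)
    have "av (poly Q y) = av (poly Q z)"
      using zero_free_sn[OF typeI_sn[of y], of z r Q] zfz yz t by simp
    moreover have "h y - h z = poly P1 y / poly Q y" using Qy[OF y] by (simp add: P1_def h_def[of y] diff_divide_distrib)
    ultimately show ?thesis using 1 Qy[OF z] by (simp add: av_divide field_simps)
  qed
  define x where "x n = (h ^^ n) a" for n
  have xS: "x (Suc n) = h (x n)" for n by (simp add: x_def)
  have xa: "av (x n - a) < r'" for n
  proof (induction n)
    case 0 then show ?case using r by (simp add: x_def)
  next
    case (Suc n) then show ?case using ha[of "x n"] xS r by simp
  qed
  have xr: "av (x n - a) < r" for n using xa[of n] r by linarith
  have xx: "av (x n - x m) \<le> t" for n m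
    using av_ultra[of "x n" "x m" a] xa[of n] xa[of m] av_commute[of a "x m"] t by linarith
  have step: "av (x (Suc n) - x n) \<le> r' * l ^ n" for n
  proof (induction n)
    case 0 then show ?case using xa[of 1] by (simp add: x_def)
  next
    case (Suc n)
    have "av (x (Suc (Suc n)) - x (Suc n)) \<le> l * av (x (Suc n) - x n)"
      using contr[OF xr xr xx, of "Suc n" n] by (simp add: xS)
    also have "\<dots> \<le> l * (r' * l ^ n)" using Suc l by (intro mult_left_mono) auto
    finally show ?case by (simp add: mult_ac)
  qed
  have far: "av (x (n + k) - x n) \<le> r' * l ^ n" for n k
  proof (induction k)
    case (Suc k)
    have "l ^ (n + k) \<le> l ^ n" using l by (intro power_decreasing) auto
    then have "r' * l ^ (n + k) \<le> r' * l ^ n" using r by simp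
    then show ?case using av_ultra[of "x (n + Suc k)" "x n" "x (n + k)"] step[of "n + k"] Suc by simp
  qed (use l r in auto)
  have lim0: "(\<lambda>n. r' * l ^ n) \<longlonglongrightarrow> 0" using l by (intro tendsto_mult_right_zero LIMSEQ_realpow_zero) auto
  have "\<forall>e>0. \<exists>N. \<forall>m\<ge>N. \<forall>n\<ge>N. av (x m - x n) < e"
  proof (intro allI impI)
    fix e :: real assume "e > 0"
    then have "eventually (\<lambda>n. r' * l ^ n < e) sequentially" using lim0 order_tendstoD(2) by blast
    then obtain N where N: "r' * l ^ N < e" by (auto simp: eventually_sequentially)
    have "av (x m - x n) < e" if "m \<ge> N" "n \<ge> N" for m n
    proof -
      have "av (x m - x N) \<le> r' * l ^ N" "av (x n - x N) \<le> r' * l ^ N" using far[of N "m - N"] far[of N "n - N"] that by auto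
      then show ?thesis using av_ultra[of "x m" "x n" "x N"] av_commute[of "x N" "x n"] N by linarith
    qed
    then show "\<exists>N. \<forall>m\<ge>N. \<forall>n\<ge>N. av (x m - x n) < e" by blast
  qed
  then obtain y where y: "\<And>e. e > 0 \<Longrightarrow> \<exists>N. \<forall>n\<ge>N. av (x n - y) < e"
    using complete unfolding absv_complete_def by blast
  obtain N0 where "\<forall>n\<ge>N0. av (x n - y) < r'" using y[OF r(1)] by blast
  then have "av (x N0 - y) < r'" by blast
  then have "av (y - a) < r'" using av_ultra[of y a "x N0"] xa[of N0] av_commute[of y "x N0"] by linarith
  then have ya: "av (y - a) < r" using r by linarith
  have "h y = y"
  proof (rule ccontr)
    assume "h y \<noteq> y"
    then have "min (av (h y - y)) t > 0" using t by simp
    then obtain N where N: "\<forall>n\<ge>N. av (x n - y) < min (av (h y - y)) t" using y by blast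
    then have 1: "av (x N - y) < av (h y - y)" "av (x N - y) < t" "av (x (Suc N) - y) < av (h y - y)" by auto
    have "av (h y - h (x N)) \<le> l * av (y - x N)" using contr[OF ya xr[of N]] 1 av_commute[of y "x N"] by simp
    also have "\<dots> \<le> av (y - x N)" using l by (simp add: mult_left_le_one_le)
    finally have "av (h y - x (Suc N)) < av (h y - y)" using 1 av_commute[of y "x N"] by (simp add: xS)
    then show False using av_ultra[of "h y" y "x (Suc N)"] 1 by linarith
  qed
  have "poly Q z \<noteq> 0 \<and> av (h z - y) \<le> l * av (z - y)" if "av (z - y) < t" for z
  proof -
    have "av (z - a) < r" using av_ultra[of z a y] that ya t by linarith
    then show ?thesis using Qy contr[OF _ ya, of z] that \<open>h y = y\<close> by simp
  qed
  then show ?thesis using ya l t \<open>h y = y\<close> Qy[OF ya] unfolding h_def P_def Q_def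
    by (intro exI[of _ y] exI[of _ l] exI[of _ t]) auto
qed

text \<open>The difference quotient is \<open>P2 / Q\<close>, whose value at \<open>x\<close> is the
  derivative. Its size is constant near \<open>x\<close>, so a single \<open>y\<close> close to
  \<open>x\<close> but different from it suffices for the comparison with \<open>l\<close>.\<close>

lemma rat_deriv_le:
  assumes x: "poly (snd f) x \<noteq> 0" "poly (fst f) x / poly (snd f) x = x" and l: "0 \<le> l" and e: "e > 0"
    and c: "\<And>y. av (y - x) < e \<Longrightarrow> poly (snd f) y \<noteq> 0 \<and> av (poly (fst f) y / poly (snd f) y - x) \<le> l * av (y - x)"
  shows "av (rat_deriv_at f x) \<le> l"
proof -
  define P Q where "P = fst f" and "Q = snd f"
  define P1 where "P1 = P - smult x Q"
  have Px: "poly P x = x * poly Q x" using x by (simp add: P_def Q_def field_simps)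
  then have "poly P1 x = 0" by (simp add: P1_def)
  then obtain P2 where P2: "P1 = Lin x * P2" by (rule root_factor)
  have "poly (pderiv P1) x = poly P2 x" by (simp add: P2 pderiv_mult) (simp add: Lin_def pderiv_pCons)
  then have "poly (pderiv P) x - x * poly (pderiv Q) x = poly P2 x" by (simp add: P1_def pderiv_diff pderiv_smult)
  moreover have "rat_deriv_at f x = (poly (pderiv P) x - x * poly (pderiv Q) x) / poly Q x"
    using x Px by (simp add: rat_deriv_at_def P_def[symmetric] Q_def[symmetric] power2_eq_square field_simps)
  ultimately have d: "rat_deriv_at f x = poly P2 x / poly Q x" by simp
  show ?thesis
  proof (cases "poly P2 x = 0")
    case True
    then show ?thesis using d l by simp
  next
    case False
    obtain e1 where e1: "e1 > 0" "\<And>s. sn s \<Longrightarrow> s (Lin x) < e1 \<Longrightarrow> s P2 = av (poly P2 x)" using near_const[OF False] by blast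
    obtain e2 where e2: "e2 > 0" "\<And>s. sn s \<Longrightarrow> s (Lin x) < e2 \<Longrightarrow> s Q = av (poly Q x)" using near_const[of Q x] x Q_def by blast
    have "(\<lambda>n. q ^ n) \<longlonglongrightarrow> 0" using unif(2,3) by (intro LIMSEQ_realpow_zero) auto
    then have "eventually (\<lambda>n. q ^ n < min e (min e1 e2)) sequentially"
      using e e1 e2 by (intro order_tendstoD(2)) auto
    then obtain n where n: "q ^ n < min e (min e1 e2)" by (auto simp: eventually_sequentially)
    define y where "y = x + unif ^ n"
    have y: "av (y - x) < e" "av (y - x) < e1" "av (y - x) < e2" "y - x \<noteq> 0" using n unif_pow by (auto simp: y_def av_unif_pow)
    have Qy: "av (poly Q y) = av (poly Q x)" "av (poly P2 y) = av (poly P2 x)"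
      using e2(2)[OF typeI_sn[of y]] e1(2)[OF typeI_sn[of y]] y by simp_all
    have "poly P y / poly Q y - x = (y - x) * poly P2 y / poly Q y"
    proof -
      have "poly P1 y = (y - x) * poly P2 y" by (simp add: P2)
      then show ?thesis using c[OF y(1)] by (simp add: P1_def Q_def[symmetric] field_simps)
    qed
    then have "av (y - x) * av (poly P2 x) / av (poly Q x) \<le> l * av (y - x)"
      using c[OF y(1)] Qy by (simp add: P_def[symmetric] Q_def[symmetric] av_divide av_mult)
    then have "av (poly P2 x) / av (poly Q x) \<le> l" using y(4) x(1) by (simp add: field_simps Q_def)
    then show ?thesis using d by (simp add: av_divide)
  qed
qed

text \<open>\<open>cj e' f e\<close> is f read in the chart e on the source and in the chart e' on the target.\<close>
definition pre :: "bool \<Rightarrow> 'k poly \<times> 'k poly \<Rightarrow> 'k poly \<times> 'k poly" where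
  "pre e f = (if e then rat_comp f iota else f)"
definition cj :: "bool \<Rightarrow> 'k poly \<times> 'k poly \<Rightarrow> bool \<Rightarrow> 'k poly \<times> 'k poly" where
  "cj e' f e = (if e' then (snd (pre e f), fst (pre e f)) else pre e f)"

lemma cj_alt: "cj e' f e = (if e' then rat_comp iota (pre e f) else pre e f)"
  by (simp add: cj_def rat_comp_iota_left)

lemma nondeg_pre: "nondeg f \<Longrightarrow> nondeg (pre e f)"
  using rat_comp_correct(1)[OF _ nondeg_iota(1)] by (simp add: pre_def)
lemma nondeg_cj: "nondeg f \<Longrightarrow> nondeg (cj e' f e)"
  unfolding cj_alt using rat_comp_correct(1)[OF nondeg_iota(1) nondeg_pre] nondeg_pre by simp
lemma ratL_cj: "ratL f \<Longrightarrow> ratL (cj e' f e)"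
  unfolding cj_alt pre_def using ratL_comp ratL_iota by simp

lemma berk_map_cj: assumes "nondeg f" "z \<in> BP av"
  shows "berk_map av (cj e' f e) z = J e' (berk_map av f (J e z))"
proof -
  have "berk_map av (pre e f) z = berk_map av f (J e z)"
    using rat_comp_correct(3)[OF assms(1) nondeg_iota(1) assms(2)] by (simp add: pre_def J_def)
  then show ?thesis
    using rat_comp_correct(3)[OF nondeg_iota(1) nondeg_pre[OF assms(1)] assms(2)] by (simp add: cj_alt J_def)
qed

section \<open>The action on split points and their disks\<close>

lemma wronskian_cj: "wronskian (cj e' f e) = (if e' then - wronskian (pre e f) else wronskian (pre e f))"
  by (simp add: wronskian_def cj_def algebra_simps)

end

locale berk_dynamics = berk av L for av :: "'k::field \<Rightarrow> real" and L :: "'k set" +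
  fixes f :: "'k poly \<times> 'k poly"
  assumes f: "ratL f"
begin

abbreviation "F \<equiv> berk_map av f"

lemma nd: "nondeg f" using f by (simp add: ratL_def)
lemma F_T: "z \<in> T \<Longrightarrow> F z \<in> T" using T_image[OF f] .
lemma F_BP: "z \<in> BP av \<Longrightarrow> F z \<in> BP av" using berk_map_BP[OF nd] .

text \<open>The target is a residue disk at the root with split centre. The finer target, a disk
  attached to \<open>F (par t)\<close>, is derived in \<open>good_image\<close>.\<close>

definition good :: "'k berk \<Rightarrow> bool" where
  "good t \<longleftrightarrow> (\<exists>e c. valid e c \<and> F ` Dd t \<subseteq> J e ` disk c 1)"

lemma good_image:
  assumes t: "valid e a" "t = Zt e a (Suc n)" and g: "good t"
  obtains e' c j G where "valid e' c" "G = cj e' f e" "c = poly (fst G) a / poly (snd G) a"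
    "zero_free a (q ^ n) (snd G)" "q ^ j = gs a (q ^ n) (fst G - smult c (snd G)) / av (poly (snd G) a)"
    "F (par t) = Zt e' c j" "F ` Dd t \<subseteq> Dd (Zt e' c (Suc j))"
proof -
  obtain e' c0 where c0: "valid e' c0" "F ` Dd t \<subseteq> J e' ` disk c0 1" using g unfolding good_def by blast
  define G where "G = cj e' f e"
  have nG: "nondeg G" and LG: "ratL G" unfolding G_def using nondeg_cj[OF nd] ratL_cj[OF f] by auto
  have Dt: "Dd t = J e ` disk a (q ^ n)" using Dd_Zt[OF t(1)] t(2) by simp
  have JG: "F (J e z) = J e' (berk_map av G z)" if "z \<in> BP av" for z
    using berk_map_cj[OF nd that, of e' e] J_J F_BP J_BP that unfolding G_def by simp
  have sub: "berk_map av G ` disk a (q ^ n) \<subseteq> disk c0 1"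
  proof
    fix w assume "w \<in> berk_map av G ` disk a (q ^ n)"
    then obtain z where z: "z \<in> disk a (q ^ n)" "w = berk_map av G z" by auto
    then have zB: "z \<in> BP av" using disk_BP by auto
    have "F (J e z) \<in> J e' ` disk c0 1" using c0(2) Dt z by blast
    then obtain y where y: "y \<in> disk c0 1" "J e' w = J e' y" using JG[OF zB] z by auto
    have "w \<in> BP av" "y \<in> BP av" using berk_map_BP[OF nG zB] z y disk_BP by auto
    then show "w \<in> disk c0 1" using J_inj y by blast
  qed
  define c where "c = poly (fst G) a / poly (snd G) a"
  define R where "R = gs a (q ^ n) (fst G - smult c (snd G)) / av (poly (snd G) a)"
  note dm = disk_map[OF nG q_pow(1) sub c_def R_def]
  have cL: "c \<in> L" unfolding c_def using LG valid_L[OF t(1)] by (auto simp: ratL_def intro!: L_divide polyL_poly)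
  have vc: "valid e' c"
  proof -
    have "av c \<le> max (av (c - c0)) (av c0)" using av_add[of "c - c0" c0] by simp
    then show ?thesis using dm(2) c0(1) cL by (auto simp: valid_def split: if_splits)
  qed
  have aB: "Fin (gs a (q ^ n)) \<in> BP av" by simp
  have p: "par t = J e (Fin (gs a (q ^ n)))" using par_Zt[OF t(1)] t(2) by (simp add: Zt_def)
  have Fp: "F (par t) = J e' (Fin (gs c R))" using JG[OF aB] dm(3) p by simp
  \<comment> \<open>So far \<open>R\<close> is just a real number. Since \<open>par t\<close> is
    split, so is its image, which puts \<open>R\<close> into the value group of \<open>L\<close>;
    with \<open>R \<le> 1\<close> it is a power of \<open>q\<close>.\<close>
  have "par t \<in> T" using par_Zt[OF t(1)] Zt_T[OF t(1)] t(2) by simp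
  then have "J e' (J e' (Fin (gs c R))) \<in> T" using F_T Fp J_T by metis
  then have "Fin (gs c R) \<in> T" using J_J[of "Fin (gs c R)" e'] gs_sn dm(4) by simp
  then obtain b \<rho> where b: "\<rho> \<in> L" "\<rho> \<noteq> 0" "gs c R = gs b (av \<rho>)" by (auto simp: T_iff)
  then have "R = av \<rho>" using gs_inj[of R "av \<rho>" c b] dm(4) by auto
  then obtain j where j: "R = q ^ j" using L_value_le1[OF b(1,2)] dm(5) by auto
  have "F ` Dd t \<subseteq> Dd (Zt e' c (Suc j))"
  proof
    fix w assume "w \<in> F ` Dd t"
    then obtain z where z: "z \<in> disk a (q ^ n)" "w = F (J e z)" using Dt by auto
    then have "w = J e' (berk_map av G z)" using JG disk_BP by auto
    then show "w \<in> Dd (Zt e' c (Suc j))" using dm(6) z j Dd_Zt[OF vc] by auto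
  qed
  then show thesis using that[of e' c G j] vc G_def c_def dm(1) R_def j Fp by (simp add: Zt_def)
qed

text \<open>The root has an empty \<open>Dd\<close> and would count as good vacuously; it is added
  because it has no parent and carries no disk.\<close>

definition B :: "'k berk set" where "B = {t \<in> T. t = v0 \<or> \<not> good t}"
definition g :: "'k berk \<Rightarrow> 'k berk" where
  "g t = (SOME x. x \<in> T \<and> x \<noteq> v0 \<and> par x = F (par t) \<and> F ` Dd t \<subseteq> Dd x)"

lemma g_props: assumes "t \<in> T" "t \<notin> B"
  shows "g t \<in> T" "g t \<noteq> v0" "par (g t) = F (par t)" "F ` Dd t \<subseteq> Dd (g t)"
proof -
  have t: "t \<noteq> v0" "good t" using assms by (auto simp: B_def)
  obtain e a n where a: "valid e a" "t = Zt e a (Suc n)" by (rule T_ne_v0[OF assms(1) t(1)])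
  obtain e' c j G where "valid e' c" "F (par t) = Zt e' c j" "F ` Dd t \<subseteq> Dd (Zt e' c (Suc j))"
    by (rule good_image[OF a t(2)])
  then have "\<exists>x. x \<in> T \<and> x \<noteq> v0 \<and> par x = F (par t) \<and> F ` Dd t \<subseteq> Dd x"
    using Zt_T Zt_ne_v0 par_Zt by (intro exI[of _ "Zt e' c (Suc j)"]) auto
  from someI_ex[OF this] show "g t \<in> T" "g t \<noteq> v0" "par (g t) = F (par t)" "F ` Dd t \<subseteq> Dd (g t)"
    unfolding g_def by auto
qed

text \<open>The inequality says that \<open>f - c\<close>, read in the charts, has size below 1 on
  the disk.\<close>

lemma goodI:
  assumes "valid e b" "valid e' c" "G = cj e' f e"
    and s: "\<And>s. sn s \<Longrightarrow> s (Lin b) < q ^ m \<Longrightarrow> s (fst G - smult c (snd G)) < s (snd G)"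
  shows "good (Zt e b (Suc m))"
proof -
  have nG: "nondeg G" using nondeg_cj[OF nd] assms(3) by simp
  have "F ` Dd (Zt e b (Suc m)) \<subseteq> J e' ` disk c 1"
  proof
    fix w assume "w \<in> F ` Dd (Zt e b (Suc m))"
    then obtain s where z: "w = F (J e (Fin s))" "sn s" "s (Lin b) < q ^ m" using Dd_Zt[OF assms(1)] by (auto simp: disk_def)
    have lt: "s (fst G - smult c (snd G)) < s (snd G)" using s z by auto
    then have "s (snd G) > 0" using sn_nonneg[OF z(2), of "fst G - smult c (snd G)"] by linarith
    then obtain t where t: "berk_map av G (Fin s) = Fin t" "sn t" "t (Lin c) = s (fst G - smult c (snd G)) / s (snd G)"
      using berk_map_Lin[OF nG z(2)] by auto
    then have "berk_map av G (Fin s) \<in> disk c 1" using lt \<open>s (snd G) > 0\<close> by (simp add: disk_def)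
    moreover have "w = J e' (berk_map av G (Fin s))"
      using berk_map_cj[OF nd, of "Fin s" e' e] z J_J F_BP J_BP assms(3) by simp
    ultimately show "w \<in> J e' ` disk c 1" by simp
  qed
  then show ?thesis unfolding good_def using assms(2) by blast
qed

text \<open>Without zeros and poles the size of \<open>f\<close> is constant on the disk. Below 1
  the image lies around 0, above 1 around infinity; if it equals 1, then \<open>f - f b\<close>
  vanishes at \<open>b\<close> and has size below 1 inside.\<close>

lemma good_of_zero_free:
  assumes b: "valid e b" and P: "zero_free b (q ^ m) (fst (pre e f))" and Q: "zero_free b (q ^ m) (snd (pre e f))"
  shows "good (Zt e b (Suc m))"
proof -
  define P Q where "P = fst (pre e f)" and "Q = snd (pre e f)"
  have v0: "valid e' 0" for e' by (auto simp: valid_def)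
  have sP: "s P = av (poly P b)" and sQ: "s Q = av (poly Q b)" if "sn s" "s (Lin b) < q ^ m" for s
    using zero_free_sn[OF that] assms(2,3) by (auto simp: P_def Q_def)
  have nz: "poly P b \<noteq> 0" "poly Q b \<noteq> 0" using P Q unfolding zero_free_def P_def Q_def by auto
  consider "av (poly P b) < av (poly Q b)" | "av (poly Q b) < av (poly P b)" | "av (poly P b) = av (poly Q b)" by linarith
  then show ?thesis
  proof cases
    case 1
    show ?thesis by (rule goodI[OF b v0[of False] refl]) (use 1 sP sQ in \<open>simp add: cj_def P_def Q_def\<close>)
  next
    case 2
    show ?thesis by (rule goodI[OF b v0[of True] refl]) (use 2 sP sQ in \<open>simp add: cj_def P_def Q_def\<close>)
  next
    case 3
    define c where "c = poly P b / poly Q b"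
    have "av c = 1" using 3 nz by (simp add: c_def av_divide)
    moreover have "c \<in> L" unfolding c_def P_def Q_def using ratL_cj[OF f, of False e] valid_L[OF b]
      by (auto simp: ratL_def cj_def intro!: L_divide polyL_poly)
    ultimately have vc: "valid False c" by (simp add: valid_def)
    show ?thesis
    proof (rule goodI[OF b vc refl])
      fix s assume s: "sn s" "s (Lin b) < q ^ m"
      have sb: "sn (gs b (q ^ m))" by simp
      have "P - smult c Q \<noteq> 0" using nondeg_diff[OF nondeg_pre[OF nd, of e]] by (simp add: P_def Q_def)
      moreover have "poly (P - smult c Q) b = 0" using nz by (simp add: c_def)
      ultimately have "s (P - smult c Q) < gs b (q ^ m) (P - smult c Q)" by (rule sn_less_gs[OF s])
      also have "\<dots> \<le> max (gs b (q ^ m) P) (gs b (q ^ m) (smult c Q))" by (rule sn_diff[OF sb])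
      also have "\<dots> = av (poly Q b)"
        using zero_free_gs[OF assms(2), of "q ^ m"] zero_free_gs[OF assms(3), of "q ^ m"] 3 \<open>av c = 1\<close> q_pow(1)[of m]
        by (simp add: sn_smult[OF sb] P_def Q_def less_imp_le del: q_pow)
      also have "\<dots> = s Q" using sQ[OF s] by simp
      finally show "s (fst (cj False f e) - smult c (snd (cj False f e))) < s (snd (cj False f e))"
        by (simp add: cj_def P_def Q_def)
    qed
  qed
qed

text \<open>Small disks near a zero go close to 0 and small disks near a pole close to infinity,
  uniformly from some level on.\<close>

lemma good_near_zero:
  assumes "poly (fst (pre e f) * snd (pre e f)) x = 0"
  shows "\<exists>M. \<forall>m\<ge>M. \<forall>b. valid e b \<longrightarrow> av (x - b) < q ^ m \<longrightarrow> good (Zt e b (Suc m))"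
proof -
  define P Q where "P = fst (pre e f)" and "Q = snd (pre e f)"
  have v0: "valid e' 0" for e' by (auto simp: valid_def)
  have *: "\<exists>M. \<forall>m\<ge>M. \<forall>b s. av (x - b) < q ^ m \<longrightarrow> sn s \<longrightarrow> s (Lin b) < q ^ m \<longrightarrow> s p < s p'"
    if "poly p x = 0" "poly p' x \<noteq> 0" for p p'
  proof -
    note pp = that
    obtain e1 where e1: "e1 > 0" "\<And>s. sn s \<Longrightarrow> s (Lin x) < e1 \<Longrightarrow> s p' = av (poly p' x)" using near_const[OF pp(2)] by blast
    obtain e2 where e2: "e2 > 0" "gs x e2 p < av (poly p' x)" using gs_small[OF pp(1), of "av (poly p' x)"] pp(2) by auto
    have "(\<lambda>n. q ^ n) \<longlonglongrightarrow> 0" using unif(2,3) by (intro LIMSEQ_realpow_zero) auto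
    then have "eventually (\<lambda>n. q ^ n < min e1 e2) sequentially" using e1 e2 by (intro order_tendstoD(2)) auto
    then obtain M where M: "\<And>m. m \<ge> M \<Longrightarrow> q ^ m < min e1 e2" by (auto simp: eventually_sequentially)
    have "s p < s p'" if "m \<ge> M" "av (x - b) < q ^ m" "sn s" "s (Lin b) < q ^ m" for m b s
    proof -
      have "s (Lin x) < q ^ m" using sn_Lin[OF that(3), of x b] that av_commute[of x b] by simp
      then have "s (Lin x) < e1" "s (Lin x) \<le> e2" using M[OF that(1)] by auto
      then show ?thesis using e1(2)[OF that(3)] gs_le[OF that(3), of x e2 p] e2 by simp
    qed
    then show ?thesis by blast
  qed
  have "poly P x \<noteq> 0 \<or> poly Q x \<noteq> 0" using nondeg_typeI[OF nondeg_pre[OF nd, of e], of x] by (simp add: P_def Q_def)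
  moreover have "poly P x = 0 \<or> poly Q x = 0" using assms by (simp add: P_def Q_def)
  ultimately consider "poly P x = 0" "poly Q x \<noteq> 0" | "poly Q x = 0" "poly P x \<noteq> 0" by blast
  then show ?thesis
  proof cases
    case 1
    obtain M where M: "\<forall>m\<ge>M. \<forall>b s. av (x - b) < q ^ m \<longrightarrow> sn s \<longrightarrow> s (Lin b) < q ^ m \<longrightarrow> s P < s Q" using *[OF 1] by blast
    have "good (Zt e b (Suc m))" if "m \<ge> M" "valid e b" "av (x - b) < q ^ m" for m b
      by (rule goodI[OF that(2) v0[of False] refl]) (use M that in \<open>simp add: cj_def P_def Q_def\<close>)
    then show ?thesis by blast
  next
    case 2
    obtain M where M: "\<forall>m\<ge>M. \<forall>b s. av (x - b) < q ^ m \<longrightarrow> sn s \<longrightarrow> s (Lin b) < q ^ m \<longrightarrow> s Q < s P" using *[OF 2] by blast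
    have "good (Zt e b (Suc m))" if "m \<ge> M" "valid e b" "av (x - b) < q ^ m" for m b
      by (rule goodI[OF that(2) v0[of True] refl]) (use M that in \<open>simp add: cj_def P_def Q_def\<close>)
    then show ?thesis by blast
  qed
qed

text \<open>A bad disk contains a zero or a pole \<open>x\<close>. For each \<open>x\<close> only
  finitely many levels are bad by \<open>good_near_zero\<close>, and at each level only one disk
  contains \<open>x\<close>, by the gap in the values of \<open>L\<close>.\<close>

lemma finite_B: "finite B"
proof -
  define Z where "Z e = {x. poly (fst (pre e f) * snd (pre e f)) x = 0}" for e
  have finZ: "finite (Z e)" for e unfolding Z_def
    using nondeg_fst[OF nondeg_pre[OF nd]] nondeg_snd[OF nondeg_pre[OF nd]] by (intro poly_roots_finite) auto
  define N where "N e x = (SOME M. \<forall>m\<ge>M. \<forall>b. valid e b \<longrightarrow> av (x - b) < q ^ m \<longrightarrow> good (Zt e b (Suc m)))" for e x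
  have N: "good (Zt e b (Suc m))" if "x \<in> Z e" "m \<ge> N e x" "valid e b" "av (x - b) < q ^ m" for e x m b
    using someI_ex[OF good_near_zero[of e x]] that unfolding Z_def N_def by blast
  define K where "K e x m = {t. \<exists>b. valid e b \<and> av (x - b) < q ^ m \<and> t = Zt e b (Suc m)}" for e x m
  have "t = t'" if t: "t \<in> K e x m" "t' \<in> K e x m" for t t' e x m
  proof -
    obtain b b' where b: "valid e b" "av (x - b) < q ^ m" "t = Zt e b (Suc m)" "valid e b'" "av (x - b') < q ^ m" "t' = Zt e b' (Suc m)"
      using t unfolding K_def by blast
    then have "av (b - b') < q ^ m" using av_ultra[of b b' x] av_commute[of b x] by linarith
    then have "av (b - b') \<le> q ^ Suc m" using L_value_gap L_diff valid_L b by metis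
    then show ?thesis using Zt_eq b by auto
  qed
  then have "K e x m \<subseteq> {SOME t. t \<in> K e x m}" for e x m by (metis singletonI someI_ex subsetI)
  then have finK: "finite (K e x m)" for e x m
    using finite_subset[of "K e x m" "{SOME t. t \<in> K e x m}"] by simp
  have "B \<subseteq> insert v0 (\<Union>e\<in>UNIV. \<Union>x\<in>Z e. \<Union>m\<in>{..<N e x}. K e x m)"
  proof
    fix t assume t: "t \<in> B"
    show "t \<in> insert v0 (\<Union>e\<in>UNIV. \<Union>x\<in>Z e. \<Union>m\<in>{..<N e x}. K e x m)"
    proof (cases "t = v0")
      case False
      then have "t \<in> T" "\<not> good t" using t by (auto simp: B_def)
      then obtain e b m where b: "valid e b" "t = Zt e b (Suc m)" using T_ne_v0 False by metis
      then have "\<not> (zero_free b (q ^ m) (fst (pre e f)) \<and> zero_free b (q ^ m) (snd (pre e f)))"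
        using good_of_zero_free \<open>\<not> good t\<close> by blast
      then obtain x where x: "av (x - b) < q ^ m" "x \<in> Z e" unfolding zero_free_def Z_def by auto
      have "m < N e x" using N[OF x(2) _ b(1) x(1)] \<open>\<not> good t\<close> b by (meson not_le)
      moreover have "t \<in> K e x m" unfolding K_def using b x by blast
      ultimately show ?thesis using x by blast
    qed simp
  qed
  moreover have "finite (insert v0 (\<Union>e\<in>UNIV. \<Union>x\<in>Z e. \<Union>m\<in>{..<N e x}. K e x m))"
    using finZ finK by auto
  ultimately show ?thesis by (rule finite_subset)
qed

text \<open>Both charts are used so that critical behaviour at infinity, which is
  \<open>x = 0\<close> in the chart 1/z, is captured.\<close>

definition Crit :: "'k berk set" where
  "Crit = (\<Union>e\<in>UNIV. (\<lambda>x. J e (Fin (gs x 0))) ` {x. poly (wronskian (pre e f)) x = 0})"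

lemma finite_Crit: "finite Crit"
  unfolding Crit_def using wronskian_nonzero[OF nondeg_pre[OF nd]] by (intro finite_UN_I finite_imageI poly_roots_finite) auto

text \<open>Without critical points the image radius is proportional to the radius. Going down from
  \<open>par t\<close> to \<open>t\<close> multiplies both by \<open>q\<close>, so
  \<open>F t\<close> is exactly one level below \<open>F (par t)\<close>.\<close>

lemma noncritical: assumes t: "t \<in> T" "t \<notin> B" and C: "\<And>c. c \<in> Crit \<Longrightarrow> c \<notin> Dd t" shows "par (F t) = F (par t)"
proof -
  have t': "t \<noteq> v0" "good t" using t by (auto simp: B_def)
  obtain e a n where a: "valid e a" "t = Zt e a (Suc n)" by (rule T_ne_v0[OF t(1) t'(1)])
  obtain e' c j G where G: "valid e' c" "G = cj e' f e" "c = poly (fst G) a / poly (snd G) a"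
    "zero_free a (q ^ n) (snd G)" "q ^ j = gs a (q ^ n) (fst G - smult c (snd G)) / av (poly (snd G) a)"
    "F (par t) = Zt e' c j" by (rule good_image[OF a t'(2)])
  have nG: "nondeg G" using G nondeg_cj[OF nd] by simp
  have Dt: "Dd t = J e ` disk a (q ^ n)" using Dd_Zt[OF a(1)] a(2) by simp
  have W: "zero_free a (q ^ n) (wronskian G)" unfolding zero_free_def
  proof (intro allI impI notI)
    fix x assume x: "av (x - a) < q ^ n" "poly (wronskian G) x = 0"
    then have "poly (wronskian (pre e f)) x = 0" by (simp add: G(2) wronskian_cj split: if_splits)
    then have "J e (Fin (gs x 0)) \<in> Crit" unfolding Crit_def by blast
    moreover have "Fin (gs x 0) \<in> disk a (q ^ n)" using gs_sn[of 0 x] x by (simp add: disk_def gs_Lin)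
    ultimately show False using C Dt by blast
  qed
  have Qa: "poly (snd G) a \<noteq> 0" using G(4) unfolding zero_free_def by auto
  have le: "q ^ Suc n \<le> q ^ n" by (simp only: q_pow_le)
  have gQ: "gs a (q ^ Suc n) (snd G) = av (poly (snd G) a)"
    using zero_free_gs[OF G(4) _ le] q_pow(1)[of "Suc n"] by (simp add: less_imp_le del: q_pow power_Suc)
  have "gs a (q ^ Suc n) (fst G - smult c (snd G)) * q ^ n = gs a (q ^ n) (fst G - smult c (snd G)) * q ^ Suc n"
    by (rule noncritical_disk[OF nG G(4) q_pow(1) W G(3) q_pow(1) le])
  then have "gs a (q ^ Suc n) (fst G - smult c (snd G)) = gs a (q ^ n) (fst G - smult c (snd G)) * q"
    using q_pow(1)[of n] unif(2) by (simp add: mult_ac)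
  then have R: "q ^ Suc j = gs a (q ^ Suc n) (fst G - smult c (snd G)) / gs a (q ^ Suc n) (snd G)"
    using G(5) gQ by simp
  have aa: "av (a - a) \<le> q ^ Suc n" using q_pow(1)[of "Suc n"] by (simp add: less_imp_le del: q_pow power_Suc)
  have "berk_map av G (Fin (gs a (q ^ Suc n))) = Fin (gs c (q ^ Suc j))"
    by (rule berk_map_gs(1)[OF nG q_pow(1) aa gQ[symmetric] G(3) R])
  moreover have "berk_map av G (Fin (gs a (q ^ Suc n))) = J e' (F t)"
    unfolding G(2) using berk_map_cj[OF nd, of "Fin (gs a (q ^ Suc n))" e' e] gsq_sn[of a "Suc n"] a(2) by (simp add: Zt_def del: power_Suc)
  ultimately have "F t = J e' (Fin (gs c (q ^ Suc j)))" using J_J F_BP T_BP[OF t(1)] by metis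
  then have "F t = Zt e' c (Suc j)" by (simp only: Zt_def)
  then show ?thesis using par_Zt[OF G(1)] G(6) by simp
qed

sublocale tree_dynamics T v0 par ht F g B Crit "\<lambda>c t. c \<in> Dd t"
proof
  show "F x \<in> T" if "x \<in> T" for x using F_T that .
  show "finite B" by (rule finite_B)
  show "v0 \<in> B" using root_in by (simp add: B_def)
  show "x \<in> B" if y: "y \<in> B" "anc x y" for x y
  proof (rule ccontr)
    assume x: "x \<notin> B"
    have yT: "y \<in> T" using y by (auto simp: B_def)
    then have xT: "x \<in> T" using anc_in y by blast
    then have x': "x \<noteq> v0" "good x" using x by (auto simp: B_def)
    have "y \<noteq> v0" using y anc_par_cases[OF yT y(2)] x' by auto
    moreover have "good y" using x'(2) Dd_mono[OF yT x'(1) y(2)] unfolding good_def by blast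
    ultimately show False using y by (auto simp: B_def)
  qed
  show "g x \<in> T \<and> g x \<noteq> v0 \<and> par (g x) = F (par x)" if "x \<in> T" "x \<notin> B" for x using g_props[OF that] by auto
  show g_le: "anc (g x) (F y)" if x: "x \<in> T" "x \<notin> B" "y \<in> T" "anc x y" for x y
  proof -
    have "x \<noteq> v0" using x by (auto simp: B_def)
    then have "y \<in> Dd x" using Dd_iff x by blast
    then have "F y \<in> Dd (g x)" using g_props(4)[OF x(1,2)] by auto
    then show ?thesis using Dd_iff g_props(1,2)[OF x(1,2)] F_T[OF x(3)] by blast
  qed
  show "finite Crit" by (rule finite_Crit)
  show "anc x y \<or> anc y x" if "x \<in> T" "y \<in> T" "x \<noteq> v0" "y \<noteq> v0" "c \<in> Dd x" "c \<in> Dd y" for c x y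
    using Dd_comparable that by blast
  \<comment> \<open>Both vertices are children of \<open>F (par x)\<close> on the branch to
    \<open>F x\<close>.\<close>
  show "g x = F x" if x: "x \<in> T" "x \<notin> B" and c: "\<And>c. c \<in> Crit \<Longrightarrow> c \<notin> Dd x" for x
  proof -
    have le: "anc (g x) (F x)" using g_le[OF x x(1)] by simp
    have ne: "F x \<noteq> v0" using anc_par_cases[OF F_T[OF x(1)] le] g_props(2)[OF x] by auto
    show ?thesis
      using child_unique[OF F_T[OF x(1)] le anc_refl g_props(2)[OF x] ne] g_props(3)[OF x] noncritical[OF x c] by simp
  qed
qed

end

section \<open>Attracting points and stable vertex sets\<close>

context berk_dynamics
begin

lemma F_iter_Dd: "(\<And>j. j < p \<Longrightarrow> (g ^^ j) t \<in> T - B) \<Longrightarrow> (F ^^ p) ` Dd t \<subseteq> Dd ((g ^^ p) t)"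
proof (induction p)
  case (Suc p)
  have "(F ^^ Suc p) ` Dd t = F ` ((F ^^ p) ` Dd t)" by (simp add: image_comp)
  also have "\<dots> \<subseteq> F ` Dd ((g ^^ p) t)" using Suc by (intro image_mono) auto
  also have "\<dots> \<subseteq> Dd (g ((g ^^ p) t))" using Suc.prems[of p] by (intro g_props(4)) auto
  finally show ?case by simp
qed auto

lemma multiplier_finite: "multiplier av h (Fin (gs x 0)) = rat_deriv_at h x"
proof -
  have "(SOME a. Fin (gs x 0) = typeI_pt av a) = x"
  proof (rule some_equality)
    fix a assume "Fin (gs x 0) = typeI_pt av a"
    then have "av (x - a) \<le> 0" using gs_inj[of 0 0 x a] by (simp add: typeI_gs)
    then have "av (x - a) = 0" using av_nonneg[of "x - a"] by linarith
    then show "a = x" by simp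
  qed (simp add: typeI_gs)
  then show ?thesis by (simp add: multiplier_def)
qed

lemma poly_cj_inverse:
  assumes "nondeg h" "y \<noteq> 0"
  shows "poly (fst (cj True h True)) y = y ^ rat_deg h * poly (snd h) (1 / y)"
    and "poly (snd (cj True h True)) y = y ^ rat_deg h * poly (fst h) (1 / y)"
  using assms poly_hcomp_eval[OF rat_deg_le(2)[of h], of "[:0, 1:]" y 1] poly_hcomp_eval[OF rat_deg_le(1)[of h], of "[:0, 1:]" y 1]
  by (simp_all add: cj_def pre_def rat_comp_def iota_def)

lemma cj_True_rev: "cj True h True = (rev_deg (rat_deg h) (snd h), rev_deg (rat_deg h) (fst h))"
  by (simp add: cj_def pre_def rat_comp_def iota_def hcomp_rev_deg rat_deg_le)

text \<open>In the chart at infinity, a nonzero fixed point x of the conjugated map corresponds to the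
  finite fixed point 1/x of h, and the contraction estimate transfers since z -> 1/z scales small
  disks around x by the constant factor |x|^(-2).\<close>
lemma multiplier_small:
  assumes h: "nondeg h" and r: "0 < r'" "r' < r" and sub: "berk_map av (cj e h e) ` disk a r \<subseteq> disk a r'"
  shows "\<exists>x. av (x - a) < r \<and> berk_map av h (J e (Fin (gs x 0))) = J e (Fin (gs x 0)) \<and>
    is_typeI av (J e (Fin (gs x 0))) \<and> av (multiplier av h (J e (Fin (gs x 0)))) < 1"
proof -
  define H where "H = cj e h e"
  have nH: "nondeg H" using nondeg_cj[OF h] H_def by simp
  obtain x l \<epsilon> where x: "av (x - a) < r" "0 \<le> l" "l < 1" "\<epsilon> > 0" "poly (snd H) x \<noteq> 0" "poly (fst H) x / poly (snd H) x = x"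
    and con: "\<And>y. av (y - x) < \<epsilon> \<Longrightarrow> poly (snd H) y \<noteq> 0 \<and> av (poly (fst H) y / poly (snd H) y - x) \<le> l * av (y - x)"
    using contraction_fixed_point[OF nH r sub[folded H_def]] by blast
  define X where "X = J e (Fin (gs x 0))"
  have xB: "Fin (gs x 0) \<in> BP av" using gs_sn by simp
  have "berk_map av H (Fin (gs x 0)) = Fin (gs x 0)" using berk_map_typeI[OF nH x(5)] x(6) by simp
  then have "J e (berk_map av h X) = Fin (gs x 0)"
    using berk_map_cj[OF h xB, of e e] by (simp add: H_def X_def)
  then have fixed: "berk_map av h X = X"
    using J_J[OF berk_map_BP[OF h J_BP[OF xB]], of e e] X_def by metis
  have dH: "av (rat_deriv_at H x) \<le> l" by (rule rat_deriv_le[OF x(5,6,2,4) con])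
  have "is_typeI av X \<and> av (multiplier av h X) < 1"
  proof (cases e)
    case False
    then have "X = Fin (gs x 0)" "H = h" by (simp_all add: X_def J_def H_def cj_def pre_def)
    then show ?thesis using dH x(3) multiplier_finite[of h x] by (auto simp: is_typeI_def typeI_gs)
  next
    case e: True
    have H: "H = cj True h True" using e H_def by simp
    show ?thesis
    proof (cases "x = 0")
      case True
      then have "X = Inf" using e by (simp add: X_def J_def berk_map_def iota_def gs_zero)
      then have "multiplier av h X = rat_deriv_at H x" using True H cj_True_rev by (simp add: multiplier_def)
      then show ?thesis using dH x(3) \<open>X = Inf\<close> by (simp add: is_typeI_def)
    next
      case x0: False
      define y where "y = 1 / x"
      have y0: "y \<noteq> 0" "1 / y = x" using x0 by (auto simp: y_def)
      have Xy: "X = Fin (gs y 0)"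
        using e berk_map_typeI[OF nondeg_iota(1), of x] x0 by (simp add: X_def J_def iota_def y_def)
      have conv: "poly (snd h) (1 / z) \<noteq> 0 \<and> poly (fst h) (1 / z) \<noteq> 0 \<and>
        poly (fst H) z / poly (snd H) z = poly (snd h) (1 / z) / poly (fst h) (1 / z) \<and> av (poly (fst H) z / poly (snd H) z) = av x"
        if "av (z - x) < min \<epsilon> (av x)" for z
      proof -
        have z0: "z \<noteq> 0" using that by auto
        have c: "poly (snd H) z \<noteq> 0" "av (poly (fst H) z / poly (snd H) z - x) \<le> l * av (z - x)" using con[of z] that by auto
        have "l * av (z - x) \<le> av (z - x)" using x by (simp add: mult_left_le_one_le)
        then have "av (poly (fst H) z / poly (snd H) z - x) < av x" using c that by auto
        then have "av (poly (fst H) z / poly (snd H) z) = av x"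
          using av_add_eq[of "poly (fst H) z / poly (snd H) z - x" x] by simp
        then show ?thesis using x0 z0 c poly_cj_inverse[OF h z0] H by (auto simp: av_divide)
      qed
      have fy: "poly (snd h) y \<noteq> 0" "poly (fst h) y / poly (snd h) y = y"
      proof -
        have *: "poly (snd h) y \<noteq> 0 \<and> poly (fst h) y \<noteq> 0 \<and> x = poly (snd h) y / poly (fst h) y"
          using conv[of x] x x0 by (simp add: y_def)
        then have "poly (fst h) y / poly (snd h) y = 1 / x" by simp
        then show "poly (fst h) y / poly (snd h) y = y" by (simp only: y_def[symmetric])
        show "poly (snd h) y \<noteq> 0" using * by blast
      qed
      define \<delta> where "\<delta> = min (av y) (min \<epsilon> (av x) / av x ^ 2)"
      have \<delta>: "\<delta> > 0" using x(4) x0 y0(1) by (simp add: \<delta>_def)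
      have "av (rat_deriv_at h y) \<le> l"
      proof (rule rat_deriv_le[OF fy x(2) \<delta>])
        fix w assume w: "av (w - y) < \<delta>"
        then have "av (w - y) < av y" by (simp add: \<delta>_def)
        then have aw: "av w = av y" using av_add_eq[of "w - y" y] by simp
        then have w0: "w \<noteq> 0" using y0 by auto
        define z where "z = 1 / w"
        have avy: "av y = 1 / av x" by (simp add: y_def av_divide)
        have "z - x = 1 / w - 1 / y" by (simp add: z_def y0(2))
        also have "\<dots> = (y - w) / (w * y)" using w0 y0(1) by (simp add: field_simps)
        finally have "z - x = (y - w) / (w * y)" .
        then have zx: "av (z - x) = av (w - y) * av x ^ 2"
          using av_commute[of w y] aw avy x0 by (simp add: av_divide av_mult power2_eq_square)
        have "av (w - y) < min \<epsilon> (av x) / av x ^ 2" using w by (simp add: \<delta>_def)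
        then have zlt: "av (z - x) < min \<epsilon> (av x)" unfolding zx using x0 by (simp add: pos_less_divide_eq)
        have zw: "1 / z = w" using w0 by (simp add: z_def)
        note cz = conv[OF zlt, unfolded zw]
        define v where "v = poly (fst H) z / poly (snd H) z"
        have v: "v = poly (snd h) w / poly (fst h) w" "av v = av x" using cz by (auto simp: v_def)
        have v0: "v \<noteq> 0" using v(2) x0 by auto
        have "poly (fst h) w / poly (snd h) w - y = 1 / v - 1 / x" using v(1) y_def by simp
        also have "\<dots> = (x - v) / (v * x)" using v0 x0 by (simp add: field_simps)
        finally have "av (poly (fst h) w / poly (snd h) w - y) = av (v - x) / av x ^ 2"
          using v(2) av_commute[of x v] by (simp add: av_divide av_mult power2_eq_square)
        also have "\<dots> \<le> l * av (z - x) / av x ^ 2"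
          using con[of z] zlt by (intro divide_right_mono) (auto simp: v_def)
        also have "\<dots> = l * av (w - y)" using zx x0 by simp
        finally show "poly (snd h) w \<noteq> 0 \<and> av (poly (fst h) w / poly (snd h) w - y) \<le> l * av (w - y)" using cz by simp
      qed
      then show ?thesis using Xy x(3) multiplier_finite[of h y] by (auto simp: is_typeI_def typeI_gs)
    qed
  qed
  then show ?thesis using x(1) fixed X_def by blast
qed

text \<open>Since \<open>t\<close> is an ancestor of its image disk \<open>u\<close>, both can be
  written with one chart and one centre \<open>a\<close>; the conjugated iterate then maps a disk
  into a concentric smaller one.\<close>

lemma contracting_attracting:
  assumes t: "t \<in> T" "t \<noteq> v0" and k: "contracting t"
  shows "\<exists>x\<in>Dd t. attracting_typeI_periodic av f x"
proof -
  obtain p where p: "p \<ge> 1" "anc t ((g ^^ p) t)" "t \<noteq> (g ^^ p) t" "\<And>j. j \<le> p \<Longrightarrow> (g ^^ j) t \<in> T - B"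
    using k unfolding contracting_def by auto
  define u where "u = (g ^^ p) t"
  have uT: "u \<in> T" "u \<noteq> v0" using p(4)[of p] root_B by (auto simp: u_def)
  obtain e a n' where u: "valid e a" "u = Zt e a (Suc n')" by (rule T_ne_v0[OF uT])
  obtain m where m: "m \<le> Suc n'" "t = Zt e a m" using p(2) anc_Zt[OF u(1)] u(2) u_def by auto
  then obtain n where n: "m = Suc n" using t(2) Zt_0[OF u(1)] by (cases m) auto
  have nn: "n < n'" using m n p(3) u u_def by (cases "n = n'") auto
  have Dt: "Dd t = J e ` disk a (q ^ n)" "Dd u = J e ` disk a (q ^ n')" using Dd_Zt[OF u(1)] m n u by auto
  define h where "h = rat_iter f p"
  have h: "nondeg h" "\<And>z. z \<in> BP av \<Longrightarrow> berk_map av h z = (F ^^ p) z"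
    using rat_iter_correct[OF nd, of p] by (auto simp: h_def)
  have sub: "berk_map av (cj e h e) ` disk a (q ^ n) \<subseteq> disk a (q ^ n')"
  proof
    fix w assume "w \<in> berk_map av (cj e h e) ` disk a (q ^ n)"
    then obtain z where z: "z \<in> disk a (q ^ n)" "w = berk_map av (cj e h e) z" by auto
    then have zB: "z \<in> BP av" using disk_BP by auto
    have "(F ^^ p) (J e z) \<in> Dd u" using F_iter_Dd[of p t] p(4) z Dt unfolding u_def by fastforce
    then obtain y where y: "y \<in> disk a (q ^ n')" "berk_map av h (J e z) = J e y" using Dt h(2)[OF J_BP[OF zB]] by auto
    then have "w = J e (J e y)" using z berk_map_cj[OF h(1) zB] by simp
    then show "w \<in> disk a (q ^ n')" using y J_J disk_BP by (metis subsetD)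
  qed
  have "q ^ n' < q ^ n" using nn q_pow_less by simp
  then obtain x where x: "av (x - a) < q ^ n" "berk_map av h (J e (Fin (gs x 0))) = J e (Fin (gs x 0))"
    "is_typeI av (J e (Fin (gs x 0)))" "av (multiplier av h (J e (Fin (gs x 0)))) < 1"
    using multiplier_small[OF h(1) q_pow(1) _ sub] by blast
  have "Fin (gs x 0) \<in> disk a (q ^ n)" using gs_sn[of 0 x] x(1) by (simp add: disk_def gs_Lin)
  then have "J e (Fin (gs x 0)) \<in> Dd t" using Dt by blast
  moreover have "(F ^^ p) (J e (Fin (gs x 0))) = J e (Fin (gs x 0))"
    using x(2) h(2)[OF J_BP, of "Fin (gs x 0)" e] gs_sn[of 0 x] by simp
  then have "attracting_typeI_periodic av f (J e (Fin (gs x 0)))"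
    unfolding attracting_typeI_periodic_def using x p(1) h_def by blast
  ultimately show ?thesis by blast
qed

text \<open>Each member of the forward orbit is the domain containing some iterate of
  \<open>x\<close>, and a periodic \<open>x\<close> has only finitely many iterates. This separates
  alternatives (ii) and (iii).\<close>

lemma wandering_no_periodic:
  assumes "wandering av f G U" "x \<in> U" "n \<ge> 1" "(F ^^ n) x = x" shows False
proof -
  have per: "(F ^^ m) x \<in> (\<lambda>m. (F ^^ m) x) ` {..<n}" for m
  proof -
    have "(F ^^ m) x = (F ^^ (m mod n)) x" by (rule funpow_mod_eq[OF assms(4), symmetric])
    then show ?thesis using assms(3) by auto
  qed
  have "\<exists>y \<in> (\<lambda>m. (F ^^ m) x) ` {..<n}. V = (THE V. Gamma_domain av G V \<and> y \<in> V)"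
    if "V \<in> forward_orbit av f G U" for V
  proof -
    from that obtain m where m: "Gamma_domain av G V" "(F ^^ m) ` U \<subseteq> V"
      unfolding forward_orbit_def F_domain_def by auto
    then have "(F ^^ m) x \<in> V" using assms(2) by auto
    then have "V = (THE V. Gamma_domain av G V \<and> (F ^^ m) x \<in> V)"
      using m Gamma_domain_unique by (intro the_equality[symmetric]) blast+
    then show ?thesis using per[of m] by blast
  qed
  then have "forward_orbit av f G U \<subseteq> (\<lambda>y. THE V. Gamma_domain av G V \<and> y \<in> V) ` (\<lambda>m. (F ^^ m) x) ` {..<n}" by blast
  then have "finite (forward_orbit av f G U)" by (rule finite_subset) simp
  then show False using assms(1) unfolding wandering_def by simp
qed

lemma Dd_inj: "t \<in> T \<Longrightarrow> t \<noteq> v0 \<Longrightarrow> u \<in> T \<Longrightarrow> u \<noteq> v0 \<Longrightarrow> Dd t = Dd u \<Longrightarrow> t = u"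
  using Dd_self Dd_iff anc_antisym by metis

lemma exists_stable_vertex_set:
  assumes G: "finite G" "G \<subseteq> T"
  shows "\<exists>G'. finite G' \<and> G \<subseteq> G' \<and> G' \<subseteq> T \<and> (\<forall>z\<in>G'. F z \<in> G' \<or>
    (\<exists>U b. F_disk av f G' U \<and> wandering av f G' U \<and> F z \<in> U \<and> bt frontier_of U = {b} \<and> b \<in> G' \<and> periodic_pt av f b) \<or>
    (\<exists>U. F_disk av f G' U \<and> F z \<in> U \<and> (\<exists>x\<in>U. attracting_typeI_periodic av f x)))"
proof -
  obtain G' Om where G': "finite G'" "G \<subseteq> G'" "G' \<subseteq> T" and Om: "Om \<subseteq> T - B"
    and sys0: "\<forall>t\<in>Om. par t \<in> G' \<and> (\<exists>t'\<in>Om. anc t' (g t)) \<and> (\<forall>a\<in>G'. \<not> anc t a) \<and> (drifting Om t \<or> contracting t)"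
    and next': "\<forall>a\<in>G'. F a \<in> G' \<or> enters Om (F a)"
    using stable_extension[OF G] by (elim exE conjE)
  have sys: "par t \<in> G'" "\<exists>t'\<in>Om. anc t' (g t)" "\<And>a. a \<in> G' \<Longrightarrow> \<not> anc t a" "drifting Om t \<or> contracting t" if "t \<in> Om" for t
    using sys0 that by auto
  have OmT: "t \<in> T" "t \<noteq> v0" "t \<notin> B" if "t \<in> Om" for t using Om that root_B by auto
  have disj: "Dd t \<inter> G' = {}" if "t \<in> Om" for t
    using sys(3)[OF that] Dd_iff[OF OmT(1,2)[OF that]] G'(3) by blast
  have dom: "Gamma_domain av G' (Dd t)" if "t \<in> Om" for t
    using Dd_topology[OF OmT(1,2)[OF that]] Dd_self[OF OmT(1,2)[OF that]] sys(1)[OF that] disj[OF that]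
    by (intro Gamma_domainI) auto
  \<comment> \<open>The system is closed under images: an iterate of a disk stays inside disks of
    \<open>Om\<close>, which miss \<open>G'\<close>. This is the F-domain property.\<close>
  have iter: "\<exists>t'\<in>Om. (F ^^ n) ` Dd t \<subseteq> Dd t'" if "t \<in> Om" for t n
  proof (induction n)
    case 0 then show ?case using that by auto
  next
    case (Suc n)
    then obtain t' where t': "t' \<in> Om" "(F ^^ n) ` Dd t \<subseteq> Dd t'" by auto
    obtain t'' where t'': "t'' \<in> Om" "anc t'' (g t')" using sys(2)[OF t'(1)] by auto
    have "(F ^^ Suc n) ` Dd t = F ` ((F ^^ n) ` Dd t)" by (simp add: image_comp)
    also have "\<dots> \<subseteq> F ` Dd t'" using t' by (intro image_mono)
    also have "\<dots> \<subseteq> Dd (g t')" using OmT[OF t'(1)] by (intro g_props(4))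
    also have "\<dots> \<subseteq> Dd t''" using g_props(1)[of t'] OmT[OF t'(1)] OmT[OF t''(1)] t''(2) by (intro Dd_mono) auto
    finally show ?case using t'' by blast
  qed
  have Fdom: "F_domain av f G' (Dd t)" if "t \<in> Om" for t
    unfolding F_domain_def using dom[OF that] iter[OF that] disj by blast
  have Fdisk: "F_disk av f G' (Dd t)" if "t \<in> Om" for t
    unfolding F_disk_def Gamma_disk_def using Fdom[OF that] dom[OF that] Dd_topology(3)[OF OmT(1,2)[OF that]] by blast
  have cases: "(\<exists>U b. F_disk av f G' U \<and> wandering av f G' U \<and> F z \<in> U \<and> bt frontier_of U = {b} \<and> b \<in> G' \<and> periodic_pt av f b) \<or>
    (\<exists>U. F_disk av f G' U \<and> F z \<in> U \<and> (\<exists>x\<in>U. attracting_typeI_periodic av f x))" if z: "z \<in> G'" "F z \<notin> G'" for z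
  proof -
    obtain t where t: "t \<in> Om" "anc t (F z)" using next' z unfolding enters_def by auto
    have Fz: "F z \<in> Dd t" using Dd_iff[OF OmT(1,2)[OF t(1)]] F_T t(2) z(1) G'(3) by auto
    show ?thesis
    proof (cases "contracting t")
      case True
      then show ?thesis using contracting_attracting[OF OmT(1,2)[OF t(1)]] Fdisk[OF t(1)] Fz by blast
    next
      case False
      then have k: "drifting Om t" using sys(4)[OF t(1)] by blast
      then have gn: "(g ^^ n) t \<in> Om" for n unfolding drifting_def by blast
      \<comment> \<open>Distinct vertices have distinct disks, so drifting gives infinitely many
        members of the forward orbit.\<close>
      have "inj (\<lambda>n. Dd ((g ^^ n) t))"
      proof (rule injI)
        fix n m assume "Dd ((g ^^ n) t) = Dd ((g ^^ m) t)"
        then have "(g ^^ n) t = (g ^^ m) t" using Dd_inj OmT(1,2)[OF gn] by blast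
        then show "n = m" using k unfolding drifting_def inj_def by blast
      qed
      then have "infinite (range (\<lambda>n. Dd ((g ^^ n) t)))" by (simp add: finite_image_iff)
      moreover have "range (\<lambda>n. Dd ((g ^^ n) t)) \<subseteq> forward_orbit av f G' (Dd t)"
      proof
        fix V assume "V \<in> range (\<lambda>n. Dd ((g ^^ n) t))"
        then obtain n where n: "V = Dd ((g ^^ n) t)" by auto
        have "(F ^^ n) ` Dd t \<subseteq> V" unfolding n using gn Om by (intro F_iter_Dd) auto
        then show "V \<in> forward_orbit av f G' (Dd t)" unfolding forward_orbit_def using Fdom[OF gn] n by blast
      qed
      ultimately have "wandering av f G' (Dd t)" unfolding wandering_def using finite_subset by blast
      moreover have "periodic_pt av f (par t)" using k unfolding drifting_def periodic_pt_def by blast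
      ultimately show ?thesis
        using Fdisk[OF t(1)] Fz Dd_topology(3)[OF OmT(1,2)[OF t(1)]] sys(1)[OF t(1)] by blast
    qed
  qed
  show ?thesis
  proof (intro exI[of _ G'] conjI ballI G')
    fix z assume z: "z \<in> G'"
    show "F z \<in> G' \<or>
      (\<exists>U b. F_disk av f G' U \<and> wandering av f G' U \<and> F z \<in> U \<and> bt frontier_of U = {b} \<and> b \<in> G' \<and> periodic_pt av f b) \<or>
      (\<exists>U. F_disk av f G' U \<and> F z \<in> U \<and> (\<exists>x\<in>U. attracting_typeI_periodic av f x))"
    proof (cases "F z \<in> G'")
      case True then show ?thesis by (rule disjI1)
    next
      case False then show ?thesis by (rule disjI2[OF cases[OF z]])
    qed
  qed
qed

end

theorem theorem3p10:
  fixes absv :: "'k::field \<Rightarrow> real" and L :: "'k set"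
    and f :: "'k poly \<times> 'k poly" and G :: "'k berk set"
  assumes "berk_setting absv L"
    and "rat_over L f" and "rat_deg f \<ge> 2"
    and "L_split_vertex_set absv L G"
  shows "\<exists>G'. L_split_vertex_set absv L G' \<and> G \<subseteq> G' \<and>
    (\<forall>z\<in>G'.
      (let c1 = berk_map absv f z \<in> G';
           c2 = (\<exists>U b. F_disk absv f G' U \<and> wandering absv f G' U \<and> berk_map absv f z \<in> U \<and>
                   berk_top absv frontier_of U = {b} \<and> b \<in> G' \<and> periodic_pt absv f b);
           c3 = (\<exists>U. F_disk absv f G' U \<and> berk_map absv f z \<in> U \<and>
                   (\<exists>x\<in>U. attracting_typeI_periodic absv f x))
       in (c1 \<or> c2 \<or> c3) \<and> \<not> (c1 \<and> c2) \<and> \<not> (c1 \<and> c3) \<and> \<not> (c2 \<and> c3))) \<and>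
    analytically_stable absv f G'"
proof -
  interpret berk absv L
    using assms(1) unfolding berk_setting_def by unfold_locales auto
  have "nondeg f" using assms(2,3) coprime_nondeg[of f] unfolding rat_over_def by simp
  then have "ratL f" using assms(2) polyL_coeffs unfolding rat_over_def ratL_def by blast
  then interpret berk_dynamics absv L f by unfold_locales
  have G: "finite G" "G \<subseteq> T" "G \<noteq> {}" using assms(4) unfolding L_split_vertex_set_def vertex_set_def T_def by auto
  have T2: "is_typeII absv z" if "z \<in> T" for z
    using that unfolding T_def L_split_def is_typeII_def by blast
  obtain G' where G': "finite G'" "G \<subseteq> G'" "G' \<subseteq> T" and tri: "\<forall>z\<in>G'. F z \<in> G' \<or>
    (\<exists>U b. F_disk absv f G' U \<and> wandering absv f G' U \<and> F z \<in> U \<and> bt frontier_of U = {b} \<and> b \<in> G' \<and> periodic_pt absv f b) \<or>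
    (\<exists>U. F_disk absv f G' U \<and> F z \<in> U \<and> (\<exists>x\<in>U. attracting_typeI_periodic absv f x))"
    using exists_stable_vertex_set[OF G(1,2)] by (elim exE conjE)
  have split: "L_split_vertex_set absv L G'"
    unfolding L_split_vertex_set_def vertex_set_def using G' G T2 by (auto simp: T_def)
  have domain: "Gamma_domain absv G' U" if "F_disk absv f G' U" for U
    using that unfolding F_disk_def F_domain_def by blast
  have out: "F z \<notin> G'" if "F_disk absv f G' U" "F z \<in> U" for U z
    using Gamma_domain_disjoint[OF domain[OF that(1)]] that(2) by blast
  \<comment> \<open>\<open>F z\<close> lies in only one component, so (ii) and (iii) would concern
    the same disk, wandering and yet containing a periodic point.\<close>
  have excl: False if "F_disk absv f G' U" "wandering absv f G' U" "F z \<in> U"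
    "F_disk absv f G' V" "F z \<in> V" "x \<in> V" "attracting_typeI_periodic absv f x" for U V x z
  proof -
    have "U = V" using Gamma_domain_unique[OF domain domain] that by blast
    then show False using wandering_no_periodic[OF that(2)] that(6,7) unfolding attracting_typeI_periodic_def by blast
  qed
  have "analytically_stable absv f G'" unfolding analytically_stable_def
  proof
    fix z assume "z \<in> G'"
    from tri[rule_format, OF this] show "F z \<in> G' \<or> (\<exists>U. F_domain absv f G' U \<and> F z \<in> U)" unfolding F_disk_def by blast
  qed
  note stable = this
  have trichotomy: "(let c1 = F z \<in> G';
           c2 = (\<exists>U b. F_disk absv f G' U \<and> wandering absv f G' U \<and> F z \<in> U \<and>
                   bt frontier_of U = {b} \<and> b \<in> G' \<and> periodic_pt absv f b);
           c3 = (\<exists>U. F_disk absv f G' U \<and> F z \<in> U \<and> (\<exists>x\<in>U. attracting_typeI_periodic absv f x))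
       in (c1 \<or> c2 \<or> c3) \<and> \<not> (c1 \<and> c2) \<and> \<not> (c1 \<and> c3) \<and> \<not> (c2 \<and> c3))" if "z \<in> G'" for z
    unfolding Let_def
  proof (intro conjI notI, goal_cases)
    case 1 then show ?case using tri[rule_format, OF that] .
  next
    case 2 then show ?case using out by (elim conjE exE) blast
  next
    case 3 then show ?case using out by (elim conjE exE) blast
  next
    case 4 then show ?case using excl by (elim conjE exE bexE) blast
  qed
  show ?thesis
    by (intro exI[of _ G'] conjI ballI split G'(2) stable) (rule trichotomy)
qed

end
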